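(* Let $K$ be an algebraic function field in one variable with constant field $\mathbb{F}_q$, $\infty$ a fixed place of $K$ (of arbitrary degree), $A$ the ring of elements of $K$ integral outside $\infty$, $G=GL_2(A)$, $\widehat{G}=GL_2(K)$. Let $c\in\mathbb{P}^1(K)$ be represented as $(x:y)$ with $x,y\in A$, and put $J_c=xA+yA$. Let $$M=\begin{pmatrix}a&b\\c'&d\end{pmatrix}\in N_{\widehat{G}}(G)$$ with $a,b,c',d\in A$, let $\mathfrak{q}(M)=aA+bA+c'A+dA$, and let $J_{M(c)}=(ax+by)A+(c'x+dy)A$. Then in $\mathrm{Cl}(A)$ $$[J_{M(c)}]=[\mathfrak{q}(M)J_c]=[\mathfrak{q}(M)][J_c].$$ Thus, under the identifications $\mathrm{Cusp}(G)=G\backslash\mathbb{P}^1(K)\leftrightarrow\mathrm{Cl}(A)$ (via $Gc\mapsto[J_c]$) and $Quinn(G)\leftrightarrow\mathrm{Cl}(A)_2$ (via $M\mapsto[\mathfrak{q}(M)]$), the action of $Quinn(G)$ on cusps is multiplication in $\mathrm{Cl}(A)$.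
   Context: $N_{\widehat{G}}(G)$ is the normalizer of $G$ in $\widehat{G}$, $Z(K)$ the scalar matrices, $Quinn(G)=N_{\widehat{G}}(G)/Z(K)\cdot G$, acting on $\mathbb{P}^1(K)$ by Möbius transformations and hence on $G\backslash\mathbb{P}^1(K)$. $\mathrm{Cl}(A)$ is the ideal class group of $A$, $[I]$ the class of an ideal, and $\mathrm{Cl}(A)_2$ its subgroup of elements of order dividing 2. (Every element of $N_{\widehat{G}}(G)$ has a scalar multiple with entries in $A$, and $\mathfrak{q}(M)^2=(\det M)$.) *)

theory Defs
  imports
    "HOL-Analysis.Cartesian_Space"
    "HOL-Algebra.Algebra"
    "HOL-Algebra.Algebraic_Closure_Type"
begin

text \<open>
  The function field is the type \<open>'k::field\<close> itself, regarded as an algebra record so that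
  its subrings, ideals and subfields are those of the algebra library.
\<close>

abbreviation fld :: "'k::field ring"
  where "fld \<equiv> ring_of_type_algebra"

abbreviation subring_of :: "'k::field set \<Rightarrow> 'k ring"
  where "subring_of A \<equiv> fld\<lparr>carrier := A\<rparr>"


section \<open>Function fields and places\<close>

text \<open>
  The last conjunct says that \<open>k\<close> is the full constant field, i.e. algebraically closed
  in the function field.
\<close>

definition function_field_over_finite_field :: "'k::field set \<Rightarrow> bool"
  where "function_field_over_finite_field k \<longleftrightarrow>
    subfield k fld \<and> finite k \<and>
    (\<exists>t. (ring.transcendental fld over k) t \<and>
         (ring.finite_dimension fld over generate_field fld (insert t k)) UNIV) \<and>
    (\<forall>z. (ring.algebraic fld over k) z \<longrightarrow> z \<in> k)"

definition valuation_ring :: "'k::field set \<Rightarrow> 'k set \<Rightarrow> bool"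
  where "valuation_ring k V \<longleftrightarrow>
    subring V fld \<and> k \<subset> V \<and> V \<subset> UNIV \<and> (\<forall>z. z \<noteq> 0 \<longrightarrow> z \<in> V \<or> inverse z \<in> V)"

text \<open>A place is the maximal ideal of a valuation ring, which it determines.\<close>

definition place_with_ring :: "'k::field set \<Rightarrow> 'k set \<Rightarrow> 'k set \<Rightarrow> bool"
  where "place_with_ring k V P \<longleftrightarrow> valuation_ring k V \<and> maximalideal P (subring_of V)"

definition is_place :: "'k::field set \<Rightarrow> 'k set \<Rightarrow> bool"
  where "is_place k P \<longleftrightarrow> (\<exists>V. place_with_ring k V P)"

definition integral_outside :: "'k::field set \<Rightarrow> 'k set \<Rightarrow> 'k set"
  where "integral_outside k Q =
    {z. \<forall>V P. place_with_ring k V P \<and> P \<noteq> Q \<longrightarrow> z \<in> V}"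


section \<open>The ideal class group\<close>

definition fractional_ideal :: "'k::field set \<Rightarrow> 'k set \<Rightarrow> bool"
  where "fractional_ideal A I \<longleftrightarrow>
    subgroup I (add_monoid fld) \<and> (\<forall>r\<in>A. \<forall>z\<in>I. r * z \<in> I) \<and>
    (\<exists>d\<in>A. d \<noteq> 0 \<and> (\<forall>z\<in>I. d * z \<in> A))"

definition fractional_ideals :: "'k::field set \<Rightarrow> 'k set monoid"
  where "fractional_ideals A =
    \<lparr>carrier = {I. fractional_ideal A I \<and> I \<noteq> {0}}, monoid.mult = ideal_prod fld, one = A\<rparr>"

definition principal_fractional_ideals :: "'k::field set \<Rightarrow> 'k set set"
  where "principal_fractional_ideals A = {(\<lambda>r. z * r) ` A | z. z \<noteq> 0}"

definition class_group :: "'k::field set \<Rightarrow> 'k set set monoid"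
  where "class_group A = fractional_ideals A Mod principal_fractional_ideals A"

definition ideal_class :: "'k::field set \<Rightarrow> 'k set \<Rightarrow> 'k set set"
  where "ideal_class A I = principal_fractional_ideals A #>\<^bsub>fractional_ideals A\<^esub> I"

definition class_group_2 :: "'k::field set \<Rightarrow> 'k set set monoid"
  where "class_group_2 A = (class_group A)
    \<lparr>carrier := {C \<in> carrier (class_group A).
       C \<otimes>\<^bsub>class_group A\<^esub> C = \<one>\<^bsub>class_group A\<^esub>}\<rparr>"


section \<open>General linear groups, the projective line, cusps\<close>

definition mat2 :: "'k \<Rightarrow> 'k \<Rightarrow> 'k \<Rightarrow> 'k \<Rightarrow> 'k::field^2^2"
  where "mat2 a b c d = vector [vector [a, b], vector [c, d]]"

definition matrix_monoid :: "'k::field set \<Rightarrow> ('k^2^2) monoid"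
  where "matrix_monoid A = \<lparr>carrier = {M. \<forall>i j. M $ i $ j \<in> A}, monoid.mult = (**), one = mat 1\<rparr>"

definition GL2 :: "'k::field set \<Rightarrow> ('k^2^2) monoid"
  where "GL2 A = units_of (matrix_monoid A)"

definition scalar_matrices :: "('k::field^2^2) set"
  where "scalar_matrices = {mat z | z. z \<noteq> 0}"

definition GL2_normalizer :: "'k::field set \<Rightarrow> ('k^2^2) set"
  where "GL2_normalizer A = normalizer (GL2 UNIV) (carrier (GL2 A))"

definition scalars_GL2 :: "'k::field set \<Rightarrow> ('k^2^2) set"
  where "scalars_GL2 A = scalar_matrices <#>\<^bsub>GL2 UNIV\<^esub> carrier (GL2 A)"

definition Quinn :: "'k::field set \<Rightarrow> ('k^2^2) set monoid"
  where "Quinn A = (GL2 UNIV)\<lparr>carrier := GL2_normalizer A\<rparr> Mod scalars_GL2 A"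

definition quinn_coset :: "'k::field set \<Rightarrow> 'k^2^2 \<Rightarrow> ('k^2^2) set"
  where "quinn_coset A M = scalars_GL2 A #>\<^bsub>GL2 UNIV\<^esub> M"

text \<open>\<open>proj_point x y\<close> is the point \<open>(x : y)\<close>, as the set of its homogeneous coordinate vectors.\<close>

definition proj_point :: "'k \<Rightarrow> 'k \<Rightarrow> ('k::field^2) set"
  where "proj_point x y = {vector [z * x, z * y] | z. z \<noteq> 0}"

definition proj_line :: "('k::field^2) set set"
  where "proj_line = {proj_point x y | x y. (x, y) \<noteq> (0, 0)}"

definition moebius :: "'k::field^2^2 \<Rightarrow> ('k^2) set \<Rightarrow> ('k^2) set"
  where "moebius M p = (\<lambda>v. M *v v) ` p"

definition cusp :: "'k::field set \<Rightarrow> ('k^2) set \<Rightarrow> ('k^2) set set"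
  where "cusp A p = orbit (GL2 A) moebius p"

definition cusps :: "'k::field set \<Rightarrow> ('k^2) set set set"
  where "cusps A = orbits (GL2 A) proj_line moebius"

text \<open>
  The induced action on cusps, free of choices: for \<open>C\<close> the coset of a normalizing \<open>M\<close> and
  \<open>w\<close> the orbit of \<open>p\<close>, the set below is the orbit of \<open>M(p)\<close>.
\<close>

definition quinn_act :: "('k::field^2^2) set \<Rightarrow> ('k^2) set set \<Rightarrow> ('k^2) set set"
  where "quinn_act C w = {moebius M p | M p. M \<in> C \<and> p \<in> w}"


section \<open>The ideals attached to points and to matrices\<close>

definition point_ideal :: "'k::field set \<Rightarrow> 'k \<Rightarrow> 'k \<Rightarrow> 'k set"
  where "point_ideal A x y = (PIdl\<^bsub>subring_of A\<^esub> x) <+>\<^bsub>subring_of A\<^esub> (PIdl\<^bsub>subring_of A\<^esub> y)"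

definition matrix_ideal :: "'k::field set \<Rightarrow> 'k^2^2 \<Rightarrow> 'k set"
  where "matrix_ideal A M =
    (PIdl\<^bsub>subring_of A\<^esub> (M $ 1 $ 1)) <+>\<^bsub>subring_of A\<^esub> (PIdl\<^bsub>subring_of A\<^esub> (M $ 1 $ 2))
      <+>\<^bsub>subring_of A\<^esub> (PIdl\<^bsub>subring_of A\<^esub> (M $ 2 $ 1)) <+>\<^bsub>subring_of A\<^esub> (PIdl\<^bsub>subring_of A\<^esub> (M $ 2 $ 2))"

end

theory Submission
  imports Defs "HOL-Analysis.Determinants"
begin

text \<open>
  A subring of \<open>K\<close> containing \<open>k\<close> has finite quotients modulo nonzero elements, because elements
  independent over \<open>k\<close> modulo \<open>y\<close> are independent over \<open>k(y)\<close>. If it is moreover integrally closed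
  with fraction field \<open>K\<close>, then its nonzero ideals are invertible and generated by two elements. For \<open>A\<close>
  this only requires \<open>A \<noteq> k\<close>, which is Riemann's argument: for a pole \<open>x\<close> at \<open>\<infinity>\<close> one counts the
  functions with poles bounded by those of \<open>x^l\<close> against their principal parts away from \<open>\<infinity>\<close>.

  A matrix \<open>M\<close> normalizes \<open>GL2 A\<close> iff \<open>det M\<close> divides all products of two of its entries, i.e.
  \<open>q(M)^2 = (det M)\<close>, so \<open>q(M^-1)\<close> is the inverse ideal of \<open>q(M)\<close>. The trivial inclusions
  \<open>J(Mv) \<subseteq> q(M) J(v)\<close> and \<open>q(MN) \<subseteq> q(M) q(N)\<close>, applied to \<open>M\<close> and \<open>M^-1\<close>, are then equalities.
\<close>

section \<open>Rings with finite quotients\<close>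

text \<open>Finiteness of the constant field replaces structure theory. In a finite quotient R/aR
  the powers of an element repeat, so some power is idempotent modulo \<open>a\<close>; such
  idempotents supply annihilators, generators, and a function that is 1 at one place and 0 at
  others. Dimensions over \<open>k\<close> are compared by counting elements. The ideal theory is
  stated for a general subring because it is needed twice. \<open>A\<close> is an intersection of
  valuation rings and might a priori be \<open>k\<close>. To exclude this, one first studies
  \<open>W\<close>, the functions regular at the zeros of \<open>y = 1/x\<close>, which visibly
  contains the nonconstant \<open>y\<close>. The function field is given as finite over k(t) for a
  single \<open>t\<close>, while quotients modulo \<open>y\<close> require a bound over k(y) for
  every \<open>y\<close>; this is the purpose of the counting with denominators. The identities for
  q(M) hold over any subring of the field, since the inverse of q(M) comes from the matrix and not
  from ideal theory. Invertibility and two generators enter in the class group, in separating orbits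
  of points and in reaching every class.\<close>

lemma fld_simps [simp]:
  "carrier (fld :: 'k::field ring) = UNIV"
  "x \<otimes>\<^bsub>(fld :: 'k ring)\<^esub> y = x * y"
  "x \<oplus>\<^bsub>(fld :: 'k ring)\<^esub> y = x + y"
  "\<one>\<^bsub>(fld :: 'k ring)\<^esub> = 1"
  "\<zero>\<^bsub>(fld :: 'k ring)\<^esub> = 0"
  by (simp_all add: ring_of_type_algebra_def)

abbreviation iprod :: "'k::field set \<Rightarrow> 'k set \<Rightarrow> 'k set"
  where "iprod \<equiv> ideal_prod fld"

lemma iprod_mult: "i \<in> I \<Longrightarrow> j \<in> J \<Longrightarrow> i * j \<in> iprod I J"
  using ideal_prod.prod[of i I j J fld] by simp

lemma iprod_add: "s \<in> iprod I J \<Longrightarrow> t \<in> iprod I J \<Longrightarrow> s + t \<in> iprod I J"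
  using ideal_prod.sum[of s fld I J t] by simp

lemma iprod_induct [consumes 1, case_names mult add]:
  assumes "s \<in> iprod I J"
    and "\<And>i j. i \<in> I \<Longrightarrow> j \<in> J \<Longrightarrow> P (i * j)"
    and "\<And>s t. P s \<Longrightarrow> P t \<Longrightarrow> P (s + t)"
  shows "P s"
  using assms(1)
proof (induction s rule: ideal_prod.induct)
  case (prod i j)
  then show ?case using assms(2)[of i j] by simp
next
  case (sum s1 s2)
  then show ?case using assms(3)[of s1 s2] by simp
qed

section \<open>Submodules of the field, colon ideals and finite quotients\<close>

definition submod :: "'k::field set \<Rightarrow> 'k set \<Rightarrow> bool"
  where "submod R I \<longleftrightarrow> 0 \<in> I \<and> (\<forall>a\<in>I. \<forall>b\<in>I. a + b \<in> I) \<and> (\<forall>r\<in>R. \<forall>a\<in>I. r * a \<in> I)"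

definition inv_ideal :: "'k::field set \<Rightarrow> 'k set \<Rightarrow> 'k set"
  where "inv_ideal R I = {v. \<forall>i\<in>I. v * i \<in> R}"

text \<open>Closed in the whole field. For \<open>n = 0\<close> the equation reads 1 = 0, so it
  imposes nothing.\<close>

definition integrally_closed :: "'k::field set \<Rightarrow> bool"
  where "integrally_closed R \<longleftrightarrow>
    (\<forall>w n r. (\<forall>i<n. r i \<in> R) \<and> w ^ n = (\<Sum>i<n. r i * w ^ i) \<longrightarrow> w \<in> R)"

text \<open>R/aR is finite. The representatives in \<open>S\<close> may repeat a residue.\<close>

definition finite_quotient :: "'k::field set \<Rightarrow> 'k \<Rightarrow> bool"
  where "finite_quotient R a \<longleftrightarrow>
    (\<exists>S. finite S \<and> S \<subseteq> R \<and> (\<forall>r\<in>R. \<exists>s\<in>S. \<exists>t\<in>R. r = s + a * t))"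

locale field_subring =
  fixes R :: "'k::field set"
  assumes zero: "0 \<in> R" and one: "1 \<in> R"
    and add: "a \<in> R \<Longrightarrow> b \<in> R \<Longrightarrow> a + b \<in> R"
    and uminus: "a \<in> R \<Longrightarrow> - a \<in> R"
    and mult: "a \<in> R \<Longrightarrow> b \<in> R \<Longrightarrow> a * b \<in> R"
begin

lemma diff: "a \<in> R \<Longrightarrow> b \<in> R \<Longrightarrow> a - b \<in> R"
  using add[of a "- b"] uminus[of b] by simp

lemma power: "a \<in> R \<Longrightarrow> a ^ n \<in> R"
  by (induction n) (auto intro: one mult)

lemma sum: "(\<And>i. i \<in> T \<Longrightarrow> f i \<in> R) \<Longrightarrow> (\<Sum>i\<in>T. f i) \<in> R"
  by (induction T rule: infinite_finite_induct) (auto intro: zero add)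

lemma prod: "(\<And>i. i \<in> T \<Longrightarrow> f i \<in> R) \<Longrightarrow> (\<Prod>i\<in>T. f i) \<in> R"
  by (induction T rule: infinite_finite_induct) (auto intro: one mult)

lemmas closed = zero one add uminus mult diff power sum prod

lemma submod_zero: "submod R I \<Longrightarrow> 0 \<in> I"
  and submod_add: "submod R I \<Longrightarrow> a \<in> I \<Longrightarrow> b \<in> I \<Longrightarrow> a + b \<in> I"
  and submod_mult: "submod R I \<Longrightarrow> r \<in> R \<Longrightarrow> a \<in> I \<Longrightarrow> r * a \<in> I"
  by (auto simp: submod_def)

lemma submod_uminus: "submod R I \<Longrightarrow> a \<in> I \<Longrightarrow> - a \<in> I"
  using submod_mult[of I "- 1" a] uminus[OF one] by simp

lemma submod_diff: "submod R I \<Longrightarrow> a \<in> I \<Longrightarrow> b \<in> I \<Longrightarrow> a - b \<in> I"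
  using submod_add[of I a "- b"] submod_uminus[of I b] by simp

lemma submod_sum: "submod R I \<Longrightarrow> (\<And>i. i \<in> T \<Longrightarrow> f i \<in> I) \<Longrightarrow> (\<Sum>i\<in>T. f i) \<in> I"
  by (induction T rule: infinite_finite_induct) (auto intro: submod_zero submod_add)

lemmas submod_closed = submod_zero submod_add submod_mult submod_uminus submod_diff submod_sum

lemma submod_self: "submod R R"
  by (auto simp: submod_def intro: closed)

lemma submod_scale: "submod R I \<Longrightarrow> submod R ((*) z ` I)"
  unfolding submod_def[of R "(*) z ` I"]
proof (intro conjI ballI)
  assume I: "submod R I"
  show "0 \<in> (*) z ` I" using submod_zero[OF I] by force
  show "a + b \<in> (*) z ` I" if "a \<in> (*) z ` I" "b \<in> (*) z ` I" for a b
    using that submod_add[OF I] by (auto simp flip: distrib_left)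
  show "r * a \<in> (*) z ` I" if "r \<in> R" "a \<in> (*) z ` I" for r a
    using that submod_mult[OF I] by (auto simp: mult.left_commute)
qed

lemma submod_principal: "submod R ((*) z ` R)"
  by (rule submod_scale[OF submod_self])

lemma submod_preimage: "submod R N \<Longrightarrow> submod R {z. s * z \<in> N}"
  by (auto simp: submod_def distrib_left mult.left_commute)

lemma submod_combinations:
  assumes I: "submod R I" and J: "submod R J"
  shows "submod R {i * a + j * b | i j. i \<in> I \<and> j \<in> J}" (is "submod R ?C")
  unfolding submod_def
proof (intro conjI ballI)
  have mem: "i * a + j * b \<in> ?C" if "i \<in> I" "j \<in> J" for i j using that by blast
  show "0 \<in> ?C" using mem[OF submod_zero[OF I] submod_zero[OF J]] by simp
  fix x y assume "x \<in> ?C" "y \<in> ?C"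
  then obtain i j i' j' where "x = i * a + j * b" "y = i' * a + j' * b" "i \<in> I" "j \<in> J" "i' \<in> I" "j' \<in> J"
    by blast
  then show "x + y \<in> ?C"
    using mem[of "i + i'" "j + j'"] submod_add[OF I] submod_add[OF J] by (simp add: algebra_simps)
next
  fix r x assume r: "r \<in> R" and "x \<in> ?C"
  then obtain i j where "x = i * a + j * b" "i \<in> I" "j \<in> J" by blast
  then have "r * x = (r * i) * a + (r * j) * b" "r * i \<in> I" "r * j \<in> J"
    using submod_mult[OF I r] submod_mult[OF J r] by (simp_all add: algebra_simps)
  then show "r * x \<in> ?C" by blast
qed

lemma principal_mem: "z \<in> (*) z ` R"
  using one by force

lemma principal_subset: "submod R I \<Longrightarrow> z \<in> I \<Longrightarrow> (*) z ` R \<subseteq> I"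
  by (auto simp: mult.commute[of z] intro: submod_mult)

text \<open>Scalars are absorbed by the left factor alone, so \<open>J\<close> can be any nonempty
  set; a member of \<open>J\<close> is what puts 0 into the product.\<close>

lemma submod_iprod: "submod R I \<Longrightarrow> submod R (iprod I J)" if "J \<noteq> {}"
  unfolding submod_def[of R "iprod I J"]
proof (intro conjI ballI)
  assume I: "submod R I"
  show "0 \<in> iprod I J"
    using iprod_mult[OF submod_zero[OF I]] that by fastforce
  show "a + b \<in> iprod I J" if "a \<in> iprod I J" "b \<in> iprod I J" for a b
    using that by (rule iprod_add)
  show "r * a \<in> iprod I J" if "r \<in> R" "a \<in> iprod I J" for r a
    using that(2)
  proof (induction rule: iprod_induct)
    case (mult i j)
    then show ?case using iprod_mult[OF submod_mult[OF I that(1)], of i j J] by (simp add: mult.assoc)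
  qed (auto simp: distrib_left intro: iprod_add)
qed

lemma submod_inv_ideal: "submod R (inv_ideal R I)"
  by (auto simp: submod_def inv_ideal_def distrib_right mult.assoc intro: closed)

lemma iprod_subset: "submod R M \<Longrightarrow> (\<And>i j. i \<in> I \<Longrightarrow> j \<in> J \<Longrightarrow> i * j \<in> M) \<Longrightarrow> iprod I J \<subseteq> M"
proof
  fix s assume M: "submod R M" "\<And>i j. i \<in> I \<Longrightarrow> j \<in> J \<Longrightarrow> i * j \<in> M" and "s \<in> iprod I J"
  from this(3) show "s \<in> M"
    by (induction rule: iprod_induct) (auto intro: M submod_add)
qed

lemma iprod_inv_ideal_subset: "iprod I (inv_ideal R I) \<subseteq> R"
  by (rule iprod_subset[OF submod_self]) (auto simp: inv_ideal_def mult.commute)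

text \<open>Powers of \<open>i\<close> repeat modulo \<open>a\<close>, say from exponent
  \<open>p\<close> on with period \<open>d\<close>. An exponent that is at least \<open>p\<close>
  and a multiple of \<open>d\<close>, such as \<open>p * d\<close>, may then be doubled without
  changing the residue.\<close>

lemma idempotent_power:
  assumes fq: "finite_quotient R a" and i: "i \<in> R" and a: "a \<in> R"
  shows "\<exists>N>0. \<exists>t\<in>R. i ^ (2 * N) = i ^ N + a * t"
proof -
  obtain S where S: "finite S" "\<And>r. r \<in> R \<Longrightarrow> \<exists>s\<in>S. \<exists>t\<in>R. r = s + a * t"
    using fq unfolding finite_quotient_def by blast
  have "\<forall>n. \<exists>s. s \<in> S \<and> (\<exists>t\<in>R. i ^ n = s + a * t)"
    using S(2) power[OF i] by blast
  then obtain f where f: "\<And>n. f n \<in> S" "\<And>n. \<exists>t\<in>R. i ^ n = f n + a * t"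
    by metis
  have "\<not> inj_on f {1..}"
    using finite_imageD[of f "{1..}"] S(1) f(1) finite_subset[of "f ` {1..}" S] infinite_Ici[of "1::nat"]
    by blast
  then obtain p p' where "p \<ge> 1" "p' \<ge> 1" "p \<noteq> p'" "f p = f p'"
    by (auto simp: inj_on_def)
  then have "\<exists>p d. p \<ge> 1 \<and> d \<ge> 1 \<and> f (p + d) = f p"
    by (intro exI[of _ "min p p'"] exI[of _ "max p p' - min p p'"]) (auto simp: min_def max_def)
  then obtain p d where p: "p \<ge> 1" "d \<ge> 1" "f (p + d) = f p" by blast
  obtain t1 t2 where "t1 \<in> R" "t2 \<in> R" "i ^ (p + d) = f (p + d) + a * t1" "i ^ p = f p + a * t2"
    using f(2) by metis
  then have "i ^ (p + d) = i ^ p + a * (t1 - t2)" "t1 - t2 \<in> R"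
    using p(3) by (auto simp: algebra_simps intro: closed)
  then obtain t where t: "t \<in> R" "i ^ (p + d) = i ^ p + a * t" by blast
  have step: "\<exists>u\<in>R. i ^ (m + k * d) = i ^ m + a * u" if "m \<ge> p" for m k
  proof (induction k)
    case 0
    show ?case using zero by auto
  next
    case (Suc k)
    then obtain u where u: "u \<in> R" "i ^ (m + k * d) = i ^ m + a * u" by blast
    have "i ^ (m + Suc k * d) = i ^ (m - p + k * d) * i ^ (p + d)"
      using that by (simp flip: power_add add: add.commute add.left_commute)
    also have "\<dots> = i ^ (m - p + k * d) * i ^ p + a * (i ^ (m - p + k * d) * t)"
      unfolding t(2) by (simp only: distrib_left mult.left_commute)
    also have "i ^ (m - p + k * d) * i ^ p = i ^ (m + k * d)"
      using that by (simp flip: power_add)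
    also have "\<dots> + a * (i ^ (m - p + k * d) * t) = i ^ m + a * (u + i ^ (m - p + k * d) * t)"
      unfolding u(2) by (simp only: distrib_left add.assoc)
    finally show ?case using u(1) t(1) i by (blast intro: closed)
  qed
  show ?thesis
  proof (intro exI conjI)
    show "p * d > 0" using p by simp
    have "p * d \<ge> p" using p by simp
    from step[OF this, of p] show "\<exists>t\<in>R. i ^ (2 * (p * d)) = i ^ (p * d) + a * t"
      by (simp add: mult_2)
  qed
qed

text \<open>Modulo \<open>a\<close>, every \<open>i\<close> in \<open>I\<close> acts nilpotently on \<open>z = \<Prod>i. 1 - i^N\<close>, where \<open>i^N\<close> is idempotent,
  and \<open>z \<noteq> 0\<close> as \<open>z \<equiv> 1\<close> modulo \<open>I\<close>; multiplying \<open>z\<close> by suitable powers gives an annihilator.\<close>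

lemma proper_ideal_annihilator:
  assumes fq: "finite_quotient R a" and I: "submod R I" "I \<subseteq> R" "a \<in> I" "1 \<notin> I"
  shows "\<exists>b\<in>R. b \<notin> (*) a ` R \<and> (\<forall>i\<in>I. b * i \<in> (*) a ` R)"
proof -
  let ?P = "(*) a ` R"
  have P: "submod R ?P" by (rule submod_principal)
  have aR: "a \<in> R" using I by blast
  obtain S where S: "finite S" "S \<subseteq> R" "\<And>r. r \<in> R \<Longrightarrow> \<exists>s\<in>S. \<exists>t\<in>R. r = s + a * t"
    using fq unfolding finite_quotient_def by blast
  \<comment> \<open>Because \<open>a\<close> is in \<open>I\<close>, each element of
    \<open>I\<close> is congruent modulo \<open>a\<close> to a representative that itself lies in
    \<open>I\<close>; it suffices to annihilate these finitely many.\<close>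
  let ?F = "S \<inter> I"
  have FR: "i \<in> R" if "i \<in> ?F" for i using that S by blast
  have "\<forall>i\<in>?F. \<exists>N>0. \<exists>t\<in>R. i ^ (2 * N) = i ^ N + a * t"
    using idempotent_power[OF fq _ aR] S(2) by blast
  then obtain N where N: "\<And>i. i \<in> ?F \<Longrightarrow> N i > 0 \<and> (\<exists>t\<in>R. i ^ (2 * N i) = i ^ N i + a * t)"
    by metis
  define z where "z = (\<Prod>i\<in>?F. 1 - i ^ N i)"
  have zR: "z \<in> R" unfolding z_def using FR by (intro closed) auto
  have "1 - (\<Prod>i\<in>T. 1 - i ^ N i) \<in> I" if "T \<subseteq> ?F" "finite T" for T
    using that(2,1)
  proof (induction T rule: finite_induct)
    case empty
    then show ?case using submod_zero[OF I(1)] by simp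
  next
    case (insert i T)
    have "i ^ N i = i ^ (N i - 1) * i" using N[of i] insert.prems by (cases "N i") auto
    moreover have "i ^ (N i - 1) * i \<in> I"
      using insert.prems FR by (intro submod_mult[OF I(1)] closed) auto
    ultimately have 1: "i ^ N i \<in> I" by simp
    have 2: "(\<Prod>i\<in>T. 1 - i ^ N i) \<in> R" using FR insert.prems by (intro closed) auto
    have "1 - (\<Prod>i\<in>insert i T. 1 - i ^ N i) = (1 - (\<Prod>i\<in>T. 1 - i ^ N i)) + (\<Prod>i\<in>T. 1 - i ^ N i) * i ^ N i"
      using insert.hyps by (simp add: algebra_simps)
    also have "\<dots> \<in> I"
      using insert 1 2 by (intro submod_add[OF I(1)] submod_mult[OF I(1)]) auto
    finally show ?case .
  qed
  from this[of ?F] have z1: "1 - z \<in> I" using S(1) by (simp add: z_def)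
  have PI: "?P \<subseteq> I" using principal_subset[OF I(1,3)] .
  have zP: "z \<notin> ?P" using z1 I(4) submod_add[OF I(1) z1, of z] PI by auto
  have zN: "z * i ^ N i \<in> ?P" if "i \<in> ?F" for i
  proof -
    obtain t where t: "t \<in> R" "i ^ (2 * N i) = i ^ N i + a * t" using N \<open>i \<in> ?F\<close> by blast
    define c where "c = (\<Prod>i\<in>?F - {i}. 1 - i ^ N i)"
    have cR: "c \<in> R" unfolding c_def using FR by (intro closed) auto
    have zc: "z = (1 - i ^ N i) * c"
      unfolding z_def c_def using S(1) that by (subst prod.remove) auto
    have "(1 - i ^ N i) * i ^ N i = - (a * t)"
      using t(2) by (simp add: algebra_simps flip: power_add mult_2)
    then have "z * i ^ N i = - (a * t) * c" unfolding zc by (metis mult.assoc mult.commute)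
    then have "z * i ^ N i = a * - (t * c)" by simp
    moreover have "- (t * c) \<in> R" using t(1) cR by (intro closed)
    ultimately show ?thesis by blast
  qed
  have "\<exists>b\<in>R. z * b \<notin> ?P \<and> (\<forall>i\<in>T. z * b * i \<in> ?P)" if "T \<subseteq> ?F" "finite T" for T
    using that(2,1)
  proof (induction T rule: finite_induct)
    case empty
    then show ?case using zP one by (intro bexI[of _ 1]) auto
  next
    case (insert i T)
    then obtain b where b: "b \<in> R" "z * b \<notin> ?P" "\<forall>i\<in>T. z * b * i \<in> ?P" by auto
    have iF: "i \<in> ?F" and iR: "i \<in> R" using insert.prems FR by auto
    \<comment> \<open>Minimality of \<open>j\<close> keeps \<open>z * b * i ^ (j - 1)\<close>
      outside aR, while one more factor \<open>i\<close> brings it in. Since \<open>z * b\<close> is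
      outside aR, \<open>j\<close> is positive.\<close>
    define j where "j = (LEAST j. z * b * i ^ j \<in> ?P)"
    have "b * (z * i ^ N i) \<in> ?P" using zN[OF iF] by (intro submod_mult[OF P b(1)])
    then have ex: "z * b * i ^ N i \<in> ?P" by (simp add: mult_ac)
    have j: "z * b * i ^ j \<in> ?P" unfolding j_def by (rule LeastI[of "\<lambda>j. z * b * i ^ j \<in> ?P"]) (rule ex)
    have "j \<noteq> 0" using j b(2) by (intro notI) simp
    then obtain m where m: "j = Suc m" by (cases j) auto
    have nm: "z * b * i ^ m \<notin> ?P" using not_less_Least[of m "\<lambda>j. z * b * i ^ j \<in> ?P"] m j_def by auto
    show ?case
    proof (intro bexI[of _ "b * i ^ m"] conjI ballI)
      show "z * (b * i ^ m) \<notin> ?P" using nm by (simp add: mult.assoc)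
      show "b * i ^ m \<in> R" using b iR by (intro closed)
      fix i' assume "i' \<in> insert i T"
      then consider "i' = i" | "i' \<in> T" by blast
      then show "z * (b * i ^ m) * i' \<in> ?P"
      proof cases
        case 1
        then show ?thesis using j m by (simp add: mult_ac)
      next
        case 2
        then have "i ^ m * (z * b * i') \<in> ?P" using submod_mult[OF P power[OF iR]] b by blast
        then show ?thesis by (simp add: mult_ac)
      qed
    qed
  qed
  from this[of ?F] obtain b where b: "b \<in> R" "z * b \<notin> ?P" "\<forall>i\<in>?F. z * b * i \<in> ?P" using S(1) by auto
  show ?thesis
  proof (intro bexI[of _ "z * b"] conjI ballI)
    fix i assume i: "i \<in> I"
    then obtain s t where st: "s \<in> S" "t \<in> R" "i = s + a * t" using S(3) I by blast
    have "s = i - t * a" using st by simp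
    then have "s \<in> I" using submod_diff[OF I(1) i submod_mult[OF I(1) st(2) I(3)]] by simp
    then have "z * b * s + a * (z * b * t) \<in> ?P"
      using b st zR by (intro submod_add[OF P] imageI closed) auto
    then show "z * b * i \<in> ?P" by (simp add: st algebra_simps)
  qed (use b zR in \<open>auto intro: closed\<close>)
qed

end

section \<open>Integrally closed rings with finite quotients: invertibility and generators of
  ideals\<close>

locale finite_quotient_ring = field_subring +
  assumes int_closed: "integrally_closed R"
    and fin_quot: "a \<in> R \<Longrightarrow> a \<noteq> 0 \<Longrightarrow> finite_quotient R a"
begin

text \<open>Finite quotients stand in for the noetherian condition. The modules \<open>M n\<close>
  generated by a, aw, ..., aw^n increase between aR and R, so each is determined by the members of
  the finite set \<open>S\<close> that it contains. The chain must pause, and cancelling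
  \<open>a\<close> in the resulting relation gives a monic equation for \<open>w\<close>.\<close>

lemma stabilizer_subset:
  assumes I: "submod R I" "I \<subseteq> R" "a \<in> I" "a \<noteq> 0" and w: "\<And>i. i \<in> I \<Longrightarrow> w * i \<in> I"
  shows "w \<in> R"
proof -
  have aR: "a \<in> R" using I by blast
  obtain S where S: "finite S" "\<And>r. r \<in> R \<Longrightarrow> \<exists>s\<in>S. \<exists>t\<in>R. r = s + a * t"
    using fin_quot[OF aR I(4)] unfolding finite_quotient_def by blast
  define M where "M = (\<lambda>n::nat. {\<Sum>i<Suc n. r i * (a * w ^ i) | r. \<forall>i. r i \<in> R})"
  have aw: "a * w ^ i \<in> I" for i
  proof (induction i)
    case (Suc i)
    then show ?case using w[of "a * w ^ i"] by (simp add: mult.left_commute)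
  qed (use I(3) in simp)
  have sub: "M n \<subseteq> R" for n
  proof -
    have "(\<Sum>i<Suc n. r i * (a * w ^ i)) \<in> I" if "\<forall>i. r i \<in> R" for r
      using aw that by (blast intro: submod_sum[OF I(1)] submod_mult[OF I(1)])
    then have "M n \<subseteq> I" unfolding M_def by blast
    then show ?thesis using I(2) by blast
  qed
  have mono1: "M n \<subseteq> M (Suc n)" for n
  proof
    fix s assume "s \<in> M n"
    then obtain r where r: "\<forall>i. r i \<in> R" "s = (\<Sum>i<Suc n. r i * (a * w ^ i))" unfolding M_def by blast
    have "s = (\<Sum>i<Suc (Suc n). (r(Suc n := 0)) i * (a * w ^ i))"
      unfolding sum.lessThan_Suc[of _ "Suc n"] r(2) by (simp add: sum.neutral)
    moreover have "\<forall>i. (r(Suc n := 0)) i \<in> R" using r zero by simp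
    ultimately show "s \<in> M (Suc n)" unfolding M_def by blast
  qed
  have M0: "a * t \<in> M n" if "t \<in> R" for t n
  proof (induction n)
    case 0
    show ?case unfolding M_def using that by (auto intro!: exI[of _ "\<lambda>_. t"] simp: mult.commute)
  qed (use mono1 in blast)
  have Madd: "s + t \<in> M n" if "s \<in> M n" "t \<in> M n" for s t n
  proof -
    obtain r r' where "\<forall>i. r i \<in> R" "s = (\<Sum>i<Suc n. r i * (a * w ^ i))"
      "\<forall>i. r' i \<in> R" "t = (\<Sum>i<Suc n. r' i * (a * w ^ i))" using \<open>s \<in> M n\<close> \<open>t \<in> M n\<close> unfolding M_def by blast
    then have "s + t = (\<Sum>i<Suc n. (r i + r' i) * (a * w ^ i))" "\<forall>i. r i + r' i \<in> R"
      by (auto simp: distrib_right sum.distrib intro: closed)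
    then show ?thesis unfolding M_def by (intro CollectI exI[of _ "\<lambda>i. r i + r' i"] conjI)
  qed
  have "\<exists>n. M (Suc n) \<inter> S = M n \<inter> S"
  proof (rule ccontr)
    assume no: "\<nexists>n. M (Suc n) \<inter> S = M n \<inter> S"
    have "card (M n \<inter> S) \<ge> n" for n
    proof (induction n)
      case (Suc n)
      have "M n \<inter> S \<subset> M (Suc n) \<inter> S" using no mono1 by blast
      then have "card (M n \<inter> S) < card (M (Suc n) \<inter> S)" using S(1) by (intro psubset_card_mono) auto
      then show ?case using Suc by simp
    qed simp
    moreover have "card (M n \<inter> S) \<le> card S" for n using S(1) by (intro card_mono) auto
    ultimately show False by (meson Suc_n_not_le_n order_trans)
  qed
  then obtain n where n: "M (Suc n) \<inter> S = M n \<inter> S" by blast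
  have "a * w ^ Suc n \<in> M (Suc n)"
    unfolding M_def
    by (intro CollectI exI[of _ "\<lambda>i. if i = Suc n then 1 else 0"]) (auto simp: zero one if_distrib[of "\<lambda>x. x * _"] cong: if_cong)
  moreover obtain s t where st: "s \<in> S" "t \<in> R" "a * w ^ Suc n = s + a * t"
    using S(2) aw[of "Suc n"] I(2) by blast
  ultimately have "s \<in> M (Suc n)" using Madd[of "a * w ^ Suc n" "Suc n" "a * - t"] M0[of "- t" "Suc n"] uminus by simp
  then have "s \<in> M n" using n st(1) by blast
  then have "a * w ^ Suc n \<in> M n" using Madd M0[OF st(2)] st(3) by simp
  then obtain r where r: "\<forall>i. r i \<in> R" "a * w ^ Suc n = (\<Sum>i<Suc n. r i * (a * w ^ i))" unfolding M_def by blast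
  have "a * w ^ Suc n = a * (\<Sum>i<Suc n. r i * w ^ i)" unfolding r(2) sum_distrib_left by (simp only: mult.left_commute)
  then have "w ^ Suc n = (\<Sum>i<Suc n. r i * w ^ i)" using I(4) mult_cancel_left by blast
  then show ?thesis using int_closed r(1) unfolding integrally_closed_def by blast
qed

text \<open>Induction on the number of representatives modulo a fixed \<open>a\<close> that
  \<open>I\<close> misses. If \<open>I\<close> is proper, an annihilator \<open>b\<close> of
  \<open>I\<close> modulo \<open>a\<close> gives \<open>w = b / a\<close> outside R with wI inside
  R. By \<open>stabilizer_subset\<close> wI is not inside I, so I + wI is a strictly larger ideal. A
  representation of 1 for it regroups as one for \<open>I\<close>, since v and wv both map
  \<open>I\<close> into R whenever v maps I + wI into R.\<close>

lemma ideal_invertible: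
  assumes "submod R I" "I \<subseteq> R" "I \<noteq> {0}"
  shows "1 \<in> iprod I (inv_ideal R I)"
proof -
  obtain a where a: "a \<in> I" "a \<noteq> 0" using assms submod_zero by blast
  have aR: "a \<in> R" using a assms by blast
  obtain S where S: "finite S" "\<And>r. r \<in> R \<Longrightarrow> \<exists>s\<in>S. \<exists>t\<in>R. r = s + a * t"
    using fin_quot[OF aR a(2)] unfolding finite_quotient_def by blast
  show ?thesis
    using assms(1,2) a(1)
  proof (induction "card (S - I)" arbitrary: I rule: less_induct)
    case less
    note I = less.prems
    show ?case
    proof (cases "1 \<in> I")
      case True
      then show ?thesis
        using iprod_mult[of 1 I 1 "inv_ideal R I"] I(2) by (auto simp: inv_ideal_def)
    next
      case False
      obtain b where b: "b \<in> R" "b \<notin> (*) a ` R" "\<forall>i\<in>I. b * i \<in> (*) a ` R"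
        using proper_ideal_annihilator[OF fin_quot[OF aR a(2)] I False] by blast
      define w where "w = b / a"
      have wR: "w \<notin> R" using b(2) a(2) by (auto simp: w_def image_iff)
      have wI: "w * i \<in> R" if "i \<in> I" for i
        using b(3) that a(2) by (fastforce simp: w_def)
      define I' where "I' = {i + w * j | i j. i \<in> I \<and> j \<in> I}"
      have I'm: "i + w * j \<in> I'" if "i \<in> I" "j \<in> I" for i j using that I'_def by blast
      have "I' = {i * 1 + j * w | i j. i \<in> I \<and> j \<in> I}" unfolding I'_def by (simp add: mult.commute)
      then have sI': "submod R I'" using submod_combinations[OF I(1) I(1), of 1 w] by simp
      have sub: "I' \<subseteq> R" using wI I(2) unfolding I'_def by (auto intro: closed)
      have II': "I \<subseteq> I'" using I'm[of _ 0] submod_zero[OF I(1)] by force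
      have "\<not> I' \<subseteq> I"
      proof
        assume "I' \<subseteq> I"
        then have "w * i \<in> I" if "i \<in> I" for i
          using I'm[of 0 i] submod_zero[OF I(1)] that by auto
        then show False using stabilizer_subset[OF I a(2)] wR by blast
      qed
      then obtain x where x: "x \<in> I'" "x \<notin> I" by blast
      obtain s t where st: "s \<in> S" "t \<in> R" "x = s + a * t" using S(2) sub x by blast
      have atI: "a * t \<in> I" using submod_mult[OF I(1) st(2) I(3)] by (simp add: mult.commute)
      have s: "s \<in> I'" using submod_diff[OF sI' x(1)] atI II' st(3) by (metis add_diff_cancel_right' subsetD)
      have "s \<notin> I" using submod_add[OF I(1) _ atI] st(3) x(2) by blast
      then have "S - I' \<subset> S - I" using s st(1) II' by blast
      then have "card (S - I') < card (S - I)" using S(1) by (intro psubset_card_mono) auto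
      then have "1 \<in> iprod I' (inv_ideal R I')" using less.hyps sI' sub II' I(3) by blast
      moreover have "x \<in> iprod I (inv_ideal R I)" if "x \<in> iprod I' (inv_ideal R I')" for x
        using that
      proof (induction rule: iprod_induct)
        case (mult x v)
        then obtain i j where ij: "x = i + w * j" "i \<in> I" "j \<in> I" unfolding I'_def by blast
        have "v * k \<in> R" if "k \<in> I" for k using mult(2) that II' by (auto simp: inv_ideal_def)
        then have 1: "v \<in> inv_ideal R I" by (auto simp: inv_ideal_def)
        have "v * (w * k) \<in> R" if "k \<in> I" for k
          using mult(2) I'm[of 0 k] that submod_zero[OF I(1)] by (auto simp: inv_ideal_def)
        then have 2: "w * v \<in> inv_ideal R I" by (auto simp: inv_ideal_def mult_ac)
        have "i * v + j * (w * v) \<in> iprod I (inv_ideal R I)"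
          using ij 1 2 by (intro iprod_add iprod_mult)
        then show ?case by (simp add: ij algebra_simps)
      qed (rule iprod_add)
      ultimately show ?thesis by blast
    qed
  qed
qed

text \<open>With \<open>1 = a v0 + g v1 + h v2\<close> and \<open>e\<close> an idempotent power of \<open>g v1\<close> modulo \<open>a\<close>, the ideal is generated
  by \<open>g\<close> where \<open>e = 1\<close> and by \<open>h\<close> where \<open>e = 0\<close>; hence \<open>b = e g + (1 - e) h\<close> works.\<close>

lemma three_to_two:
  assumes I: "submod R I" "I \<subseteq> R" "I = {r * a + s * g + t * h | r s t. r \<in> R \<and> s \<in> R \<and> t \<in> R}" "a \<noteq> 0"
  shows "\<exists>b\<in>I. I = {r * a + s * b | r s. r \<in> R \<and> s \<in> R}"
proof -
  have gens: "a \<in> I" "g \<in> I" "h \<in> I"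
  proof -
    have "r * a + s * g + t * h \<in> I" if "r \<in> R" "s \<in> R" "t \<in> R" for r s t
      unfolding I(3) using that by blast
    from this[of 1 0 0] this[of 0 1 0] this[of 0 0 1] show "a \<in> I" "g \<in> I" "h \<in> I"
      using zero one by simp_all
  qed
  have aR: "a \<in> R" using gens I by blast
  let ?V = "inv_ideal R I"
  have V: "submod R ?V" by (rule submod_inv_ideal)
  have vi: "v * i \<in> R" if "v \<in> ?V" "i \<in> I" for v i using that by (auto simp: inv_ideal_def)
  have "\<exists>u v w. u \<in> ?V \<and> v \<in> ?V \<and> w \<in> ?V \<and> x = a * u + g * v + h * w" if "x \<in> iprod I ?V" for x
    using that
  proof (induction rule: iprod_induct)
    case (mult i v)
    then obtain r s t where "i = r * a + s * g + t * h" "r \<in> R" "s \<in> R" "t \<in> R" using I(3) by blast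
    then show ?case using mult submod_mult[OF V]
      by (intro exI[of _ "r * v"] exI[of _ "s * v"] exI[of _ "t * v"]) (auto simp: algebra_simps)
  next
    case (add x y)
    then obtain u v w u' v' w' where "u \<in> ?V" "v \<in> ?V" "w \<in> ?V" "x = a * u + g * v + h * w"
      "u' \<in> ?V" "v' \<in> ?V" "w' \<in> ?V" "y = a * u' + g * v' + h * w'" by blast
    then show ?case using submod_add[OF V]
      by (intro exI[of _ "u + u'"] exI[of _ "v + v'"] exI[of _ "w + w'"]) (auto simp: algebra_simps)
  qed
  from this[OF ideal_invertible[OF I(1,2)]] obtain v0 v1 v2 where
    v: "v0 \<in> ?V" "v1 \<in> ?V" "v2 \<in> ?V" "1 = a * v0 + g * v1 + h * v2" using gens I(4) by blast
  define i where "i = g * v1"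
  have iR: "i \<in> R" unfolding i_def using vi[OF v(2) gens(2)] by (simp add: mult.commute)
  obtain N t where N: "N > 0" "t \<in> R" "i ^ (2 * N) = i ^ N + a * t"
    using idempotent_power[OF fin_quot[OF aR I(4)] iR aR] by blast
  define e where "e = i ^ N"
  have eR: "e \<in> R" unfolding e_def using iR by (intro closed)
  have ee: "e * e = e + a * t" using N(3) unfolding e_def by (simp add: mult_2 power_add)
  \<comment> \<open>With V the inverse ideal of \<open>I\<close>, it suffices that 1 lies in aV +
    bV: multiplying such a representation of 1 by x in \<open>I\<close> gives coefficients in
    R.\<close>
  define b where "b = e * g + (1 - e) * h"
  have bI: "b \<in> I" unfolding b_def using gens eR by (intro submod_add[OF I(1)] submod_mult[OF I(1)] closed)
  define Q where "Q = {a * u + b * v | u v. u \<in> ?V \<and> v \<in> ?V}"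
  have Qm: "a * u + b * v \<in> Q" if "u \<in> ?V" "v \<in> ?V" for u v using that Q_def by blast
  have "Q = {u * a + v * b | u v. u \<in> ?V \<and> v \<in> ?V}" unfolding Q_def by (simp add: mult.commute)
  then have Q: "submod R Q" using submod_combinations[OF V V, of a b] by simp
  have RV: "r \<in> ?V" if "r \<in> R" for r using that I(2) by (auto simp: inv_ideal_def intro: closed)
  have aQ: "a * u \<in> Q" if "u \<in> ?V" for u using Qm[OF that submod_zero[OF V]] by simp
  have bQ: "b * u \<in> Q" if "u \<in> ?V" for u using Qm[OF submod_zero[OF V] that] by simp
  have hv1: "v1 * h \<in> R" and gv2: "v2 * g \<in> R" using vi v gens by auto
  \<comment> \<open>Modulo aV the mixed terms vanish, since e(1 - e) is a multiple of
    \<open>a\<close>: \<open>b\<close> times \<open>e * v1\<close> becomes e i, and below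
    \<open>b\<close> times \<open>(1 - e) * v2\<close> becomes (1 - e)(1 - i).\<close>
  have ei: "e * i \<in> Q"
  proof -
    have eei: "e * (1 - e) = a * - t" using ee by (simp add: algebra_simps)
    have "b * (e * v1) = e * e * i + e * (1 - e) * (v1 * h)" by (simp add: b_def i_def algebra_simps)
    also have "\<dots> = e * i + a * (t * i - t * (v1 * h))" unfolding ee eei by (simp add: algebra_simps)
    finally have "e * i = b * (e * v1) - a * (t * i - t * (v1 * h))" by simp
    also have "\<dots> \<in> Q"
    proof (intro submod_diff[OF Q] bQ aQ)
      show "e * v1 \<in> ?V" using eR v by (intro submod_mult[OF V])
      show "t * i - t * (v1 * h) \<in> ?V" using RV[OF diff[OF mult mult]] N(2) iR hv1 by blast
    qed
    finally show ?thesis .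
  qed
  have eQ: "e \<in> Q"
  proof -
    have "i ^ (N - 1) * (e * i) \<in> Q" using submod_mult[OF Q power[OF iR] ei] .
    moreover have "i ^ (N - 1) * (e * i) = e * e" unfolding e_def using N(1)
      by (cases N) (simp_all add: mult_ac)
    ultimately have "e * e \<in> Q" by metis
    then have "e * e - a * t \<in> Q" using N(2) by (intro submod_diff[OF Q] aQ RV)
    then show ?thesis using ee by simp
  qed
  have e1Q: "(1 - e) * (1 - i) \<in> Q"
  proof -
    have hv: "h * v2 = 1 - i - a * v0" using v(4) by (simp add: i_def algebra_simps)
    have eei: "(1 - e) * e = a * - t" using ee by (simp add: algebra_simps)
    have "b * ((1 - e) * v2) = (1 - e) * e * (v2 * g) + (1 - e) * (1 - e) * (h * v2)"
      by (simp add: b_def algebra_simps)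
    also have "(1 - e) * (1 - e) = (1 - e) - a * - t" using eei by (simp add: algebra_simps)
    also have "(1 - e) * e * (v2 * g) + (1 - e - a * - t) * (h * v2) =
       (1 - e) * (1 - i) + a * ((t * (1 - i - a * v0) - t * (v2 * g)) - (1 - e) * v0)"
      unfolding eei hv by (simp add: algebra_simps)
    finally have "(1 - e) * (1 - i) = b * ((1 - e) * v2) - a * ((t * (1 - i - a * v0) - t * (v2 * g)) - (1 - e) * v0)"
      by simp
    also have "\<dots> \<in> Q"
    proof (intro submod_diff[OF Q] bQ aQ)
      show "(1 - e) * v2 \<in> ?V" using eR v one by (intro submod_mult[OF V] diff)
      have "1 - i - a * v0 \<in> R" using vi[OF v(1) gens(1)] iR one by (simp add: diff mult.commute)
      then have "t * (1 - i - a * v0) - t * (v2 * g) \<in> R" using N(2) gv2 by (blast intro: closed)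
      then show "t * (1 - i - a * v0) - t * (v2 * g) - (1 - e) * v0 \<in> ?V"
        using submod_diff[OF V RV submod_mult[OF V diff[OF one eR] v(1)]] by blast
    qed
    finally show ?thesis .
  qed
  \<comment> \<open>The geometric sum turns the factor 1 - i into 1 - i^N = 1 - e.\<close>
  have "(\<Sum>j<N. i ^ j) * ((1 - e) * (1 - i)) \<in> Q"
    using submod_mult[OF Q sum[OF power[OF iR]] e1Q] .
  moreover have "(\<Sum>j<N. i ^ j) * ((1 - e) * (1 - i)) = (1 - e) * (1 - e)"
    using one_diff_power_eq[of i N] by (simp add: e_def mult_ac)
  ultimately have "(1 - e) * (1 - e) \<in> Q" by simp
  then have "(1 - e) * (1 - e) + ((e + e) - e * e) \<in> Q"
    by (rule submod_add[OF Q _ submod_diff[OF Q submod_add[OF Q eQ eQ] submod_mult[OF Q eR eQ]]])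
  moreover have "(1 - e) * (1 - e) + ((e + e) - e * e) = 1" by (simp add: algebra_simps)
  ultimately have "1 \<in> Q" by simp
  then obtain u v where uv: "u \<in> ?V" "v \<in> ?V" "1 = a * u + b * v" unfolding Q_def by blast
  have "x \<in> {r * a + s * b | r s. r \<in> R \<and> s \<in> R}" if "x \<in> I" for x
  proof -
    have "(u * x) * a + (v * x) * b = (a * u + b * v) * x" by (simp add: algebra_simps)
    then have "x = (u * x) * a + (v * x) * b" using uv(3) by simp
    then show ?thesis using vi that uv by blast
  qed
  moreover have "r * a + s * b \<in> I" if "r \<in> R" "s \<in> R" for r s
    using that gens bI by (intro submod_add[OF I(1)] submod_mult[OF I(1)])
  ultimately show ?thesis using bI by blast
qed

text \<open>\<open>I\<close> is generated by \<open>a\<close> together with the finitely many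
  representatives modulo \<open>a\<close> that lie in \<open>I\<close>; these are absorbed one at a
  time by \<open>three_to_two\<close>. The first generator can thus be prescribed.\<close>

lemma ideal_two_generated:
  assumes I: "submod R I" "I \<subseteq> R" "a \<in> I" "a \<noteq> 0"
  shows "\<exists>b\<in>I. I = {r * a + s * b | r s. r \<in> R \<and> s \<in> R}"
proof -
  have aR: "a \<in> R" using I by blast
  obtain S where S: "finite S" "\<And>r. r \<in> R \<Longrightarrow> \<exists>s\<in>S. \<exists>t\<in>R. r = s + a * t"
    using fin_quot[OF aR I(4)] unfolding finite_quotient_def by blast
  have "\<exists>b\<in>I. T \<subseteq> {r * a + s * b | r s. r \<in> R \<and> s \<in> R}" if "finite T" "T \<subseteq> I" for T
    using that
  proof (induction T rule: finite_induct)
    case empty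
    then show ?case using I(3) by blast
  next
    case (insert h T)
    then obtain g where g: "g \<in> I" "T \<subseteq> {r * a + s * g | r s. r \<in> R \<and> s \<in> R}" by blast
    define J where "J = {r * a + s * g + t * h | r s t. r \<in> R \<and> s \<in> R \<and> t \<in> R}"
    have Jm: "r * a + s * g + t * h \<in> J" if "r \<in> R" "s \<in> R" "t \<in> R" for r s t using that J_def by blast
    have "J = {x * 1 + t * h | x t. x \<in> {r * a + s * g | r s. r \<in> R \<and> s \<in> R} \<and> t \<in> R}"
      unfolding J_def by auto
    then have "submod R J"
      using submod_combinations[OF submod_combinations[OF submod_self submod_self] submod_self]
      by (simp only:)
    moreover have JI: "J \<subseteq> I" unfolding J_def using I(3) g insert.prems
      by (auto intro!: submod_add[OF I(1)] submod_mult[OF I(1)])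
    ultimately obtain b where b: "b \<in> J" "J = {r * a + s * b | r s. r \<in> R \<and> s \<in> R}"
      using three_to_two[of J a g h] I(2,4) J_def by blast
    have "h \<in> J" using Jm[of 0 0 1] zero one by simp
    moreover have "T \<subseteq> J" using g(2) Jm[of _ _ 0] zero by force
    ultimately show ?case using b JI by blast
  qed
  from this[of "S \<inter> I"] obtain b where b: "b \<in> I" "S \<inter> I \<subseteq> {r * a + s * b | r s. r \<in> R \<and> s \<in> R}"
    using S(1) by auto
  have "x \<in> {r * a + s * b | r s. r \<in> R \<and> s \<in> R}" if x: "x \<in> I" for x
  proof -
    obtain s t where st: "s \<in> S" "t \<in> R" "x = s + a * t" using S(2) I(2) x by blast
    have "s \<in> I" using submod_diff[OF I(1) x submod_mult[OF I(1) st(2) I(3)]] st(3) by (simp add: mult.commute)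
    then obtain r u where ru: "r \<in> R" "u \<in> R" "s = r * a + u * b" using b(2) st(1) by blast
    have "x = (r + t) * a + u * b" using st ru by (simp add: algebra_simps)
    then show ?thesis using ru st(2) add by blast
  qed
  moreover have "r * a + s * b \<in> I" if "r \<in> R" "s \<in> R" for r s
    using that I(3) b(1) by (intro submod_add[OF I(1)] submod_mult[OF I(1)])
  ultimately show ?thesis using b(1) by blast
qed

end

section \<open>Bounded linear dependence over a rational subfield\<close>

locale fraction_ring = finite_quotient_ring +
  assumes fractions: "\<exists>d\<in>R. d \<noteq> 0 \<and> d * w \<in> R"
begin

text \<open>The fractional ideal aR + bR times its inverse is R, and 1 splits along the two
  generators. The four memberships say that \<open>u\<close> and \<open>v\<close> lie in the inverse
  ideal.\<close>

lemma pair_inverse: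
  assumes "(a, b) \<noteq> (0, 0)"
  shows "\<exists>u v. a * u + b * v = 1 \<and> a * u \<in> R \<and> a * v \<in> R \<and> b * u \<in> R \<and> b * v \<in> R"
proof -
  obtain d d' where d: "d \<in> R" "d \<noteq> 0" "d * a \<in> R" "d' \<in> R" "d' \<noteq> 0" "d' * b \<in> R"
    using fractions by blast
  define p q where "p = d' * (d * a)" and "q = d * (d' * b)"
  have pq: "p \<in> R" "q \<in> R" "p \<noteq> 0 \<or> q \<noteq> 0" using d assms mult by (auto simp: p_def q_def)
  define I where "I = {r * p + s * q | r s. r \<in> R \<and> s \<in> R}"
  have I: "submod R I" unfolding I_def by (rule submod_combinations[OF submod_self submod_self])
  have Im: "r * p + s * q \<in> I" if "r \<in> R" "s \<in> R" for r s using that I_def by blast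
  have pI: "p \<in> I" "q \<in> I" using Im[of 1 0] Im[of 0 1] zero one by simp_all
  have IR: "I \<subseteq> R" unfolding I_def using pq by (auto intro: closed)
  let ?V = "inv_ideal R I"
  have V: "submod R ?V" by (rule submod_inv_ideal)
  have "iprod I ?V \<subseteq> {u * p + v * q | u v. u \<in> ?V \<and> v \<in> ?V}"
  proof (rule iprod_subset[OF submod_combinations[OF V V]])
    fix i w assume "i \<in> I" and w: "w \<in> ?V"
    then obtain r s where "i = r * p + s * q" "r \<in> R" "s \<in> R" using I_def by blast
    then have "i * w = (r * w) * p + (s * w) * q" "r * w \<in> ?V" "s * w \<in> ?V"
      using submod_mult[OF V _ w] by (simp_all add: algebra_simps)
    then show "i * w \<in> {u * p + v * q | u v. u \<in> ?V \<and> v \<in> ?V}" by blast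
  qed
  moreover have "1 \<in> iprod I ?V" using pI pq(3) by (intro ideal_invertible I IR) auto
  ultimately obtain u v where uv: "u \<in> ?V" "v \<in> ?V" "1 = u * p + v * q" by blast
  have "u * p \<in> R" "v * p \<in> R" "u * q \<in> R" "v * q \<in> R" using uv pI by (auto simp: inv_ideal_def)
  then show ?thesis
    using uv(3) by (intro exI[of _ "d * d' * u"] exI[of _ "d * d' * v"]) (simp add: p_def q_def mult_ac)
qed

end

section \<open>Polynomials, spans and counting over a finite constant field\<close>

locale finite_constants = field_subring k for k :: "'k::field set" +
  assumes inverse: "a \<in> k \<Longrightarrow> inverse a \<in> k" and fin: "finite k"
begin

definition kpoly :: "'k poly set"
  where "kpoly = {p. \<forall>i. Polynomial.coeff p i \<in> k}"

text \<open>Linear independence over k[x], hence over k(x) when \<open>x\<close> is transcendental.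
  For \<open>x\<close> in \<open>k\<close> only the empty family qualifies, because the polynomial X
  - x vanishes at \<open>x\<close>.\<close>

definition kindep :: "'k \<Rightarrow> nat \<Rightarrow> (nat \<Rightarrow> 'k) \<Rightarrow> bool"
  where "kindep x n a \<longleftrightarrow> (\<forall>f. (\<forall>i<n. f i \<in> kpoly) \<longrightarrow> (\<Sum>i<n. poly (f i) x * a i) = 0 \<longrightarrow> (\<forall>i<n. f i = 0))"

lemma kpoly_add: "p \<in> kpoly \<Longrightarrow> q \<in> kpoly \<Longrightarrow> p + q \<in> kpoly"
  and kpoly_mult: "p \<in> kpoly \<Longrightarrow> q \<in> kpoly \<Longrightarrow> p * q \<in> kpoly"
  and kpoly_uminus: "p \<in> kpoly \<Longrightarrow> - p \<in> kpoly"
  and kpoly_0: "0 \<in> kpoly"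
  and kpoly_1: "1 \<in> kpoly"
  and kpoly_monom: "c \<in> k \<Longrightarrow> Polynomial.monom c n \<in> kpoly"
  by (auto simp: kpoly_def coeff_mult zero one intro!: closed)

lemma kpoly_const: "c \<in> k \<Longrightarrow> [:c:] \<in> kpoly"
  by (auto simp: kpoly_def zero coeff_pCons split: nat.splits)

lemma kpoly_sum: "(\<And>i. i \<in> T \<Longrightarrow> f i \<in> kpoly) \<Longrightarrow> (\<Sum>i\<in>T. f i) \<in> kpoly"
  by (induction T rule: infinite_finite_induct) (auto intro: kpoly_0 kpoly_add)

lemma kpoly_coeff: "p \<in> kpoly \<Longrightarrow> Polynomial.coeff p i \<in> k"
  by (auto simp: kpoly_def)

lemma card_k_ge2: "card k \<ge> 2"
proof -
  have "card {0, 1 :: 'k} \<le> card k" using zero one fin by (intro card_mono) auto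
  then show ?thesis by simp
qed

text \<open>Over a finite field a comparison of dimensions is a comparison of cardinalities: two
  coefficient vectors with the same value differ by a nontrivial relation.\<close>

lemma pigeonhole_relation:
  assumes I: "finite I" and S: "finite S" "card S < card k ^ card I"
    and mem: "\<And>c. (\<And>i. i \<in> I \<Longrightarrow> c i \<in> k) \<Longrightarrow> (\<Sum>i\<in>I. c i * v i) \<in> S"
  shows "\<exists>c. (\<forall>i\<in>I. c i \<in> k) \<and> (\<exists>i\<in>I. c i \<noteq> 0) \<and> (\<Sum>i\<in>I. c i * v i) = 0"
proof -
  let ?C = "I \<rightarrow>\<^sub>E k" and ?f = "\<lambda>c. \<Sum>i\<in>I. c i * v i"
  have "card ?C = card k ^ card I" using I by (simp add: card_PiE)
  then have "\<not> inj_on ?f ?C"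
    using card_inj_on_le[of ?f ?C S] S mem by (auto simp: image_subset_iff PiE_iff)
  then obtain c c' where c: "c \<in> ?C" "c' \<in> ?C" "c \<noteq> c'" "?f c = ?f c'" by (auto simp: inj_on_def)
  have "\<exists>i\<in>I. c i \<noteq> c' i" using PiE_ext[OF c(1,2)] c(3) by blast
  then show ?thesis using c
    by (intro exI[of _ "\<lambda>i. c i - c' i"]) (auto simp: left_diff_distrib sum_subtractf PiE_iff intro!: diff)
qed

definition kspan :: "'k set \<Rightarrow> 'k set"
  where "kspan B = {\<Sum>b\<in>B. c b * b | c. \<forall>b\<in>B. c b \<in> k}"

lemma kspan_card: "finite B \<Longrightarrow> finite (kspan B) \<and> card (kspan B) \<le> card k ^ card B"
proof -
  assume B: "finite B"
  have "kspan B \<subseteq> (\<lambda>c. \<Sum>b\<in>B. c b * b) ` (B \<rightarrow>\<^sub>E k)"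
  proof
    fix x assume "x \<in> kspan B"
    then obtain c where c: "\<forall>b\<in>B. c b \<in> k" "x = (\<Sum>b\<in>B. c b * b)" unfolding kspan_def by blast
    then have "x = (\<Sum>b\<in>B. restrict c B b * b)" by simp
    then show "x \<in> (\<lambda>c. \<Sum>b\<in>B. c b * b) ` (B \<rightarrow>\<^sub>E k)" using c(1)
      by (intro image_eqI[of _ _ "restrict c B"]) auto
  qed
  moreover have C: "finite (B \<rightarrow>\<^sub>E k)" "card (B \<rightarrow>\<^sub>E k) = card k ^ card B" using B fin by (auto simp: card_PiE finite_PiE)
  ultimately show ?thesis
    using finite_surj[OF C(1)] surj_card_le[OF C(1)] unfolding C(2) by blast
qed

lemma kspan_submod: "submod k (kspan B)"
  unfolding submod_def
proof (intro conjI ballI)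
  show "0 \<in> kspan B" unfolding kspan_def by (auto intro!: exI[of _ "\<lambda>_. 0"] simp: zero)
next
  fix a b assume "a \<in> kspan B" "b \<in> kspan B"
  then obtain c d where c: "\<forall>b\<in>B. c b \<in> k" "a = (\<Sum>b\<in>B. c b * b)" "\<forall>b\<in>B. d b \<in> k" "b = (\<Sum>b\<in>B. d b * b)"
    unfolding kspan_def by blast
  then show "a + b \<in> kspan B" unfolding kspan_def
    by (intro CollectI exI[of _ "\<lambda>b. c b + d b"]) (auto simp: distrib_right sum.distrib intro: add)
next
  fix r a assume r: "r \<in> k" "a \<in> kspan B"
  then obtain c where c: "\<forall>b\<in>B. c b \<in> k" "a = (\<Sum>b\<in>B. c b * b)" unfolding kspan_def by blast
  then show "r * a \<in> kspan B" unfolding kspan_def using r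
    by (intro CollectI exI[of _ "\<lambda>b. r * c b"]) (auto simp: sum_distrib_left mult.assoc intro: mult)
qed

lemma kspan_mem: "finite B \<Longrightarrow> b \<in> B \<Longrightarrow> b \<in> kspan B"
  unfolding kspan_def
  by (intro CollectI exI[of _ "\<lambda>b'. if b' = b then 1 else 0"])
    (auto simp: zero one if_distrib[of "\<lambda>x. x * _"] cong: if_cong)

lemma kspan_least: "submod k M \<Longrightarrow> B \<subseteq> M \<Longrightarrow> kspan B \<subseteq> M"
  unfolding kspan_def by (auto intro!: submod_sum submod_mult)

end

text \<open>The spaces \<open>M h\<close> of combinations with coefficients of degree at most \<open>h\<close> in \<open>t\<close> grow linearly
  in \<open>h\<close>; multiplication by \<open>x\<close>, up to a fixed denominator, raises \<open>h\<close> by a constant, so counting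
  forces a relation over the polynomials in \<open>x\<close> between sufficiently many elements.\<close>

locale bounded_denominators = finite_constants k for k :: "'k::field set" +
  fixes t :: "'k" and n :: nat and u :: "nat \<Rightarrow> 'k"
  assumes spanning: "\<exists>c. (\<forall>i<n. \<exists>D\<in>kpoly. \<exists>p\<in>kpoly. poly D t \<noteq> 0 \<and> poly D t * c i = poly p t) \<and>
    a = (\<Sum>i<n. c i * u i)"
begin

definition gens :: "nat \<Rightarrow> 'k set"
  where "gens h = (\<lambda>(i, j). t ^ i * u j) ` ({..h} \<times> {..<n})"

definition M :: "nat \<Rightarrow> 'k set"
  where "M h = kspan (gens h)"

lemma finite_gens: "finite (gens h)"
  by (simp add: gens_def)

lemma gens_mem: "i \<le> h \<Longrightarrow> j < n \<Longrightarrow> t ^ i * u j \<in> gens h"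
  unfolding gens_def by (rule image_eqI[of _ _ "(i, j)"]) auto

lemma card_gens: "card (gens h) \<le> Suc h * n"
  unfolding gens_def by (rule order_trans[OF card_image_le]) auto

lemma card_M: "finite (M h)" "card (M h) \<le> card k ^ (Suc h * n)"
proof -
  have "card k ^ card (gens h) \<le> card k ^ (Suc h * n)"
    using card_gens card_k_ge2 by (intro power_increasing) auto
  then show "finite (M h)" "card (M h) \<le> card k ^ (Suc h * n)"
    using kspan_card[OF finite_gens, of h] unfolding M_def by auto
qed

lemma M_submod: "submod k (M h)"
  unfolding M_def by (rule kspan_submod)

lemma M_mono: "h \<le> h' \<Longrightarrow> M h \<subseteq> M h'"
  unfolding M_def
proof (rule kspan_least[OF kspan_submod], rule kspan_mem[OF finite_gens, THEN subsetI])
  fix b assume h: "h \<le> h'" and "b \<in> gens h"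
  then obtain i j where "i \<le> h" "j < n" "b = t ^ i * u j" by (auto simp: gens_def)
  then show "b \<in> gens h'" using h by (auto intro: gens_mem)
qed

lemma M_mult_t: assumes "a \<in> M h" shows "t ^ i * a \<in> M (h + i)"
proof -
  have "M h \<subseteq> {z. t ^ i * z \<in> M (h + i)}"
    unfolding M_def[of h]
  proof (rule kspan_least[OF submod_preimage[OF M_submod]], rule)
    fix b assume "b \<in> gens h"
    then obtain i' j where "i' \<le> h" "j < n" "b = t ^ i' * u j" by (auto simp: gens_def)
    then have "t ^ i * b \<in> gens (h + i)"
      using gens_mem[of "i + i'" "h + i" j] by (simp add: power_add mult.assoc)
    then show "b \<in> {z. t ^ i * z \<in> M (h + i)}" by (simp add: M_def kspan_mem[OF finite_gens])
  qed
  then show ?thesis using assms by blast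
qed

lemma M_mult_poly: assumes "p \<in> kpoly" "a \<in> M h" "Polynomial.degree p \<le> e"
  shows "poly p t * a \<in> M (h + e)"
proof -
  have "poly p t * a = (\<Sum>i\<le>Polynomial.degree p. Polynomial.coeff p i * (t ^ i * a))"
    by (simp add: poly_altdef sum_distrib_right mult.assoc)
  also have "\<dots> \<in> M (h + e)"
  proof (rule submod_sum[OF M_submod], rule submod_mult[OF M_submod kpoly_coeff[OF assms(1)]])
    fix i assume "i \<in> {..Polynomial.degree p}"
    then have "h + i \<le> h + e" using assms(3) by simp
    then show "t ^ i * a \<in> M (h + e)" using M_mult_t[OF assms(2), of i] M_mono by blast
  qed
  finally show ?thesis .
qed

text \<open>A further factor p(t) only raises \<open>h\<close> by its degree, so finitely many
  denominators can be multiplied together.\<close>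

lemma M_denominator_sum:
  assumes "\<And>j. j \<in> T \<Longrightarrow> \<exists>D\<in>kpoly. poly D t \<noteq> 0 \<and> (\<exists>h. poly D t * a j \<in> M h)" "finite T"
  shows "\<exists>D\<in>kpoly. poly D t \<noteq> 0 \<and> (\<exists>h. \<forall>j\<in>T. poly D t * a j \<in> M h)"
  using assms(2,1)
proof (induction T rule: finite_induct)
  case empty
  show ?case using kpoly_1 by (intro bexI[of _ 1]) auto
next
  case (insert j T)
  then obtain D h where D: "D \<in> kpoly" "poly D t \<noteq> 0" "\<And>j. j \<in> T \<Longrightarrow> poly D t * a j \<in> M h" by blast
  obtain D' h' where D': "D' \<in> kpoly" "poly D' t \<noteq> 0" "poly D' t * a j \<in> M h'" using insert.prems[of j] by blast
  let ?e = "h + h' + Polynomial.degree D + Polynomial.degree D'"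
  have "poly (D * D') t * a j' \<in> M ?e" if "j' \<in> insert j T" for j'
  proof (cases "j' = j")
    case True
    have "poly D t * (poly D' t * a j) \<in> M (h' + Polynomial.degree D)" by (rule M_mult_poly[OF D(1) D'(3)]) simp
    then show ?thesis using True M_mono[of "h' + Polynomial.degree D" ?e] by (auto simp: mult.assoc)
  next
    case False
    then have "poly D' t * (poly D t * a j') \<in> M (h + Polynomial.degree D')" using that by (intro M_mult_poly[OF D'(1) D(3)]) auto
    then show ?thesis using M_mono[of "h + Polynomial.degree D'" ?e] by (auto simp: mult_ac)
  qed
  then show ?case using D(1,2) D'(1,2) by (intro bexI[of _ "D * D'"]) (auto intro: kpoly_mult)
qed

lemma M_denominator: "\<exists>D\<in>kpoly. poly D t \<noteq> 0 \<and> (\<exists>h. poly D t * a \<in> M h)"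
proof -
  obtain c where c: "\<And>i. i < n \<Longrightarrow> \<exists>D\<in>kpoly. \<exists>p\<in>kpoly. poly D t \<noteq> 0 \<and> poly D t * c i = poly p t"
    and a: "a = (\<Sum>i<n. c i * u i)" using spanning by blast
  have "\<exists>D\<in>kpoly. poly D t \<noteq> 0 \<and> (\<exists>h. poly D t * (c i * u i) \<in> M h)" if i: "i \<in> {..<n}" for i
  proof -
    obtain D p where D: "D \<in> kpoly" "p \<in> kpoly" "poly D t \<noteq> 0" "poly D t * c i = poly p t" using c i by blast
    have "u i \<in> gens 0" using gens_mem[of 0 0 i] i by simp
    then have "u i \<in> M 0" unfolding M_def by (rule kspan_mem[OF finite_gens])
    then have "poly p t * u i \<in> M (0 + Polynomial.degree p)" by (intro M_mult_poly D) auto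
    moreover have "poly D t * (c i * u i) = poly p t * u i" by (simp flip: D(4))
    ultimately show ?thesis using D(1,3) by metis
  qed
  from M_denominator_sum[of "{..<n}" "\<lambda>i. c i * u i", OF this] obtain D h where
    D: "D \<in> kpoly" "poly D t \<noteq> 0" "\<And>i. i < n \<Longrightarrow> poly D t * (c i * u i) \<in> M h" by auto
  have "poly D t * a \<in> M h" unfolding a sum_distrib_left using D(3) by (intro submod_sum[OF M_submod]) auto
  then show ?thesis using D by blast
qed

lemma kindep_bounded: "\<exists>N. \<forall>m a. kindep x m a \<longrightarrow> m \<le> N"
proof -
  have "\<exists>D\<in>kpoly. poly D t \<noteq> 0 \<and> (\<exists>h. \<forall>j\<in>{..<n}. poly D t * (x * u j) \<in> M h)"
    by (rule M_denominator_sum) (use M_denominator in auto)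
  then obtain D h0 where D: "D \<in> kpoly" "poly D t \<noteq> 0" "\<And>j. j < n \<Longrightarrow> poly D t * (x * u j) \<in> M h0" by auto
  define h where "h = h0 + Polynomial.degree D"
  have Dx: "poly D t * x * z \<in> M (m + h)" if "z \<in> M m" for z m
  proof -
    have "M m \<subseteq> {z. poly D t * x * z \<in> M (m + h)}"
      unfolding M_def[of m]
    proof (rule kspan_least[OF submod_preimage[OF M_submod]], rule)
      fix b assume "b \<in> gens m"
      then obtain i j where "i \<le> m" "j < n" "b = t ^ i * u j" by (auto simp: gens_def)
      then have "t ^ i * (poly D t * (x * u j)) \<in> M (h0 + i)" "h0 + i \<le> m + h" using D by (auto intro: M_mult_t simp: h_def)
      then show "b \<in> {z. poly D t * x * z \<in> M (m + h)}" using M_mono \<open>b = _\<close> by (auto simp: mult_ac)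
    qed
    then show ?thesis using that by blast
  qed
  have D1: "poly D t * z \<in> M (m + h)" if "z \<in> M m" for z m
    using M_mult_poly[OF D(1) that, of h] by (simp add: h_def)
  \<comment> \<open>One and the same power of D(t) is used for all \<open>j\<close> up to
    \<open>d\<close>, so that the products with different x^j all land in a single space.\<close>
  have pow: "poly D t ^ d * x ^ j * z \<in> M (m + d * h)" if "j \<le> d" "z \<in> M m" for d j m z
    using that
  proof (induction d arbitrary: j)
    case (Suc d)
    show ?case
    proof (cases "j \<le> d")
      case True
      from D1[OF Suc.IH[OF True Suc.prems(2)]] show ?thesis by (simp add: algebra_simps)
    next
      case False
      then have j: "j = Suc d" using Suc.prems by simp
      from Dx[OF Suc.IH[OF order_refl Suc.prems(2)]] show ?thesis by (simp add: algebra_simps j)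
    qed
  qed simp
  have "m \<le> n * h" if ind: "kindep x m a" for m a
  proof (rule ccontr)
    assume "\<not> m \<le> n * h"
    then have m: "n * h + 1 \<le> m" by simp
    have "\<exists>E\<in>kpoly. poly E t \<noteq> 0 \<and> (\<exists>h. \<forall>j\<in>{..<m}. poly E t * a j \<in> M h)"
      by (rule M_denominator_sum) (use M_denominator in auto)
    then obtain E h' where E: "E \<in> kpoly" "poly E t \<noteq> 0" "\<And>j. j < m \<Longrightarrow> poly E t * a j \<in> M h'" by auto
    \<comment> \<open>There are m(d + 1) products x^j a_i, in a space spanned by n(h' + dh + 1)
      elements. For m > nh the first number grows faster in \<open>d\<close>, and this
      \<open>d\<close> makes up for the constant term n h' + n.\<close>
    define d where "d = n * h' + n"
    define T where "T = {..<m} \<times> {..d}"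
    define v where "v = (\<lambda>(i, j). poly D t ^ d * x ^ j * (poly E t * a i))"
    have "Suc (h' + d * h) * n < (n * h + 1) * Suc d" by (simp add: d_def algebra_simps)
    also have "\<dots> \<le> card T" using mult_le_mono1[OF m, of "Suc d"] by (simp add: T_def card_cartesian_product)
    finally have lt: "Suc (h' + d * h) * n < card T" .
    have "\<exists>c. (\<forall>i\<in>T. c i \<in> k) \<and> (\<exists>i\<in>T. c i \<noteq> 0) \<and> (\<Sum>i\<in>T. c i * v i) = 0"
    proof (rule pigeonhole_relation)
      show "finite T" by (simp add: T_def)
      show "finite (M (h' + d * h))" by (rule card_M)
      have "card k ^ (Suc (h' + d * h) * n) < card k ^ card T" using lt card_k_ge2 by (intro power_strict_increasing) auto
      then show "card (M (h' + d * h)) < card k ^ card T" using card_M(2)[of "h' + d * h"] by linarith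
      show "(\<Sum>i\<in>T. c i * v i) \<in> M (h' + d * h)" if "\<And>i. i \<in> T \<Longrightarrow> c i \<in> k" for c
      proof (rule submod_sum[OF M_submod], rule submod_mult[OF M_submod that])
        show "v i \<in> M (h' + d * h)" if "i \<in> T" for i
          using that pow[OF _ E(3)] by (auto simp: v_def T_def)
      qed
    qed
    then obtain c where c: "\<And>i. i \<in> T \<Longrightarrow> c i \<in> k" "\<exists>i\<in>T. c i \<noteq> 0" "(\<Sum>i\<in>T. c i * v i) = 0" by blast
    define f where "f = (\<lambda>i. \<Sum>j\<le>d. Polynomial.monom (c (i, j)) j)"
    have fk: "f i \<in> kpoly" if "i < m" for i unfolding f_def using c(1) that by (intro kpoly_sum kpoly_monom) (auto simp: T_def)
    have "(\<Sum>i\<in>T. c i * v i) = poly D t ^ d * poly E t * (\<Sum>i<m. poly (f i) x * a i)"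
      unfolding T_def sum.cartesian_product' f_def v_def poly_sum poly_monom sum_distrib_left sum_distrib_right
      by (simp add: mult_ac)
    then have "(\<Sum>i<m. poly (f i) x * a i) = 0" using c(3) D E by simp
    then have f0: "\<forall>i<m. f i = 0" using ind fk unfolding kindep_def by blast
    have "c (i, j) = 0" if "i < m" "j \<le> d" for i j
    proof -
      have "c (i, j) = Polynomial.coeff (f i) j" unfolding f_def using that by (simp add: coeff_sum)
      then show ?thesis using f0 that by simp
    qed
    then show False using c(2) by (auto simp: T_def)
  qed
  then show ?thesis by blast
qed

end

section \<open>Valuation rings of a function field\<close>

lemma integrally_closedD:
  "integrally_closed R \<Longrightarrow> \<forall>i<n. r i \<in> R \<Longrightarrow> w ^ n = (\<Sum>i<n. r i * w ^ i) \<Longrightarrow> w \<in> R"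
  unfolding integrally_closed_def by blast

text \<open>Multiplying the equation by the power s - 1 of its leading coefficient makes it monic in
  \<open>b s * w\<close>. For \<open>s = 0\<close> it says that \<open>b 0\<close> vanishes.\<close>

lemma integrally_closed_multiple:
  assumes R: "field_subring R" "integrally_closed R" and b: "\<And>i. i \<le> s \<Longrightarrow> b i \<in> R"
    and eq: "(\<Sum>i\<le>s. b i * w ^ i) = 0"
  shows "b s * w \<in> R"
proof (cases s)
  case 0
  then show ?thesis using eq field_subring.zero[OF R(1)] by simp
next
  case (Suc m)
  interpret field_subring R by (rule R)
  have "(b s * w) ^ s = b s ^ m * (b s * w ^ s)"
    by (simp add: Suc power_mult_distrib)
  also have "b s * w ^ s = - (\<Sum>i<s. b i * w ^ i)"
    using eq sum.lessThan_Suc[of "\<lambda>i. b i * w ^ i" s] unfolding lessThan_Suc_atMost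
    by (simp only: eq_neg_iff_add_eq_0 add.commute)
  also have "b s ^ m * - (\<Sum>i<s. b i * w ^ i) = (\<Sum>i<s. (- b i * b s ^ (m - i)) * (b s * w) ^ i)"
    unfolding mult_minus_right sum_distrib_left sum_negf[symmetric]
  proof (rule sum.cong)
    fix i assume "i \<in> {..<s}"
    then have "b s ^ m = b s ^ (m - i) * b s ^ i" using Suc by (simp flip: power_add)
    then show "- (b s ^ m * (b i * w ^ i)) = - b i * b s ^ (m - i) * (b s * w) ^ i"
      by (simp add: power_mult_distrib mult_ac)
  qed simp
  finally have "(b s * w) ^ s = (\<Sum>i<s. (- b i * b s ^ (m - i)) * (b s * w) ^ i)" .
  moreover have "\<forall>i<s. - b i * b s ^ (m - i) \<in> R" using b by (auto intro!: closed)
  ultimately show ?thesis by (intro integrally_closedD[OF R(2)])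
qed

text \<open>Besides the finiteness of \<open>k\<close>, two properties of a function field are
  retained: \<open>k\<close> is algebraically closed in it, and it is finite over k(x) for every
  nonconstant \<open>x\<close>.\<close>

locale function_field = finite_constants k for k :: "'k::field set" +
  assumes transcendental: "x \<notin> k \<Longrightarrow> p \<in> kpoly \<Longrightarrow> poly p x = 0 \<Longrightarrow> p = 0"
    and kindep_bound: "\<exists>N. \<forall>m a. kindep x m a \<longrightarrow> m \<le> N"
begin

lemma algebraic_relation:
  "\<exists>f s. (\<forall>i\<le>s. f i \<in> kpoly) \<and> f s \<noteq> 0 \<and> (\<Sum>i\<le>s. poly (f i) x * w ^ i) = 0"
proof -
  obtain N where "\<And>m a. kindep x m a \<Longrightarrow> m \<le> N" using kindep_bound by blast
  then have "\<not> kindep x (Suc N) (\<lambda>i. w ^ i)" using Suc_n_not_le_n by blast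
  then obtain f where f: "\<And>i. i < Suc N \<Longrightarrow> f i \<in> kpoly" "(\<Sum>i<Suc N. poly (f i) x * w ^ i) = 0" "\<exists>i<Suc N. f i \<noteq> 0"
    unfolding kindep_def by blast
  define s where "s = Max {i. i < Suc N \<and> f i \<noteq> 0}"
  have fin: "finite {i. i < Suc N \<and> f i \<noteq> 0}" by simp
  have s: "s < Suc N" "f s \<noteq> 0" using Max_in[OF fin] f(3) by (auto simp: s_def)
  have "f i = 0" if "i < Suc N" "i > s" for i
    using Max_ge[OF fin, of i, folded s_def] that by (auto simp: not_le[symmetric])
  then have "(\<Sum>i\<le>s. poly (f i) x * w ^ i) = (\<Sum>i<Suc N. poly (f i) x * w ^ i)"
    using s by (intro sum.mono_neutral_left) auto
  then show ?thesis using f s by (intro exI[of _ f] exI[of _ s]) auto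
qed

lemma poly_mem:
  assumes "field_subring R" "k \<subseteq> R" "x \<in> R" "p \<in> kpoly"
  shows "poly p x \<in> R"
proof -
  interpret R: field_subring R by fact
  show ?thesis unfolding poly_altdef using assms kpoly_coeff by (auto intro!: R.closed)
qed

text \<open>The residues of the \<open>a i\<close> in R/yR are linearly independent over
  \<open>k\<close>.\<close>

definition modindep :: "'k set \<Rightarrow> 'k \<Rightarrow> nat \<Rightarrow> (nat \<Rightarrow> 'k) \<Rightarrow> bool"
  where "modindep R y m a \<longleftrightarrow> (\<forall>i<m. a i \<in> R) \<and>
    (\<forall>c. (\<forall>i<m. c i \<in> k) \<longrightarrow> (\<Sum>i<m. c i * a i) \<in> (*) y ` R \<longrightarrow> (\<forall>i<m. c i = 0))"

lemma modindepD:
  "modindep R y m a \<Longrightarrow> \<forall>i<m. c i \<in> k \<Longrightarrow> (\<Sum>i<m. c i * a i) \<in> (*) y ` R \<Longrightarrow> \<forall>i<m. c i = 0"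
  unfolding modindep_def by blast

text \<open>Modulo \<open>y\<close> a relation over k[y] reduces to its constant coefficients, which
  therefore vanish. All coefficients are then divisible by the variable, \<open>y\<close> can be
  cancelled, and the degree bound drops.\<close>

lemma modindep_kindep:
  assumes R: "field_subring R" "k \<subseteq> R" "y \<in> R" "y \<noteq> 0" and a: "modindep R y m a"
  shows "kindep y m a"
proof -
  interpret R: field_subring R by fact
  have aR: "a i \<in> R" if "i < m" for i using a that by (auto simp: modindep_def)
  have key: "\<forall>i<m. f i = 0" if "\<And>i. i < m \<Longrightarrow> Polynomial.degree (f i) \<le> d" "\<And>i. i < m \<Longrightarrow> f i \<in> kpoly"
    "(\<Sum>i<m. poly (f i) y * a i) = 0" for f d
    using that
  proof (induction d arbitrary: f)
    case (0 f)
    have *: "f i = [:Polynomial.coeff (f i) 0:]" if "i < m" for i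
      using 0(1)[OF that] by (metis degree_eq_zeroE le_zero_eq coeff_pCons_0)
    have "poly (f i) y = Polynomial.coeff (f i) 0" if "i < m" for i
      by (subst *[OF that]) simp
    then have "(\<Sum>i<m. Polynomial.coeff (f i) 0 * a i) = 0" using 0(3) by simp
    also have "0 \<in> (*) y ` R" using R.zero by force
    finally have "\<forall>i<m. Polynomial.coeff (f i) 0 = 0"
      using 0(2) kpoly_coeff by (intro modindepD[OF a]) auto
    then show ?case using * by (metis pCons_0_0)
  next
    case (Suc d f)
    define g where "g = (\<lambda>i. poly_shift 1 (f i))"
    have fg: "f i = pCons (Polynomial.coeff (f i) 0) (g i)" for i
      by (rule poly_eqI) (auto simp: g_def coeff_poly_shift coeff_pCons split: nat.splits)
    have gk: "g i \<in> kpoly" if "i < m" for i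
      using Suc(3)[OF that] by (auto simp: kpoly_def g_def coeff_poly_shift)
    have gd: "Polynomial.degree (g i) \<le> d" if "i < m" for i
      using Suc(2)[OF that] fg[of i] degree_pCons_eq[of "g i"] by (metis Suc_le_mono degree_0 le0)
    have sum: "(\<Sum>i<m. Polynomial.coeff (f i) 0 * a i) + y * (\<Sum>i<m. poly (g i) y * a i) = 0"
    proof -
      have "poly (f i) y * a i = Polynomial.coeff (f i) 0 * a i + y * (poly (g i) y * a i)" for i
        by (subst fg) (simp add: algebra_simps)
      then show ?thesis using Suc(4) by (simp add: sum.distrib sum_distrib_left)
    qed
    have "(\<Sum>i<m. poly (g i) y * a i) \<in> R"
      using poly_mem[OF R(1-3) gk] aR by (intro R.sum R.mult) auto
    moreover have "(\<Sum>i<m. Polynomial.coeff (f i) 0 * a i) = y * - (\<Sum>i<m. poly (g i) y * a i)"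
      using sum by (simp add: eq_neg_iff_add_eq_0)
    ultimately have "(\<Sum>i<m. Polynomial.coeff (f i) 0 * a i) \<in> (*) y ` R"
      using R.uminus by blast
    then have c0: "\<forall>i<m. Polynomial.coeff (f i) 0 = 0"
      using Suc(3) kpoly_coeff by (intro modindepD[OF a]) auto
    then have "(\<Sum>i<m. poly (g i) y * a i) = 0" using sum R(4) by simp
    then have "\<forall>i<m. g i = 0" by (intro Suc.IH gd gk)
    then show ?case using fg c0 by (metis pCons_0_0)
  qed
  have "\<forall>i<m. f i = 0" if f: "\<forall>i<m. f i \<in> kpoly" "(\<Sum>i<m. poly (f i) y * a i) = 0" for f
  proof (rule key[of f "Max ((\<lambda>i. Polynomial.degree (f i)) ` {..<m})"])
    show "Polynomial.degree (f i) \<le> Max ((\<lambda>i. Polynomial.degree (f i)) ` {..<m})" if "i < m" for i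
      using that by (intro Max_ge) auto
  qed (use f in auto)
  then show ?thesis unfolding kindep_def by blast
qed

text \<open>\<open>kindep_bound\<close> limits the length of independent families, so a longest one
  exists. Appending \<open>r\<close> to it creates a relation modulo \<open>y\<close> in which the
  coefficient of \<open>r\<close> cannot vanish.\<close>

lemma modindep_spanning:
  assumes R: "field_subring R" "k \<subseteq> R" "y \<in> R" "y \<noteq> 0"
  shows "\<exists>m a. modindep R y m a \<and>
    (\<forall>r\<in>R. \<exists>c. (\<forall>i<m. c i \<in> k) \<and> (\<exists>t\<in>R. r = (\<Sum>i<m. c i * a i) + y * t))"
proof -
  interpret R: field_subring R by fact
  obtain N where N: "\<And>m a. modindep R y m a \<Longrightarrow> m \<le> N"
    using kindep_bound[of y] modindep_kindep[OF R] by blast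
  define m where "m = (GREATEST m. \<exists>a. modindep R y m a)"
  have "modindep R y 0 (\<lambda>_. 0)" by (simp add: modindep_def)
  then have "\<exists>a. modindep R y m a" unfolding m_def
    using GreatestI_nat[of "\<lambda>m. \<exists>a. modindep R y m a" 0 N] N by blast
  then obtain a where a: "modindep R y m a" by blast
  have max: "\<not> modindep R y (Suc m) b" for b
    using Greatest_le_nat[of "\<lambda>m. \<exists>a. modindep R y m a" "Suc m" N] N unfolding m_def[symmetric] by (metis Suc_n_not_le_n)
  have "\<exists>c. (\<forall>i<m. c i \<in> k) \<and> (\<exists>t\<in>R. r = (\<Sum>i<m. c i * a i) + y * t)" if r: "r \<in> R" for r
  proof -
    have "\<forall>i<Suc m. (a(m := r)) i \<in> R" using a r by (auto simp: modindep_def less_Suc_eq)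
    then obtain c where c': "\<forall>i<Suc m. c i \<in> k" "(\<Sum>i<Suc m. c i * (a(m := r)) i) \<in> (*) y ` R"
      and c: "\<exists>i<Suc m. c i \<noteq> 0"
      using max[of "a(m := r)"] unfolding modindep_def by blast
    note c = c'(1)[rule_format] c'(2) c
    obtain t where t: "t \<in> R" "(\<Sum>i<m. c i * a i) + c m * r = y * t" using c(2) by auto
    have "c m \<noteq> 0"
    proof
      assume "c m = 0"
      then have "(\<Sum>i<m. c i * a i) \<in> (*) y ` R" using t by auto
      then have "\<forall>i<m. c i = 0" using c(1) by (intro modindepD[OF a]) auto
      then show False using c(3) \<open>c m = 0\<close> less_Suc_eq by auto
    qed
    have "r = inverse (c m) * (c m * r)" using \<open>c m \<noteq> 0\<close> by simp
    also have "c m * r = y * t - (\<Sum>i<m. c i * a i)" using t(2) by (simp add: algebra_simps)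
    also have "inverse (c m) * \<dots> = (\<Sum>i<m. (- inverse (c m) * c i) * a i) + y * (inverse (c m) * t)"
      by (simp add: right_diff_distrib sum_distrib_left sum_negf mult_ac)
    finally have "r = (\<Sum>i<m. (- inverse (c m) * c i) * a i) + y * (inverse (c m) * t)" .
    moreover have "inverse (c m) * t \<in> R" using inverse[OF c(1)[of m]] R(2) t(1) by (intro R.mult) auto
    moreover have "\<forall>i<m. - inverse (c m) * c i \<in> k" using c(1) inverse by (auto intro!: mult uminus)
    ultimately show ?thesis by (intro exI[of _ "\<lambda>i. - inverse (c m) * c i"]) blast
  qed
  then show ?thesis using a by blast
qed

lemma finite_quotients:
  assumes R: "field_subring R" "k \<subseteq> R" "y \<in> R" "y \<noteq> 0"
  shows "finite_quotient R y"
proof -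
  obtain m a where a: "modindep R y m a"
    and sp: "\<And>r. r \<in> R \<Longrightarrow> \<exists>c. (\<forall>i<m. c i \<in> k) \<and> (\<exists>t\<in>R. r = (\<Sum>i<m. c i * a i) + y * t)"
    using modindep_spanning[OF R] by blast
  interpret R: field_subring R by fact
  define S where "S = (\<lambda>c. \<Sum>i<m. c i * a i) ` ({..<m} \<rightarrow>\<^sub>E k)"
  have "finite S" unfolding S_def using fin by (intro finite_imageI finite_PiE) auto
  moreover have "S \<subseteq> R" unfolding S_def using a R(2) by (auto simp: modindep_def intro!: R.closed)
  moreover have "\<exists>s\<in>S. \<exists>t\<in>R. r = s + y * t" if r: "r \<in> R" for r
  proof -
    obtain c t where c: "\<forall>i<m. c i \<in> k" "t \<in> R" "r = (\<Sum>i<m. c i * a i) + y * t" using sp[OF r] by blast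
    have "(\<Sum>i<m. c i * a i) = (\<Sum>i<m. restrict c {..<m} i * a i)" by simp
    moreover have "restrict c {..<m} \<in> {..<m} \<rightarrow>\<^sub>E k" using c(1) by auto
    ultimately have "(\<Sum>i<m. c i * a i) \<in> S" unfolding S_def by (rule image_eqI)
    then show ?thesis using c by blast
  qed
  ultimately show ?thesis unfolding finite_quotient_def by blast
qed

text \<open>The leading coefficient of an algebraic equation for \<open>w\<close> over k[y] is a
  denominator of \<open>w\<close>; it is nonzero because \<open>y\<close> is transcendental over
  \<open>k\<close>.\<close>

lemma fraction_ring_if_nonconstant:
  assumes R: "field_subring R" "k \<subseteq> R" "integrally_closed R" and y: "y \<in> R" "y \<notin> k"
  shows "fraction_ring R"
proof -
  interpret R: field_subring R by fact
  show ?thesis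
  proof (intro fraction_ring.intro finite_quotient_ring.intro R finite_quotient_ring_axioms.intro fraction_ring_axioms.intro finite_quotients)
    fix w
    obtain f s where f: "\<And>i. i \<le> s \<Longrightarrow> f i \<in> kpoly" "f s \<noteq> 0" "(\<Sum>i\<le>s. poly (f i) y * w ^ i) = 0"
      using algebraic_relation[of y w] by blast
    have "poly (f s) y * w \<in> R"
      using integrally_closed_multiple[OF R(1,3), of s "\<lambda>i. poly (f i) y" w] poly_mem[OF R(1,2) y(1)] f by blast
    moreover have "poly (f s) y \<noteq> 0" using transcendental[OF y(2)] f by blast
    moreover have "poly (f s) y \<in> R" using poly_mem[OF R(1,2) y(1)] f by blast
    ultimately show "\<exists>d\<in>R. d \<noteq> 0 \<and> d * w \<in> R" by blast
  qed
qed

section \<open>Valuation rings over the constants and their nonunits\<close>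

definition val_ring :: "'k set \<Rightarrow> bool"
  where "val_ring V \<longleftrightarrow> field_subring V \<and> k \<subseteq> V \<and> (\<forall>z. z \<in> V \<or> inverse z \<in> V)"

text \<open>The maximal ideal of V. Zero is named separately because \<open>inverse 0 = 0\<close>
  belongs to V. As \<open>val_ring\<close> admits the whole field, this ideal may be zero.\<close>

definition nonunits :: "'k set \<Rightarrow> 'k set"
  where "nonunits V = {z \<in> V. z = 0 \<or> inverse z \<notin> V}"

text \<open>For \<open>w\<close> outside V the inverse is in V, and dividing the monic equation by
  w^(n - 1) expresses \<open>w\<close> through that inverse.\<close>

lemma val_ring_integrally_closed:
  assumes V: "val_ring V"
  shows "integrally_closed V"
  unfolding integrally_closed_def
proof (intro allI impI, elim conjE)
  fix w n r assume r: "\<forall>i<n. r i \<in> V" and eq: "w ^ n = (\<Sum>i<n. r i * w ^ i)"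
  interpret V: field_subring V using V by (simp add: val_ring_def)
  show "w \<in> V"
  proof (rule ccontr)
    assume w: "w \<notin> V"
    then have inv: "inverse w \<in> V" and w0: "w \<noteq> 0" using V V.zero by (auto simp: val_ring_def)
    obtain m where n: "n = Suc m" using eq by (cases n) auto
    have "w = inverse w ^ m * w ^ n" using w0 by (simp add: n power_inverse)
    also have "\<dots> = (\<Sum>i<n. r i * inverse w ^ (m - i))"
      unfolding eq sum_distrib_left
    proof (rule sum.cong)
      fix i assume "i \<in> {..<n}"
      then have "inverse w ^ m = inverse w ^ (m - i) * inverse w ^ i" using n by (simp flip: power_add)
      then show "inverse w ^ m * (r i * w ^ i) = r i * inverse w ^ (m - i)"
        using w0 by (simp add: mult_ac power_inverse)
    qed simp
    also have "\<dots> \<in> V" using r inv by (auto intro!: V.closed)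
    finally show False using w by blast
  qed
qed

text \<open>Of two nonzero nonunits one divides the other in V, so their sum is a multiple of one of
  them.\<close>

lemma nonunits_submod:
  assumes V: "val_ring V"
  shows "submod V (nonunits V)"
proof -
  interpret V: field_subring V using V by (simp add: val_ring_def)
  have mult: "r * z \<in> nonunits V" if "r \<in> V" "z \<in> nonunits V" for r z
  proof -
    have "inverse z \<in> V" if "inverse (r * z) \<in> V" "r * z \<noteq> 0"
      using V.mult[OF \<open>r \<in> V\<close> that(1)] that(2) by (simp add: field_simps)
    then show ?thesis using that by (auto simp: nonunits_def intro: V.mult)
  qed
  have half: "a + b \<in> nonunits V" if "a \<in> nonunits V" "b \<in> nonunits V" "a \<noteq> 0" "b * inverse a \<in> V" for a b
  proof -
    have "a + b = (1 + b * inverse a) * a" using that(3) by (simp add: field_simps)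
    then show ?thesis using mult[of "1 + b * inverse a" a] that V.one V.add by simp
  qed
  have "a + b \<in> nonunits V" if ab: "a \<in> nonunits V" "b \<in> nonunits V" for a b
  proof (cases "a = 0 \<or> b = 0")
    case False
    have "b * inverse a \<in> V \<or> inverse (b * inverse a) \<in> V" using V by (auto simp: val_ring_def)
    then have "b * inverse a \<in> V \<or> a * inverse b \<in> V" by (simp add: mult.commute)
    then show ?thesis using half[of a b] half[of b a] ab False by (auto simp: add.commute)
  qed (use ab in auto)
  moreover have "0 \<in> nonunits V" by (simp add: nonunits_def V.zero)
  ultimately show ?thesis using mult by (auto simp: submod_def)
qed

lemma one_not_nonunit: "1 \<notin> nonunits V"
  by (auto simp: nonunits_def)

lemma unitI: "z \<in> V \<Longrightarrow> z \<notin> nonunits V \<Longrightarrow> z \<noteq> 0 \<and> inverse z \<in> V"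
  by (auto simp: nonunits_def)

lemma nonunitI: "val_ring V \<Longrightarrow> z \<notin> V \<Longrightarrow> inverse z \<in> nonunits V"
  by (auto simp: nonunits_def val_ring_def)

lemma nonunit_power:
  assumes V: "val_ring V" and z: "z \<in> V" "z ^ n \<in> nonunits V"
  shows "z \<in> nonunits V"
proof (rule ccontr)
  interpret V: field_subring V using V by (simp add: val_ring_def)
  assume "z \<notin> nonunits V"
  then have "z \<noteq> 0" "inverse z \<in> V" using unitI z by blast+
  then have "z ^ n \<noteq> 0" "inverse (z ^ n) \<in> V" using V.power[of "inverse z" n] by (auto simp: power_inverse)
  then show False using z by (auto simp: nonunits_def)
qed

lemma power_nonunit:
  assumes V: "val_ring V" and z: "z \<in> nonunits V" "n > 0"
  shows "z ^ n \<in> nonunits V"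
proof -
  interpret V: field_subring V using V by (simp add: val_ring_def)
  have "z \<in> V" using z by (auto simp: nonunits_def)
  then have "z ^ (n - 1) * z \<in> nonunits V"
    using V.submod_mult[OF nonunits_submod[OF V] V.power z(1)] by blast
  then show ?thesis using z(2) by (cases n) (auto simp: mult.commute)
qed

lemma one_minus_nonunit:
  assumes V: "val_ring V" and z: "z \<in> nonunits V"
  shows "z - 1 \<noteq> 0" "inverse (z - 1) \<in> V"
proof -
  interpret V: field_subring V using V by (simp add: val_ring_def)
  have "z \<in> V" using z by (auto simp: nonunits_def)
  then have 1: "z - 1 \<in> V" using V.one by (rule V.diff)
  have "z - 1 \<notin> nonunits V"
    using V.submod_diff[OF nonunits_submod[OF V] z, of "z - 1"] one_not_nonunit by auto
  then show "z - 1 \<noteq> 0" "inverse (z - 1) \<in> V" using unitI[OF 1] by auto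
qed

lemma val_ring_Inter:
  assumes "\<And>V. V \<in> \<V> \<Longrightarrow> val_ring V"
  shows "field_subring (\<Inter>\<V>)" "k \<subseteq> \<Inter>\<V>" "integrally_closed (\<Inter>\<V>)"
proof -
  have *: "field_subring V" "k \<subseteq> V" "integrally_closed V" if "V \<in> \<V>" for V
    using assms[OF that] val_ring_integrally_closed by (auto simp: val_ring_def)
  show "field_subring (\<Inter>\<V>)"
    by unfold_locales (use * in \<open>auto dest: field_subring.closed\<close>)
  show "k \<subseteq> \<Inter>\<V>" using * by blast
  show "integrally_closed (\<Inter>\<V>)"
    using *(3) unfolding integrally_closed_def by (meson InterE InterI)
qed

end

section \<open>A nonconstant element with a single pole\<close>

locale marked_pole = function_field k for k :: "'k::field set" +
  fixes V1 :: "'k set" and x :: 'k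
  assumes V1: "val_ring V1" and x: "x \<notin> V1"
begin

section \<open>Functions regular at the poles of x\<close>

definition y where "y = inverse x"

definition Ws where "Ws = {V. val_ring V \<and> x \<notin> V}"

definition W where "W = \<Inter>Ws"

text \<open>If \<open>V1\<close> is the only pole of \<open>x\<close>, the family is empty and
  \<open>W'\<close> is the whole field; there are then no principal parts away from
  \<open>V1\<close>.\<close>

definition W' where "W' = \<Inter>(Ws - {V1})"

lemma V1_Ws: "V1 \<in> Ws"
  using V1 x by (simp add: Ws_def)

lemma Ws_val: "V \<in> Ws \<Longrightarrow> val_ring V"
  by (simp add: Ws_def)

lemma Ws_subring: "V \<in> Ws \<Longrightarrow> field_subring V"
  by (simp add: Ws_def val_ring_def)

lemma y_nonunit: "V \<in> Ws \<Longrightarrow> y \<in> nonunits V"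
  unfolding y_def by (rule nonunitI) (auto simp: Ws_def)

lemma y_mem: "V \<in> Ws \<Longrightarrow> y \<in> V"
  using y_nonunit by (auto simp: nonunits_def)

lemma x0: "x \<noteq> 0"
  using x Ws_subring[OF V1_Ws] by (auto dest: field_subring.zero)

lemma y0: "y \<noteq> 0"
  using x0 by (simp add: y_def)

lemma xy [simp]: "x * y = 1" "y * x = 1"
  using x0 by (simp_all add: y_def)

lemma W_ring: "field_subring W" "k \<subseteq> W" "integrally_closed W"
  unfolding W_def using val_ring_Inter[of Ws] Ws_val by auto

lemma W'_ring: "field_subring W'" "k \<subseteq> W'"
  unfolding W'_def using val_ring_Inter[of "Ws - {V1}"] Ws_val by auto

lemma W_sub: "V \<in> Ws \<Longrightarrow> W \<subseteq> V" "V \<in> Ws - {V1} \<Longrightarrow> W' \<subseteq> V" "W \<subseteq> W'"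
  unfolding W_def W'_def by auto

lemma y_W: "y \<in> W" "y \<in> W'"
  using y_mem by (auto simp: W_def W'_def)

lemma y_notin_k: "y \<notin> k"
proof
  assume "y \<in> k"
  then have "x \<in> k" using inverse[of y] by (simp add: y_def)
  then show False using V1 x by (auto simp: val_ring_def)
qed

sublocale W: fraction_ring W
  using fraction_ring_if_nonconstant[OF W_ring y_W(1) y_notin_k] .

sublocale W': field_subring W'
  by (rule W'_ring)

lemma fq_W: "finite_quotient W y"
  using W.fin_quot[OF y_W(1) y0] .

text \<open>A member of \<open>Ws\<close> is the localisation of \<open>W\<close> at the trace of its maximal ideal.\<close>

lemma Ws_determined:
  assumes V: "V \<in> Ws" "V' \<in> Ws" and eq: "nonunits V \<inter> W = nonunits V' \<inter> W"
  shows "V \<subseteq> V'"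
proof
  fix g assume g: "g \<in> V"
  interpret V: field_subring V using V(1) by (rule Ws_subring)
  interpret V': field_subring V' using V(2) by (rule Ws_subring)
  note NV = nonunits_submod[OF Ws_val[OF V(1)]] and NV' = nonunits_submod[OF Ws_val[OF V(2)]]
  show "g \<in> V'"
  proof (rule ccontr)
    assume gV': "g \<notin> V'"
    then have g0: "g \<noteq> 0" using V'.zero by auto
    have ig: "inverse g \<in> nonunits V'" using gV' nonunitI Ws_val[OF V(2)] by blast
    \<comment> \<open>\<open>u\<close> and \<open>v\<close> lie in the inverse of the ideal gW + W.
      Where \<open>v\<close> is a unit, g = gv/v is regular; otherwise gu is a unit, and 1/g =
      u/(gu) is controlled by elements of \<open>W\<close>.\<close>
    obtain u v where uv: "g * u + 1 * v = 1" "g * u \<in> W" "g * v \<in> W" "1 * u \<in> W" "1 * v \<in> W"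
      using W.pair_inverse[of g 1] by auto
    have "g * u \<notin> nonunits V' \<or> v \<notin> nonunits V'"
      using V'.submod_add[OF NV', of "g * u" v] uv(1) one_not_nonunit[of V'] by auto
    then show False
    proof
      assume "v \<notin> nonunits V'"
      then have "v \<noteq> 0" "inverse v \<in> V'" using unitI[of v V'] uv(5) W_sub(1)[OF V(2)] by auto
      then have "inverse v * (g * v) \<in> V'" using uv(3) W_sub(1)[OF V(2)] by (blast intro: V'.mult)
      moreover have "inverse v * (g * v) = g" using \<open>v \<noteq> 0\<close> by simp
      ultimately show False using gV' by simp
    next
      assume gu: "g * u \<notin> nonunits V'"
      then have "g * u \<notin> nonunits V" using eq uv(2) by blast
      then have u: "g * u \<noteq> 0" "inverse (g * u) \<in> V" using unitI[of "g * u" V] uv(2) W_sub(1)[OF V(1)] by auto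
      have "g * u * inverse g \<in> nonunits V'" using ig uv(2) W_sub(1)[OF V(2)] by (intro V'.submod_mult[OF NV']) auto
      moreover have "g * u * inverse g = u" using g0 by simp
      ultimately have "u \<in> nonunits V'" by simp
      then have "u \<in> nonunits V" using eq uv(4) by auto
      then have "inverse (g * u) * u \<in> nonunits V" using u by (intro V.submod_mult[OF NV]) auto
      moreover have "inverse (g * u) * u = inverse g" using u g0 by simp
      ultimately have "inverse g \<in> nonunits V" by metis
      then show False using g g0 by (auto simp: nonunits_def)
    qed
  qed
qed

text \<open>Traces on \<open>W\<close> of the maximal ideals contain \<open>y\<close>, and W/yW is
  finite, so one trace inside another equals it: for \<open>z\<close> in the larger one only, some
  z^N(z^N - 1) is in yW, hence z^N - 1 is in the smaller and both z^N and z^N - 1 are in the larger.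
  Equal traces give equal rings by \<open>Ws_determined\<close>.\<close>

lemma separation:
  assumes V: "V \<in> Ws" "V \<noteq> V1"
  shows "\<exists>z\<in>W. z \<in> nonunits V \<and> z \<notin> nonunits V1"
proof (rule ccontr)
  assume "\<not> ?thesis"
  then have sub: "nonunits V \<inter> W \<subseteq> nonunits V1" by blast
  interpret V: field_subring V using V(1) by (rule Ws_subring)
  interpret V1: field_subring V1 using V1_Ws by (rule Ws_subring)
  note NV = nonunits_submod[OF Ws_val[OF V(1)]]
  have "z \<in> nonunits V" if z: "z \<in> nonunits V1" "z \<in> W" for z
  proof (rule ccontr)
    assume "z \<notin> nonunits V"
    obtain N t where N: "N > 0" "t \<in> W" "z ^ (2 * N) = z ^ N + y * t"
      using W.idempotent_power[OF fq_W z(2) y_W(1)] by blast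
    have zV: "z \<in> V" using z(2) W_sub(1)[OF V(1)] by blast
    have zN: "z ^ N \<noteq> 0" "inverse (z ^ N) \<in> V"
      using unitI[of "z ^ N" V] nonunit_power[OF Ws_val[OF V(1)] zV, of N] \<open>z \<notin> nonunits V\<close> V.power[OF zV] by auto
    have "z ^ N * (z ^ N - 1) = t * y" using N(3)[unfolded mult_2 power_add] by (simp add: algebra_simps)
    then have "z ^ N - 1 = inverse (z ^ N) * t * y" using zN(1) by (simp add: field_simps)
    also have "\<dots> \<in> nonunits V"
      using zN(2) N(2) W_sub(1)[OF V(1)] by (intro V.submod_mult[OF NV _ y_nonunit[OF V(1)]] V.mult) auto
    finally have "z ^ N - 1 \<in> nonunits V1" using sub W.diff[OF W.power[OF z(2)] W.one] by blast
    then have "z ^ N - (z ^ N - 1) \<in> nonunits V1"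
      using V1.submod_diff[OF nonunits_submod[OF V1]] power_nonunit[OF V1 z(1) N(1)] by blast
    then show False using one_not_nonunit[of V1] by simp
  qed
  then have "nonunits V \<inter> W = nonunits V1 \<inter> W" using sub by blast
  then show False using Ws_determined[OF V(1) V1_Ws] Ws_determined[OF V1_Ws V(1)] V(2) by blast
qed

text \<open>Take the product of all representatives modulo \<open>y\<close> that are units at
  \<open>V1\<close>. A function separating V from \<open>V1\<close> is congruent modulo
  \<open>y\<close> to one of them, which then vanishes at V as well, so this one finite product
  serves all V.\<close>

lemma unit_at_V1_only: "\<exists>z\<in>W. z \<notin> nonunits V1 \<and> (\<forall>V\<in>Ws - {V1}. z \<in> nonunits V)"
proof -
  obtain S where S: "finite S" "S \<subseteq> W" "\<And>r. r \<in> W \<Longrightarrow> \<exists>s\<in>S. \<exists>t\<in>W. r = s + y * t"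
    using fq_W unfolding finite_quotient_def by blast
  define T where "T = {s \<in> S. s \<notin> nonunits V1}"
  interpret V1: field_subring V1 using V1_Ws by (rule Ws_subring)
  have T: "finite T" "T \<subseteq> W" using S by (auto simp: T_def)
  have WV1: "W \<subseteq> V1" using W_sub(1)[OF V1_Ws] .
  have 1: "\<Prod>T \<in> W" using T by (intro W.prod) auto
  have "t \<noteq> 0 \<and> inverse t \<in> V1" if "t \<in> T" for t
    using unitI[of t V1] that T WV1 by (auto simp: T_def)
  then have "\<Prod>T \<noteq> 0" "(\<Prod>t\<in>T. inverse t) \<in> V1" using T(1) by (auto intro: V1.prod)
  then have 2: "\<Prod>T \<notin> nonunits V1" using prod_inversef[of "\<lambda>t. t" T] by (simp add: nonunits_def comp_def)
  have "\<Prod>T \<in> nonunits V" if V: "V \<in> Ws - {V1}" for V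
  proof -
    interpret V: field_subring V using V by (auto intro: Ws_subring)
    have N: "submod V (nonunits V)" using nonunits_submod[of V] Ws_val V by blast
    obtain z where z: "z \<in> W" "z \<in> nonunits V" "z \<notin> nonunits V1" using separation V by blast
    obtain s t where st: "s \<in> S" "t \<in> W" "z = s + y * t" using S(3) z(1) by blast
    have "t * y \<in> nonunits V1" using st(2) WV1 by (intro V1.submod_mult[OF nonunits_submod[OF V1] _ y_nonunit[OF V1_Ws]]) auto
    then have "s \<notin> nonunits V1" using z(3) st(3) V1.submod_add[OF nonunits_submod[OF V1], of s "t * y"] by (auto simp: mult.commute)
    then have sT: "s \<in> T" using st by (simp add: T_def)
    have "t * y \<in> nonunits V" using st(2) W_sub(1)[of V] V by (intro V.submod_mult[OF N] y_nonunit) auto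
    then have "s \<in> nonunits V" using V.submod_diff[OF N z(2), of "t * y"] st(3) by (simp add: mult.commute)
    moreover have "\<Prod>(T - {s}) \<in> V" using T W_sub(1)[of V] V by (intro V.prod) auto
    ultimately have "\<Prod>(T - {s}) * s \<in> nonunits V" by (intro V.submod_mult[OF N])
    then show ?thesis using prod.remove[OF T(1) sT, of "\<lambda>t. t"] by (simp add: mult.commute)
  qed
  then show ?thesis using 1 2 by blast
qed

text \<open>An idempotent modulo \<open>y\<close> that is 1 at \<open>V1\<close> and 0 at the other
  poles of \<open>x\<close>. In e(e - 1) = y t the factor that is a unit can be cancelled:
  \<open>e\<close> at \<open>V1\<close>, and \<open>e - 1\<close> elsewhere.\<close>

lemma idempotent_at_V1: "\<exists>e\<in>W. \<exists>v\<in>V1. e = 1 + y * v \<and> (\<exists>w\<in>W'. e = y * w)"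
proof -
  obtain z where z: "z \<in> W" "z \<notin> nonunits V1" "\<And>V. V \<in> Ws - {V1} \<Longrightarrow> z \<in> nonunits V"
    using unit_at_V1_only by blast
  obtain N t where N: "N > 0" "t \<in> W" "z ^ (2 * N) = z ^ N + y * t"
    using W.idempotent_power[OF fq_W z(1) y_W(1)] by blast
  define e where "e = z ^ N"
  have eW: "e \<in> W" unfolding e_def by (rule W.power[OF z(1)])
  have ee: "e * (e - 1) = y * t" using N(3)[unfolded mult_2 power_add] by (simp add: e_def algebra_simps)
  interpret V1: field_subring V1 using V1_Ws by (rule Ws_subring)
  have WV1: "W \<subseteq> V1" using W_sub(1)[OF V1_Ws] .
  have "e \<notin> nonunits V1" unfolding e_def using nonunit_power[OF V1, of z N] z WV1 by blast
  then have e: "e \<noteq> 0" "inverse e \<in> V1" using unitI[of e V1] eW WV1 by auto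
  have "e = 1 + y * (t * inverse e)" using ee e(1) by (simp add: field_simps)
  moreover have "t * inverse e \<in> V1" using N(2) WV1 e(2) by (intro V1.mult) auto
  moreover have "x * e \<in> V" if V: "V \<in> Ws - {V1}" for V
  proof -
    interpret V: field_subring V using V by (auto intro: Ws_subring)
    have "e \<in> nonunits V" unfolding e_def using power_nonunit[of V z N] z(3)[OF V] N(1) Ws_val V by blast
    then have u: "e - 1 \<noteq> 0" "inverse (e - 1) \<in> V" using one_minus_nonunit[of V e] Ws_val V by auto
    have "x * e = x * (e * (e - 1)) * inverse (e - 1)" using u(1) by simp
    also have "\<dots> = t * inverse (e - 1)" unfolding ee by (simp flip: mult.assoc)
    also have "\<dots> \<in> V" using N(2) W_sub(1)[of V] V u(2) by (intro V.mult) auto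
    finally show ?thesis .
  qed
  then have "x * e \<in> W'" by (auto simp: W'_def)
  moreover have "e = y * (x * e)" by (simp flip: mult.assoc)
  ultimately show ?thesis using eW by blast
qed

text \<open>The valuation of \<open>V1\<close> is archimedean because \<open>V1\<close> has finite
  quotients: some y^N(y^N - 1) is a multiple of 1/z, and y^N - 1 is a unit.\<close>

lemma y_power_clears: "\<exists>j. y ^ j * z \<in> V1"
proof (cases "z \<in> V1")
  case True
  then show ?thesis by (intro exI[of _ 0]) simp
next
  case False
  interpret V1: field_subring V1 using V1_Ws by (rule Ws_subring)
  have p: "inverse z \<in> V1" "z \<noteq> 0" using False V1 V1.zero by (auto simp: val_ring_def)
  have "finite_quotient V1 (inverse z)"
    using V1 p by (intro finite_quotients) (auto simp: val_ring_def)
  then obtain N t where N: "N > 0" "t \<in> V1" "y ^ (2 * N) = y ^ N + inverse z * t"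
    using V1.idempotent_power[OF _ y_mem[OF V1_Ws] p(1)] by blast
  have u: "y ^ N - 1 \<noteq> 0" "inverse (y ^ N - 1) \<in> V1"
    using one_minus_nonunit[OF V1 power_nonunit[OF V1 y_nonunit[OF V1_Ws] N(1)]] by auto
  have "y ^ N * (y ^ N - 1) = inverse z * t" using N(3)[unfolded mult_2 power_add] by (simp add: algebra_simps)
  then have "y ^ N * z = t * inverse (y ^ N - 1)" using u(1) p(2) by (simp add: field_simps)
  then show ?thesis using V1.mult[OF N(2) u(2)] by metis
qed

text \<open>Adjoining an element concentrated at \<open>V1\<close> to a family independent modulo \<open>y\<close> away from \<open>V1\<close>
  gives a longer independent family: the local degree at \<open>V1\<close> is positive.\<close>

lemma modindep_W'_extend:
  assumes a: "modindep W' y m a"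
  shows "\<exists>b. kindep y (Suc m) b"
proof -
  obtain e v w where e: "e \<in> W" "v \<in> V1" "e = 1 + y * v" "w \<in> W'" "e = y * w" using idempotent_at_V1 by blast
  interpret V1: field_subring V1 using V1_Ws by (rule Ws_subring)
  have WV1: "W \<subseteq> V1" using W_sub(1)[OF V1_Ws] .
  have aW': "a i \<in> W'" if "i < m" for i using a that by (auto simp: modindep_def)
  have "\<forall>i. \<exists>j. y ^ j * a i \<in> V1" using y_power_clears by blast
  then obtain j where j: "\<And>i. y ^ j i * a i \<in> V1" unfolding choice_iff by blast
  \<comment> \<open>At \<open>V1\<close> the factor 1 - e is -v y, so its power \<open>j i\<close>
    removes the pole of \<open>a i\<close> there; away from \<open>V1\<close> it is 1 modulo
    \<open>y\<close>, which preserves the residues of the \<open>a i\<close>. The last member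
    \<open>e\<close> lies in yW' but not in yW.\<close>
  define b where "b = (\<lambda>i. if i < m then (1 - e) ^ j i * a i else e)"
  have eW': "e \<in> W'" using e(1) W_sub(3) by blast
  have bW: "b i \<in> W" if "i < Suc m" for i
  proof (cases "i < m")
    case True
    have "(1 - e) ^ j i * a i \<in> V" if V: "V \<in> Ws" for V
    proof (cases "V = V1")
      case [simp]: True
      have "1 - e = - v * y" using e(3) by simp
      then have "(1 - e) ^ j i * a i = (- v) ^ j i * (y ^ j i * a i)"
        by (simp only: power_mult_distrib mult.assoc)
      also have "\<dots> \<in> V1" using V1.mult[OF V1.power[OF V1.uminus[OF e(2)]] j] .
      finally show ?thesis by simp
    next
      case False
      then interpret V: field_subring V using V by (auto intro: Ws_subring)
      have "W' \<subseteq> V" using False V by (intro W_sub) auto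
      then have "e \<in> V" "a i \<in> V" using eW' aW'[OF True] by auto
      then show ?thesis using V.one by (intro V.mult V.power V.diff)
    qed
    then show ?thesis using True by (simp add: b_def W_def)
  qed (use e(1) in \<open>simp add: b_def\<close>)
  have diff: "\<exists>t\<in>W'. b i = a i + y * t" if i: "i < m" for i
  proof -
    have "\<exists>t\<in>W'. (1 - e) ^ n = 1 + y * t" for n
    proof (induction n)
      case 0
      show ?case using W'.zero by auto
    next
      case (Suc n)
      then obtain t where t: "t \<in> W'" "(1 - e) ^ n = 1 + y * t" by blast
      have "(1 - e) ^ Suc n = (1 - e) ^ n - e * (1 - e) ^ n" by (simp add: algebra_simps)
      also have "\<dots> = 1 + y * (t - w * (1 - e) ^ n)" using t(2) e(5) by (simp add: algebra_simps)
      finally show ?case using t(1) e(4) eW' by (blast intro: W'.closed)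
    qed
    then obtain t where t: "t \<in> W'" "(1 - e) ^ j i = 1 + y * t" by blast
    have "b i = a i + y * (t * a i)" using i t(2) by (simp add: b_def algebra_simps)
    then show ?thesis using t(1) aW'[OF i] W'.mult by blast
  qed
  then obtain \<delta> where \<delta>: "\<And>i. i < m \<Longrightarrow> \<delta> i \<in> W'" "\<And>i. i < m \<Longrightarrow> b i = a i + y * \<delta> i" by metis
  have "modindep W y (Suc m) b"
    unfolding modindep_def
  proof (intro conjI allI impI)
    fix c i assume c: "\<forall>i<Suc m. c i \<in> k" and mem: "(\<Sum>i<Suc m. c i * b i) \<in> (*) y ` W" and i: "i < Suc m"
    obtain s where s: "s \<in> W" "(\<Sum>i<m. c i * b i) + c m * e = y * s" using mem by (auto simp: b_def)
    have cW': "c i \<in> W'" if "i < Suc m" for i using c that W'_ring(2) by blast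
    have "(\<Sum>i<m. c i * b i) = (\<Sum>i<m. c i * a i) + y * (\<Sum>i<m. c i * \<delta> i)"
      unfolding sum_distrib_left sum.distrib[symmetric]
      by (intro sum.cong) (auto simp: \<delta>(2) algebra_simps)
    then have "(\<Sum>i<m. c i * a i) = y * (s - c m * w - (\<Sum>i<m. c i * \<delta> i))"
      using s(2) e(5) by (simp add: algebra_simps)
    moreover have "s - c m * w - (\<Sum>i<m. c i * \<delta> i) \<in> W'"
      using s(1) W_sub(3) cW' e(4) \<delta>(1) by (intro W'.diff W'.mult W'.sum) auto
    ultimately have "(\<Sum>i<m. c i * a i) \<in> (*) y ` W'" by blast
    then have c0: "\<forall>i<m. c i = 0" using c by (intro modindepD[OF a]) auto
    have "c m = 0"
    proof (rule ccontr)
      assume "c m \<noteq> 0"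
      have "c m * e = y * s" using s(2) c0 by simp
      then have "e = y * (inverse (c m) * s)" using \<open>c m \<noteq> 0\<close> by (simp add: field_simps)
      then have "1 = y * (inverse (c m) * s - v)" using e(3) by (simp add: algebra_simps)
      then have "x = x * (y * (inverse (c m) * s - v))" by simp
      then have "x = inverse (c m) * s - v" by (simp flip: mult.assoc)
      moreover have "inverse (c m) \<in> V1" using c inverse W_ring(2) WV1 by blast
      then have "inverse (c m) * s - v \<in> V1" using s(1) WV1 e(2) by (intro V1.diff V1.mult) auto
      ultimately show False using x by simp
    qed
    then show "c i = 0" using c0 i less_Suc_eq by auto
  qed (use bW in auto)
  then show ?thesis using modindep_kindep[OF W_ring(1,2) y_W(1) y0] by blast
qed

text \<open>Poles of \<open>u\<close> outside those of \<open>x\<close> are removed by a polynomial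
  in \<open>x\<close>, the reversal x^d g(y) of the leading coefficient of an equation for
  \<open>u\<close> over k[y]. Where \<open>x\<close> is regular, all reversed coefficients are
  regular; where it is not, the original ones are. In both cases leading coefficient times
  \<open>u\<close> is integral, and in the second y^d takes back x^d.\<close>

lemma good_multiple:
  "\<exists>g\<in>kpoly. g \<noteq> 0 \<and> (\<exists>d. \<forall>V. val_ring V \<longrightarrow>
    (x \<in> V \<longrightarrow> x ^ d * poly g y * u \<in> V) \<and> (x \<notin> V \<longrightarrow> y ^ d * (x ^ d * poly g y * u) \<in> V))"
proof -
  obtain f s where f: "\<And>i. i \<le> s \<Longrightarrow> f i \<in> kpoly" "f s \<noteq> 0" "(\<Sum>i\<le>s. poly (f i) y * u ^ i) = 0"
    using algebraic_relation[of y u] by blast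
  define d where "d = Max ((\<lambda>i. Polynomial.degree (f i)) ` {..s})"
  have d: "Polynomial.degree (f i) \<le> d" if "i \<le> s" for i unfolding d_def using that by (intro Max_ge) auto
  have yx: "y ^ d * x ^ d = 1" by (simp flip: power_mult_distrib)
  have "x ^ d * poly (f s) y * u \<in> V" if V: "val_ring V" "x \<in> V" for V
  proof -
    interpret V: field_subring V using V by (simp add: val_ring_def)
    have mem: "x ^ d * poly (f i) y \<in> V" if i: "i \<le> s" for i
    proof -
      have "x ^ d * poly (f i) y = (\<Sum>j\<le>Polynomial.degree (f i). Polynomial.coeff (f i) j * (x ^ d * y ^ j))"
        by (simp add: poly_altdef sum_distrib_left mult_ac)
      also have "\<dots> = (\<Sum>j\<le>Polynomial.degree (f i). Polynomial.coeff (f i) j * x ^ (d - j))"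
      proof (rule sum.cong)
        fix j assume "j \<in> {..Polynomial.degree (f i)}"
        then have "x ^ d = x ^ (d - j) * x ^ j" using d[OF i] by (simp flip: power_add)
        then show "Polynomial.coeff (f i) j * (x ^ d * y ^ j) = Polynomial.coeff (f i) j * x ^ (d - j)"
          by (simp add: mult.assoc flip: power_mult_distrib)
      qed simp
      also have "\<dots> \<in> V" using V kpoly_coeff[OF f(1)[OF i]] by (intro V.sum V.mult V.power) (auto simp: val_ring_def)
      finally show ?thesis .
    qed
    have "(\<Sum>i\<le>s. x ^ d * poly (f i) y * u ^ i) = 0" using f(3) by (simp add: mult.assoc flip: sum_distrib_left)
    then show ?thesis
      using integrally_closed_multiple[OF V.field_subring_axioms val_ring_integrally_closed[OF V(1)],
          of s "\<lambda>i. x ^ d * poly (f i) y" u] mem by blast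
  qed
  moreover have "y ^ d * (x ^ d * poly (f s) y * u) \<in> V" if V: "val_ring V" "x \<notin> V" for V
  proof -
    have *: "field_subring V" "k \<subseteq> V" using V by (auto simp: val_ring_def)
    have "y \<in> V" using y_mem[of V] V by (auto simp: Ws_def)
    then have "poly (f s) y * u \<in> V"
      using integrally_closed_multiple[OF *(1) val_ring_integrally_closed[OF V(1)],
          of s "\<lambda>i. poly (f i) y" u] f poly_mem[OF *] by blast
    then show ?thesis using yx by (simp flip: mult.assoc)
  qed
  ultimately show ?thesis using f(1)[of s] f(2) by (intro bexI[of _ "f s"] conjI exI[of _ d]) auto
qed

text \<open>The first \<open>l\<close> digits of a y-adic expansion, with digits in the span of a
  system of generators modulo \<open>y\<close>. For \<open>r = y ^ l * f\<close> they are the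
  principal parts of f away from \<open>V1\<close>.\<close>

lemma W'_expansion:
  assumes sp: "\<And>r. r \<in> W' \<Longrightarrow> \<exists>c. (\<forall>i<m. c i \<in> k) \<and> (\<exists>t\<in>W'. r = (\<Sum>i<m. c i * a i) + y * t)"
    and r: "r \<in> W'"
  shows "\<exists>b\<in>{..<m} \<times> {..<l} \<rightarrow>\<^sub>E k. \<exists>t\<in>W'. r = (\<Sum>(i, j)\<in>{..<m} \<times> {..<l}. b (i, j) * (y ^ j * a i)) + y ^ l * t"
proof -
  have "\<exists>b. (\<forall>i<m. \<forall>j<l. b i j \<in> k) \<and> (\<exists>t\<in>W'. r = (\<Sum>j<l. \<Sum>i<m. b i j * (y ^ j * a i)) + y ^ l * t)"
  proof (induction l)
    case 0
    show ?case using r by auto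
  next
    case (Suc l)
    then obtain b t where b: "\<forall>i<m. \<forall>j<l. b i j \<in> k" "t \<in> W'" "r = (\<Sum>j<l. \<Sum>i<m. b i j * (y ^ j * a i)) + y ^ l * t" by blast
    obtain c t' where c: "\<forall>i<m. c i \<in> k" "t' \<in> W'" "t = (\<Sum>i<m. c i * a i) + y * t'" using sp[OF b(2)] by blast
    define b' where "b' = (\<lambda>i j. if j = l then c i else b i j)"
    have "(\<Sum>j<l. \<Sum>i<m. b' i j * (y ^ j * a i)) = (\<Sum>j<l. \<Sum>i<m. b i j * (y ^ j * a i))"
      by (intro sum.cong) (auto simp: b'_def)
    moreover have "(\<Sum>i<m. b' i l * (y ^ l * a i)) = y ^ l * (\<Sum>i<m. c i * a i)"
      by (simp add: b'_def sum_distrib_left mult_ac)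
    ultimately have "r = (\<Sum>j<Suc l. \<Sum>i<m. b' i j * (y ^ j * a i)) + y ^ Suc l * t'"
      using b(3) c(3) by (simp add: algebra_simps)
    moreover have "\<forall>i<m. \<forall>j<Suc l. b' i j \<in> k" using b(1) c(1) by (auto simp: b'_def less_Suc_eq)
    ultimately show ?case using c(2) by blast
  qed
  then obtain b t where b: "\<forall>i<m. \<forall>j<l. b i j \<in> k" "t \<in> W'" "r = (\<Sum>j<l. \<Sum>i<m. b i j * (y ^ j * a i)) + y ^ l * t" by blast
  define B where "B = restrict (\<lambda>(i, j). b i j) ({..<m} \<times> {..<l})"
  have "(\<Sum>(i, j)\<in>{..<m} \<times> {..<l}. B (i, j) * (y ^ j * a i)) = (\<Sum>(i, j)\<in>{..<m} \<times> {..<l}. b i j * (y ^ j * a i))"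
    by (intro sum.cong) (auto simp: B_def)
  also have "\<dots> = (\<Sum>i<m. \<Sum>j<l. b i j * (y ^ j * a i))" by (simp add: sum.cartesian_product)
  also have "\<dots> = (\<Sum>j<l. \<Sum>i<m. b i j * (y ^ j * a i))" by (rule sum.swap)
  finally have "r = (\<Sum>(i, j)\<in>{..<m} \<times> {..<l}. B (i, j) * (y ^ j * a i)) + y ^ l * t" using b(3) by simp
  moreover have "B \<in> {..<m} \<times> {..<l} \<rightarrow>\<^sub>E k" using b(1) by (auto simp: B_def)
  ultimately show ?thesis using b(2) by blast
qed

text \<open>With n = [K : k(y)] and m the dimension of W'/yW', the functions \<open>el c\<close>
  form a space of dimension n(D + 1), while principal parts away from \<open>V1\<close> take m(D +
  M) coefficients. Two functions with equal principal parts differ by a function regular off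
  \<open>V1\<close>. If all such functions were constant, n(D + 1) <= m(D + M) + 1 would follow,
  which fails for large \<open>D\<close> as m < n.\<close>

theorem nonconstant_with_one_pole:
  "\<exists>f. f \<notin> k \<and> (\<forall>V. val_ring V \<longrightarrow> V \<noteq> V1 \<longrightarrow> f \<in> V)"
proof -
  obtain N where N: "\<And>m a. kindep y m a \<Longrightarrow> m \<le> N" using kindep_bound[of y] by blast
  define n where "n = (GREATEST m. \<exists>a. kindep y m a)"
  have "kindep y 0 (\<lambda>_. 0)" by (simp add: kindep_def)
  then have "\<exists>a. kindep y n a" unfolding n_def
    using GreatestI_nat[of "\<lambda>m. \<exists>a. kindep y m a" 0 N] N by blast
  then obtain a where a: "kindep y n a" by blast
  have nmax: "m \<le> n" if "kindep y m b" for m b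
    using Greatest_le_nat[of "\<lambda>m. \<exists>a. kindep y m a" m N] N that unfolding n_def by blast
  have "\<forall>i. \<exists>g d. g \<in> kpoly \<and> g \<noteq> 0 \<and> (\<forall>V. val_ring V \<longrightarrow>
    (x \<in> V \<longrightarrow> x ^ d * poly g y * a i \<in> V) \<and> (x \<notin> V \<longrightarrow> y ^ d * (x ^ d * poly g y * a i) \<in> V))"
    using good_multiple by blast
  then obtain g d where g': "\<And>i. g i \<in> kpoly \<and> g i \<noteq> 0 \<and> (\<forall>V. val_ring V \<longrightarrow>
    (x \<in> V \<longrightarrow> x ^ d i * poly (g i) y * a i \<in> V) \<and> (x \<notin> V \<longrightarrow> y ^ d i * (x ^ d i * poly (g i) y * a i) \<in> V))"
    unfolding choice_iff by blast
  then have g: "\<And>i. g i \<in> kpoly" "\<And>i. g i \<noteq> 0"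
    "\<And>i V. val_ring V \<Longrightarrow> x \<in> V \<Longrightarrow> x ^ d i * poly (g i) y * a i \<in> V"
    "\<And>i V. val_ring V \<Longrightarrow> x \<notin> V \<Longrightarrow> y ^ d i * (x ^ d i * poly (g i) y * a i) \<in> V"
    by blast+
  define M where "M = Max (insert 0 (d ` {..<n}))"
  have dM: "d i \<le> M" if "i < n" for i unfolding M_def using that by (intro Max_ge) auto
  define u where "u = (\<lambda>i. x ^ M * poly (g i) y * a i)"
  have u1: "u i \<in> V" if "val_ring V" "x \<in> V" "i < n" for V i
  proof -
    interpret V: field_subring V using that by (simp add: val_ring_def)
    have "u i = x ^ (M - d i) * (x ^ d i * poly (g i) y * a i)"
      unfolding u_def using dM[OF that(3)] by (simp flip: mult.assoc power_add)
    then show ?thesis using V.mult[OF V.power[OF that(2)] g(3)[OF that(1,2)]] by simp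
  qed
  have u2: "y ^ M * u i \<in> V" if "val_ring V" "x \<notin> V" "i < n" for V i
  proof -
    have *: "y ^ j * x ^ j = 1" for j by (simp flip: power_mult_distrib)
    have "y ^ M * u i = y ^ d i * (x ^ d i * poly (g i) y * a i)"
      unfolding u_def using * by (simp flip: mult.assoc)
    then show ?thesis using g(4)[OF that(1,2)] by simp
  qed
  have uind: "kindep y n u"
    unfolding kindep_def
  proof (intro allI impI)
    fix f i assume f: "\<forall>i<n. f i \<in> kpoly" "(\<Sum>i<n. poly (f i) y * u i) = 0" and i: "i < n"
    have "(\<Sum>i<n. poly (f i) y * u i) = x ^ M * (\<Sum>i<n. poly (f i * g i) y * a i)"
      by (simp add: u_def sum_distrib_left mult_ac)
    then have "(\<Sum>i<n. poly (f i * g i) y * a i) = 0" using f(2) x0 by simp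
    moreover have "\<forall>i<n. f i * g i \<in> kpoly" using f(1) g(1) kpoly_mult by blast
    ultimately have "\<forall>i<n. f i * g i = 0" using a unfolding kindep_def by (elim allE[of _ "\<lambda>i. f i * g i"]) blast
    then show "f i = 0" using i g(2) by simp
  qed
  obtain m b where b: "modindep W' y m b"
    and sp: "\<And>r. r \<in> W' \<Longrightarrow> \<exists>c. (\<forall>i<m. c i \<in> k) \<and> (\<exists>t\<in>W'. r = (\<Sum>i<m. c i * b i) + y * t)"
    using modindep_spanning[OF W'_ring y_W(2) y0] by blast
  have mn: "Suc m \<le> n" using modindep_W'_extend[OF b] nmax by blast
  \<comment> \<open>With m at most n - 1 the final inequality becomes D + n - 1 <= (n - 1)M, which
    this \<open>D\<close> violates. The exponent \<open>l\<close> clears the poles of all x^j u_i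
    with j up to \<open>D\<close>.\<close>
  define D where "D = n * M + 1"
  define l where "l = D + M"
  define T where "T = {..<n} \<times> {..D}"
  define T' where "T' = {..<m} \<times> {..<l}"
  let ?C = "T \<rightarrow>\<^sub>E k" and ?C' = "T' \<rightarrow>\<^sub>E k"
  define el where "el = (\<lambda>c. \<Sum>(i, j)\<in>T. c (i, j) * (x ^ j * u i))"
  have el1: "el c \<in> V" if V: "val_ring V" "x \<in> V" and c: "c \<in> ?C" for V c
  proof -
    interpret V: field_subring V using V by (simp add: val_ring_def)
    show ?thesis unfolding el_def T_def using c u1[OF V] V
      by (auto simp: T_def val_ring_def PiE_iff intro!: V.sum V.mult V.power)
  qed
  have el2: "y ^ l * el c \<in> V" if V: "val_ring V" "x \<notin> V" and c: "c \<in> ?C" for V c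
  proof -
    interpret V: field_subring V using V by (simp add: val_ring_def)
    have yV: "y \<in> V" using y_mem[of V] V by (simp add: Ws_def)
    have "y ^ l * el c = (\<Sum>(i, j)\<in>T. c (i, j) * (y ^ (D - j) * (y ^ M * u i)))"
      unfolding el_def sum_distrib_left
    proof (rule sum.cong, rule refl, clarify)
      fix i j assume "(i, j) \<in> T"
      then have "D = (D - j) + j" by (simp add: T_def)
      then have "y ^ l = y ^ (D - j) * y ^ j * y ^ M" unfolding l_def by (metis power_add)
      moreover have "y ^ j * x ^ j = 1" by (simp flip: power_mult_distrib)
      ultimately show "y ^ l * (c (i, j) * (x ^ j * u i)) = c (i, j) * (y ^ (D - j) * (y ^ M * u i))"
        by (simp add: mult_ac)
    qed
    also have "\<dots> \<in> V"
    proof (rule V.sum, clarify)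
      fix i j assume ij: "(i, j) \<in> T"
      then have "c (i, j) \<in> V" using c V by (auto simp: val_ring_def PiE_iff)
      moreover have "y ^ M * u i \<in> V" using u2[OF V] ij by (simp add: T_def)
      ultimately show "c (i, j) * (y ^ (D - j) * (y ^ M * u i)) \<in> V" using V.power[OF yV] V.mult by blast
    qed
    finally show ?thesis .
  qed
  have elinj: "inj_on el (?C)"
  proof (rule inj_onI)
    fix c c' assume c: "c \<in> ?C" "c' \<in> ?C" and eq: "el c = el c'"
    \<comment> \<open>The difference of the two functions is x^D times a combination of the
      \<open>u i\<close> over k[y], in which x^j turns into y^(D - j).\<close>
    define f where "f = (\<lambda>i. \<Sum>j\<le>D. Polynomial.monom (c (i, j) - c' (i, j)) (D - j))"
    have fk: "\<forall>i<n. f i \<in> kpoly"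
      unfolding f_def using c by (auto simp: T_def PiE_iff intro!: kpoly_sum kpoly_monom diff)
    have "x ^ D * (\<Sum>i<n. poly (f i) y * u i) = (\<Sum>i<n. \<Sum>j\<le>D. (c (i, j) - c' (i, j)) * (x ^ j * u i))"
      unfolding f_def poly_sum poly_monom sum_distrib_left sum_distrib_right
    proof (intro sum.cong refl)
      fix i j assume "j \<in> {..D}"
      then have "x ^ D = x ^ j * x ^ (D - j)" by (simp flip: power_add)
      then have "x ^ D * ((c (i, j) - c' (i, j)) * y ^ (D - j) * u i) =
          (c (i, j) - c' (i, j)) * (x ^ j * u i) * (x ^ (D - j) * y ^ (D - j))"
        by (simp only: mult_ac)
      moreover have "x ^ (D - j) * y ^ (D - j) = 1" by (simp flip: power_mult_distrib)
      ultimately show "x ^ D * ((c (i, j) - c' (i, j)) * y ^ (D - j) * u i) = (c (i, j) - c' (i, j)) * (x ^ j * u i)"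
        by simp
    qed
    also have "\<dots> = el c - el c'"
      unfolding el_def T_def sum_subtractf[symmetric] by (simp add: sum.cartesian_product case_prod_unfold left_diff_distrib)
    finally have "(\<Sum>i<n. poly (f i) y * u i) = 0" using eq x0 by simp
    then have f0: "\<forall>i<n. f i = 0" using uind fk unfolding kindep_def by blast
    have "c (i, j) = c' (i, j)" if ij: "(i, j) \<in> T" for i j
    proof -
      have "Polynomial.coeff (f i) (D - j) = (\<Sum>j'\<le>D. if j' = j then c (i, j') - c' (i, j') else 0)"
        unfolding f_def coeff_sum using ij by (intro sum.cong) (auto simp: T_def)
      then show ?thesis using f0 ij by (simp add: T_def)
    qed
    then show "c = c'" using c by (intro PiE_ext[OF c]) auto
  qed
  show ?thesis
  proof (rule ccontr)
    assume no: "\<not> ?thesis"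
    have "\<exists>\<beta>\<in>?C'. \<exists>t\<in>W'. y ^ l * el c = (\<Sum>(i, j)\<in>T'. \<beta> (i, j) * (y ^ j * b i)) + y ^ l * t" if c: "c \<in> ?C" for c
    proof -
      have "y ^ l * el c \<in> W'" using el2[OF _ _ c] by (auto simp: W'_def Ws_def)
      then show ?thesis unfolding T'_def using W'_expansion[OF sp] by blast
    qed
    then have "\<forall>c. \<exists>\<beta> t. c \<in> ?C \<longrightarrow> \<beta> \<in> ?C' \<and> t \<in> W' \<and>
        y ^ l * el c = (\<Sum>(i, j)\<in>T'. \<beta> (i, j) * (y ^ j * b i)) + y ^ l * t"
      by blast
    then obtain \<beta> \<tau> where "\<And>c. c \<in> ?C \<longrightarrow> \<beta> c \<in> ?C' \<and> \<tau> c \<in> W' \<and>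
        y ^ l * el c = (\<Sum>(i, j)\<in>T'. \<beta> c (i, j) * (y ^ j * b i)) + y ^ l * \<tau> c"
      unfolding choice_iff by blast
    then have \<beta>: "\<And>c. c \<in> ?C \<Longrightarrow> \<beta> c \<in> ?C'" "\<And>c. c \<in> ?C \<Longrightarrow> \<tau> c \<in> W'"
      "\<And>c. c \<in> ?C \<Longrightarrow> y ^ l * el c = (\<Sum>(i, j)\<in>T'. \<beta> c (i, j) * (y ^ j * b i)) + y ^ l * \<tau> c"
      by blast+
    have diffk: "el c - el c' \<in> k" if c: "c \<in> ?C" "c' \<in> ?C" "\<beta> c = \<beta> c'" for c c'
    proof -
      have "y ^ l * (el c - el c') = y ^ l * (\<tau> c - \<tau> c')" using \<beta>(3)[OF c(1)] \<beta>(3)[OF c(2)] c(3) by (simp add: right_diff_distrib)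
      then have "el c - el c' = \<tau> c - \<tau> c'" using y0 by simp
      then have W'e: "el c - el c' \<in> W'" using \<beta>(2) c W'.diff by simp
      have "el c - el c' \<in> V" if V: "val_ring V" "V \<noteq> V1" for V
      proof (cases "x \<in> V")
        case True
        then show ?thesis using el1[OF V(1) True] c field_subring.diff[of V] V by (simp add: val_ring_def)
      next
        case False
        then show ?thesis using W'e W_sub(2)[of V] V by (auto simp: Ws_def)
      qed
      then show ?thesis using no by blast
    qed
    \<comment> \<open>The representative depends on the digits alone, so \<open>c\<close> is
      recovered from its digits and the constant \<open>el c - el (rep c)\<close>. This constant
      accounts for the summand 1 in the exponent.\<close>
    define rep where "rep = (\<lambda>c. SOME c'. c' \<in> ?C \<and> \<beta> c' = \<beta> c)"
    have rep: "rep c \<in> ?C" "\<beta> (rep c) = \<beta> c" if "c \<in> ?C" for c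
      unfolding rep_def using someI[of "\<lambda>c'. c' \<in> ?C \<and> \<beta> c' = \<beta> c" c] that by auto
    have "inj_on (\<lambda>c. (\<beta> c, el c - el (rep c))) (?C)"
    proof (rule inj_onI)
      fix c c' assume c: "c \<in> ?C" "c' \<in> ?C" "(\<beta> c, el c - el (rep c)) = (\<beta> c', el c' - el (rep c'))"
      then have "rep c = rep c'" by (simp add: rep_def)
      then have "el c = el c'" using c by simp
      then show "c = c'" using elinj c by (simp add: inj_on_def)
    qed
    moreover have "(\<lambda>c. (\<beta> c, el c - el (rep c))) ` (?C) \<subseteq> (?C') \<times> k"
      using \<beta>(1) diffk rep by auto
    moreover have fin': "finite T" "finite T'" by (simp_all add: T_def T'_def)
    then have "finite ((?C') \<times> k)" using fin by (simp add: finite_PiE)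
    ultimately have "card (?C) \<le> card ((?C') \<times> k)" by (rule card_inj_on_le)
    then have "card k ^ card T \<le> card k ^ (card T' + 1)"
      using fin' by (simp add: card_PiE card_cartesian_product mult.commute)
    moreover have "1 < card k" using card_k_ge2 by simp
    ultimately have "card T \<le> card T' + 1" by (metis power_le_imp_le_exp)
    then have "n * (D + 1) \<le> m * (D + M) + 1" by (simp add: T_def T'_def l_def card_cartesian_product)
    moreover obtain n' where n': "n = Suc n'" "m \<le> n'" using mn by (cases n) auto
    moreover have "m * (D + M) \<le> n' * (D + M)" using n' by simp
    ultimately have "Suc n' * (D + 1) \<le> n' * (D + M) + 1" by (metis add_le_mono1 order_trans)
    then have "D + n' \<le> n' * M" by (simp add: algebra_simps)
    then show False unfolding D_def n'(1) by simp
  qed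
qed

end

section \<open>The ring of elements integral outside a place\<close>

lemma fld_ring: "ring (fld :: 'k::field ring)"
  by (rule ring_from_type_algebra)

lemma fld_uminus [simp]: "\<ominus>\<^bsub>(fld :: 'k::field ring)\<^esub> a = - a"
proof -
  interpret ring "fld :: 'k ring" by (rule fld_ring)
  show ?thesis using minus_equality[of "- a" a] by simp
qed

lemma fld_inv: "a \<noteq> 0 \<Longrightarrow> inv\<^bsub>(fld :: 'k::field ring)\<^esub> a = inverse a"
proof -
  assume "a \<noteq> 0"
  interpret ring "fld :: 'k ring" by (rule fld_ring)
  show ?thesis using inv_unique'[of a "inverse a"] \<open>a \<noteq> 0\<close> by simp
qed

lemma field_subring_if_subring:
  assumes "subring A (fld :: 'k::field ring)"
  shows "field_subring A"
  using subringE[OF assms] by unfold_locales simp_all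

lemma finite_constants_if_subfield:
  assumes "subfield k (fld :: 'k::field ring)" "finite k"
  shows "finite_constants k"
proof -
  interpret ring "fld :: 'k ring" by (rule fld_ring)
  interpret field_subring k using field_subring_if_subring subfieldE(1)[OF assms(1)] .
  show ?thesis
  proof
    fix a assume "a \<in> k"
    then show "inverse a \<in> k"
      using subfield_m_inv(1)[OF assms(1), of a] fld_inv[of a] zero by (cases "a = 0") auto
  qed (rule assms)
qed

text \<open>Polynomials of the algebra library are coefficient lists with the leading coefficient
  first, hence the reversal.\<close>

lemma fld_eval: "ring.eval (fld :: 'k::field ring) (rev (coeffs p)) x = poly p x"
proof -
  interpret ring "fld :: 'k ring" by (rule fld_ring)
  show ?thesis
  proof (induction p)
    case 0
    show ?case by simp
  next
    case (pCons a p)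
    then have "coeffs (pCons a p) = a # coeffs p" by (auto simp: cCons_def)
    then show ?case using eval_append_aux[of "rev (coeffs p)" a x] pCons.IH by (simp add: mult.commute)
  qed
qed

context finite_constants
begin

lemma transcendental_poly:
  assumes "(ring.transcendental fld over k) x" "p \<in> kpoly" "poly p x = 0"
  shows "p = 0"
proof -
  interpret R: ring "fld :: 'k ring" by (rule fld_ring)
  have "set (coeffs p) \<subseteq> k" using assms(2) by (auto simp: kpoly_def coeffs_def)
  moreover have "p \<noteq> 0 \<Longrightarrow> hd (rev (coeffs p)) \<noteq> 0"
    by (simp add: hd_rev last_coeffs_eq_coeff_degree)
  ultimately have "polynomial\<^bsub>fld\<^esub> k (rev (coeffs p))" by (auto simp: polynomial_def)
  then have "rev (coeffs p) \<in> carrier (k [X]\<^bsub>fld\<^esub>)" by (simp add: univ_poly_carrier)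
  then have "rev (coeffs p) = []" using assms(3)
    by (intro R.eval_transcendental[OF assms(1)]) (simp_all add: fld_eval)
  then show ?thesis by simp
qed

lemma generate_field_fraction:
  assumes "c \<in> generate_field fld (insert t k)"
  shows "\<exists>D\<in>kpoly. \<exists>p\<in>kpoly. poly D t \<noteq> 0 \<and> poly D t * c = poly p t"
  using assms
proof (induction rule: generate_field.induct)
  case one
  then show ?case using kpoly_1 by (intro bexI[of _ 1]) auto
next
  case (incl h)
  have "poly [:h:] t = h" "poly (Polynomial.monom 1 1) t = t" by (simp_all add: poly_monom)
  then have "\<exists>p\<in>kpoly. poly p t = h"
    using incl kpoly_const[of h] kpoly_monom[OF local.one, of 1] by blast
  then obtain p where "p \<in> kpoly" "poly p t = h" by blast
  then show ?case by (intro bexI[OF bexI[of _ p] kpoly_1]) auto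
next
  case (a_inv h)
  then obtain D p where "D \<in> kpoly" "p \<in> kpoly" "poly D t \<noteq> 0" "poly D t * h = poly p t" by blast
  then show ?case using kpoly_uminus by (intro bexI[of _ D] bexI[of _ "- p"]) auto
next
  case (m_inv h)
  then obtain D p where D: "D \<in> kpoly" "p \<in> kpoly" "poly D t \<noteq> 0" "poly D t * h = poly p t" by blast
  have "h \<noteq> 0" using m_inv by simp
  then have "poly p t \<noteq> 0" using D by (metis no_zero_divisors)
  then show ?case using D \<open>h \<noteq> 0\<close> by (intro bexI[of _ p] bexI[of _ D]) (auto simp: fld_inv field_simps)
next
  case (eng_add h1 h2)
  then obtain D p D' p' where D: "D \<in> kpoly" "p \<in> kpoly" "poly D t \<noteq> 0" "poly D t * h1 = poly p t"
    and D': "D' \<in> kpoly" "p' \<in> kpoly" "poly D' t \<noteq> 0" "poly D' t * h2 = poly p' t" by blast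
  have "poly (D * D') t * (h1 + h2) = poly (D' * p + D * p') t"
    by (simp add: algebra_simps flip: D(4) D'(4))
  then show ?case using D D' kpoly_mult kpoly_add
    by (intro bexI[of _ "D * D'"] bexI[of _ "D' * p + D * p'"]) auto
next
  case (eng_mult h1 h2)
  then obtain D p D' p' where D: "D \<in> kpoly" "p \<in> kpoly" "poly D t \<noteq> 0" "poly D t * h1 = poly p t"
    and D': "D' \<in> kpoly" "p' \<in> kpoly" "poly D' t \<noteq> 0" "poly D' t * h2 = poly p' t" by blast
  have "poly (D * D') t * (h1 * h2) = poly (p * p') t"
    by (simp add: algebra_simps flip: D(4) D'(4))
  then show ?case using D D' kpoly_mult by (intro bexI[of _ "D * D'"] bexI[of _ "p * p'"]) auto
qed

end

lemma dimension_spanning: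
  assumes "ring.dimension (fld :: 'k::field ring) n F E"
  shows "\<exists>u. \<forall>a\<in>E. \<exists>c. (\<forall>i<n. c i \<in> F) \<and> a = (\<Sum>i<n. c i * u i)"
proof -
  interpret ring "fld :: 'k ring" by (rule fld_ring)
  show ?thesis
    using assms
  proof (induction n F E rule: dimension.induct)
    case (zero_dim F)
    show ?case by simp
  next
    case (Suc_dim v E n F)
    then obtain u where u: "\<And>a. a \<in> E \<Longrightarrow> \<exists>c. (\<forall>i<n. c i \<in> F) \<and> a = (\<Sum>i<n. c i * u i)" by blast
    have "\<exists>c. (\<forall>i<Suc n. c i \<in> F) \<and> a = (\<Sum>i<Suc n. c i * (u(n := v)) i)" if a: "a \<in> line_extension F v E" for a
    proof -
      obtain d b where d: "d \<in> F" "b \<in> E" "a = d * v + b"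
        using a by (auto simp: line_extension_def r_coset_def set_add_def set_mult_def)
      obtain c where c: "\<forall>i<n. c i \<in> F" "b = (\<Sum>i<n. c i * u i)" using u[OF d(2)] by blast
      have "(\<Sum>i<n. (c(n := d)) i * (u(n := v)) i) = (\<Sum>i<n. c i * u i)" by (intro sum.cong) auto
      then show ?thesis using c d by (intro exI[of _ "c(n := d)"]) (auto simp: less_Suc_eq)
    qed
    then show ?case by blast
  qed
qed

lemma function_field_if_over_finite_field:
  assumes "function_field_over_finite_field (k :: 'k::field set)"
  shows "function_field k"
proof -
  have sub: "subfield k fld" "finite k" and alg: "\<And>z. \<not> (ring.transcendental fld over k) z \<Longrightarrow> z \<in> k"
    using assms unfolding function_field_over_finite_field_def over_def by auto
  obtain t n where dim: "ring.dimension fld n (generate_field fld (insert t k)) UNIV"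
    using assms unfolding function_field_over_finite_field_def over_def
    by (auto simp: ring.finite_dimension_def[OF fld_ring])
  interpret finite_constants k using finite_constants_if_subfield[OF sub] .
  obtain u where u: "\<And>a. \<exists>c. (\<forall>i<n. c i \<in> generate_field fld (insert t k)) \<and> a = (\<Sum>i<n. c i * u i)"
    using dimension_spanning[OF dim] by blast
  interpret bounded_denominators k t n u
  proof
    fix a
    show "\<exists>c. (\<forall>i<n. \<exists>D\<in>kpoly. \<exists>p\<in>kpoly. poly D t \<noteq> 0 \<and> poly D t * c i = poly p t) \<and> a = (\<Sum>i<n. c i * u i)"
      using u[of a] generate_field_fraction[of _ t] by blast
  qed
  show ?thesis
  proof
    show "p = 0" if "x \<notin> k" "p \<in> kpoly" "poly p x = 0" for x p
      using transcendental_poly[of x p] alg that by blast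
  qed (rule kindep_bounded)
qed

section \<open>Places and the ring of elements integral outside one of them\<close>

context function_field
begin

lemma val_ring_if_valuation_ring: "valuation_ring k V \<Longrightarrow> val_ring V"
  using field_subring_if_subring[of V] field_subring.zero[of V]
  unfolding valuation_ring_def val_ring_def by (metis psubset_imp_subset)

text \<open>A valuation ring is local: a maximal ideal contains no unit, and the nonunits already
  form a proper ideal. In particular a valuation ring carries only one place.\<close>

lemma maximalideal_nonunits:
  assumes V: "valuation_ring k V" and P: "maximalideal P (subring_of V)"
  shows "P = nonunits V"
proof -
  have val: "val_ring V" using V by (rule val_ring_if_valuation_ring)
  interpret F: ring "fld :: 'k ring" by (rule fld_ring)
  have sub: "subring V fld" using V by (simp add: valuation_ring_def)
  interpret V: field_subring V using val by (simp add: val_ring_def)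
  interpret P: maximalideal P "subring_of V" by (rule P)
  note N = nonunits_submod[OF val]
  have PV: "P \<subseteq> V" using P.a_subset by simp
  have one_notin: "1 \<notin> P" using P.one_imp_carrier P.I_notcarr by auto
  have "P \<subseteq> nonunits V"
  proof
    fix p assume p: "p \<in> P"
    show "p \<in> nonunits V"
    proof (rule ccontr)
      assume "p \<notin> nonunits V"
      then have "p \<noteq> 0" "inverse p \<in> V" using unitI[of p V] p PV by auto
      then show False using P.I_l_closed[OF p, of "inverse p"] one_notin by simp
    qed
  qed
  moreover have "ideal (nonunits V) (subring_of V)"
  proof (rule idealI[OF F.subring_is_ring[OF sub]])
    show "subgroup (nonunits V) (add_monoid (subring_of V))"
    proof
      show "nonunits V \<subseteq> carrier (add_monoid (subring_of V))" by (auto simp: nonunits_def)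
      fix a assume a: "a \<in> nonunits V"
      have aV: "a \<in> V" using a by (simp add: nonunits_def)
      have "\<ominus>\<^bsub>subring_of V\<^esub> a = - a"
        using aV V.uminus[OF aV] by (intro P.minus_equality) auto
      then show "inv\<^bsub>add_monoid (subring_of V)\<^esub> a \<in> nonunits V"
        using V.submod_uminus[OF N a] by (simp add: a_inv_def)
    qed (auto intro: V.submod_closed[OF N])
    fix a z assume "a \<in> nonunits V" "z \<in> carrier (subring_of V)"
    then have "z * a \<in> nonunits V" by (simp add: V.submod_mult[OF N])
    then show "z \<otimes>\<^bsub>subring_of V\<^esub> a \<in> nonunits V" "a \<otimes>\<^bsub>subring_of V\<^esub> z \<in> nonunits V"
      by (simp_all add: mult.commute)
  qed
  ultimately have "nonunits V = P \<or> nonunits V = carrier (subring_of V)"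
    using P.I_maximal[of "nonunits V"] by (auto simp: nonunits_def)
  then show ?thesis using one_not_nonunit V.one by auto
qed

lemma fraction_ring_integral_outside:
  assumes "is_place k Q"
  shows "fraction_ring (integral_outside k Q)"
proof -
  obtain V1 where V1: "valuation_ring k V1" "maximalideal Q (subring_of V1)"
    using assms by (auto simp: is_place_def place_with_ring_def)
  define \<V> where "\<V> = {V. \<exists>P. place_with_ring k V P \<and> P \<noteq> Q}"
  have A: "integral_outside k Q = \<Inter>\<V>" by (auto simp: integral_outside_def \<V>_def)
  \<comment> \<open>V = V1 would force P = Q, both being the nonunits of that ring.\<close>
  have val: "val_ring V" "V \<noteq> V1" if "V \<in> \<V>" for V
    using that maximalideal_nonunits[OF V1] maximalideal_nonunits val_ring_if_valuation_ring
    unfolding \<V>_def place_with_ring_def by blast+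
  obtain x where x: "x \<notin> V1" using V1 by (auto simp: valuation_ring_def)
  interpret marked_pole k V1 x
    by unfold_locales (use x V1 val_ring_if_valuation_ring in auto)
  obtain f where f: "f \<notin> k" "\<And>V. val_ring V \<Longrightarrow> V \<noteq> V1 \<Longrightarrow> f \<in> V" using nonconstant_with_one_pole by blast
  show ?thesis
    unfolding A using val f by (intro fraction_ring_if_nonconstant val_ring_Inter) auto
qed

end

section \<open>Fractional ideals and the class group\<close>

lemma iprod_subring_of: "ideal_prod (subring_of A) I J = iprod I J"
proof (intro Set.set_eqI iffI)
  fix s
  show "s \<in> iprod I J" if "s \<in> ideal_prod (subring_of A) I J"
    using that by (induction rule: ideal_prod.induct) (auto intro: iprod_mult iprod_add)
  show "s \<in> ideal_prod (subring_of A) I J" if "s \<in> iprod I J"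
    using that
  proof (induction rule: iprod_induct)
    case (mult i j)
    then show ?case using ideal_prod.prod[of i I j J "subring_of A"] by simp
  next
    case (add s t)
    then show ?case using ideal_prod.sum[of s "subring_of A" I J t] by simp
  qed
qed

lemma iprod_mono: "I \<subseteq> I' \<Longrightarrow> J \<subseteq> J' \<Longrightarrow> iprod I J \<subseteq> iprod I' J'"
proof
  fix s assume "I \<subseteq> I'" "J \<subseteq> J'" "s \<in> iprod I J"
  from this(3,1,2) show "s \<in> iprod I' J'"
    by (induction rule: iprod_induct) (auto intro: iprod_mult iprod_add)
qed

lemma iprod_commute: "iprod I J = iprod J I"
proof -
  have "s \<in> iprod J I" if "s \<in> iprod I J" for I J and s :: 'a
    using that
  proof (induction rule: iprod_induct)
    case (mult i j)
    then show ?case using iprod_mult[of j J i I] by (simp add: mult.commute)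
  qed (rule iprod_add)
  then show ?thesis by blast
qed

lemma iprod_assoc: "iprod (iprod I J) K = iprod I (iprod J K)"
proof -
  have half: "iprod (iprod I J) K \<subseteq> iprod I (iprod J K)" for I J K :: "'a set"
  proof
    fix s assume "s \<in> iprod (iprod I J) K"
    then show "s \<in> iprod I (iprod J K)"
    proof (induction rule: iprod_induct)
      case (mult p k)
      from mult(1) show ?case
      proof (induction rule: iprod_induct)
        case (mult i j)
        then show ?case using iprod_mult[of i I "j * k" "iprod J K"] iprod_mult[of j J k K] \<open>k \<in> K\<close>
          by (simp add: mult.assoc)
      qed (auto simp: distrib_right intro: iprod_add)
    qed (rule iprod_add)
  qed
  from half[of K J I] have "iprod I (iprod J K) \<subseteq> iprod (iprod I J) K"
    by (simp only: iprod_commute[of K J] iprod_commute[of _ I] iprod_commute[of J I] iprod_commute[of K])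
  then show ?thesis using half[of I J K] by blast
qed

section \<open>Fractional ideals as submodules, ideal classes as orbits under scaling\<close>

context field_subring
begin

lemma iprod_principal: "submod R I \<Longrightarrow> iprod ((*) z ` R) I = (*) z ` I"
proof
  assume I: "submod R I"
  show "iprod ((*) z ` R) I \<subseteq> (*) z ` I"
  proof
    fix s assume "s \<in> iprod ((*) z ` R) I"
    then show "s \<in> (*) z ` I"
    proof (induction rule: iprod_induct)
      case (mult i j)
      then show ?case using submod_mult[OF I] by (auto simp: mult.assoc)
    next
      case (add s t)
      then show ?case using submod_add[OF I] by (auto simp flip: distrib_left)
    qed
  qed
  show "(*) z ` I \<subseteq> iprod ((*) z ` R) I"
    using iprod_mult[OF principal_mem] by auto
qed

lemma iprod_R: "submod R I \<Longrightarrow> iprod R I = I"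
  using iprod_principal[of I 1] by simp

lemma submod_iff_subgroup:
  "subgroup I (add_monoid fld) \<and> (\<forall>r\<in>R. \<forall>z\<in>I. r * z \<in> I) \<longleftrightarrow> submod R I"
proof
  assume "subgroup I (add_monoid fld) \<and> (\<forall>r\<in>R. \<forall>z\<in>I. r * z \<in> I)"
  then show "submod R I"
    unfolding submod_def using subgroup.one_closed[of I "add_monoid fld"] subgroup.m_closed[of I "add_monoid fld"]
    by auto
next
  assume I: "submod R I"
  have "subgroup I (add_monoid fld)"
  proof
    fix a assume "a \<in> I"
    then have "\<ominus>\<^bsub>fld\<^esub> a \<in> I" using submod_uminus[OF I] by simp
    then show "inv\<^bsub>add_monoid fld\<^esub> a \<in> I" by (simp add: a_inv_def)
  qed (auto intro: submod_closed[OF I])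
  then show "subgroup I (add_monoid fld) \<and> (\<forall>r\<in>R. \<forall>z\<in>I. r * z \<in> I)"
    using submod_mult[OF I] by blast
qed

definition frac :: "'k set \<Rightarrow> bool"
  where "frac I \<longleftrightarrow> submod R I \<and> I \<noteq> {0} \<and> (\<exists>d\<in>R. d \<noteq> 0 \<and> (\<forall>z\<in>I. d * z \<in> R))"

lemma frac_submod: "frac I \<Longrightarrow> submod R I"
  by (simp add: frac_def)

lemma carrier_fractional_ideals: "carrier (fractional_ideals R) = Collect frac"
  unfolding fractional_ideals_def fractional_ideal_def frac_def using submod_iff_subgroup by auto

lemma frac_nonzero: "frac I \<Longrightarrow> \<exists>a\<in>I. a \<noteq> 0"
  using submod_zero by (auto simp: frac_def)

lemma frac_R: "frac R"
  unfolding frac_def using submod_self one by (auto intro!: bexI[of _ 1])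

lemma frac_iprod: "frac I \<Longrightarrow> frac J \<Longrightarrow> frac (iprod I J)"
proof -
  assume I: "frac I" and J: "frac J"
  obtain a where a: "a \<in> I" "a \<noteq> 0" using frac_nonzero[OF I] by blast
  obtain b where b: "b \<in> J" "b \<noteq> 0" using frac_nonzero[OF J] by blast
  have "a * b \<in> iprod I J" "a * b \<noteq> 0" using a b by (simp_all add: iprod_mult)
  then have ne: "iprod I J \<noteq> {0}" by blast
  obtain d e where d: "d \<in> R" "d \<noteq> 0" "\<And>z. z \<in> I \<Longrightarrow> d * z \<in> R" "e \<in> R" "e \<noteq> 0" "\<And>z. z \<in> J \<Longrightarrow> e * z \<in> R"
    using I J unfolding frac_def by blast
  have de: "(d * i) * (e * j) \<in> R" if "i \<in> I" "j \<in> J" for i j using mult[OF d(3,6)] that .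
  have "d * e * s \<in> R" if "s \<in> iprod I J" for s
    using that
  proof (induction rule: iprod_induct)
    case (mult i j)
    from de[OF this] show ?case by (simp add: mult_ac)
  qed (auto simp: distrib_left intro: add)
  moreover have "J \<noteq> {}" using b by blast
  ultimately show ?thesis using ne d submod_iprod[of J I] frac_submod[OF I] mult[OF d(1,4)]
    unfolding frac_def by (intro conjI bexI[of _ "d * e"]) auto
qed

lemma iprod_R_right: "submod R I \<Longrightarrow> iprod I R = I"
  using iprod_R iprod_commute by metis

lemma FI_mult: "I \<otimes>\<^bsub>fractional_ideals R\<^esub> J = iprod I J"
  and FI_one: "\<one>\<^bsub>fractional_ideals R\<^esub> = R"
  by (simp_all add: fractional_ideals_def)

lemma comm_monoid_fractional_ideals: "comm_monoid (fractional_ideals R)"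
  by (rule comm_monoidI)
    (simp_all add: carrier_fractional_ideals FI_mult FI_one frac_iprod frac_R iprod_assoc iprod_R frac_submod,
      rule iprod_commute)

text \<open>Multiplication by the principal ideal zR is scaling by \<open>z\<close>, so a coset of
  the principal ideals is an orbit under scaling.\<close>

lemma ideal_class_eq: "submod R I \<Longrightarrow> ideal_class R I = {(*) z ` I | z. z \<noteq> 0}"
proof -
  assume I: "submod R I"
  have "ideal_class R I = {iprod ((*) z ` R) I | z. z \<noteq> 0}"
    unfolding ideal_class_def r_coset_def principal_fractional_ideals_def by (auto simp: fractional_ideals_def)
  then show ?thesis by (simp add: iprod_principal[OF I])
qed

lemma ideal_class_eq_iff:
  assumes I: "submod R I" and J: "submod R J"
  shows "ideal_class R I = ideal_class R J \<longleftrightarrow> (\<exists>z. z \<noteq> 0 \<and> J = (*) z ` I)"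
proof
  assume "ideal_class R I = ideal_class R J"
  moreover have "J \<in> ideal_class R J" unfolding ideal_class_eq[OF J] by (auto intro!: exI[of _ 1])
  ultimately show "\<exists>z. z \<noteq> 0 \<and> J = (*) z ` I" unfolding ideal_class_eq[OF I] by blast
next
  assume "\<exists>z. z \<noteq> 0 \<and> J = (*) z ` I"
  then obtain z where z: "z \<noteq> 0" "J = (*) z ` I" by blast
  have 1: "(*) w ` J = (*) (w * z) ` I" for w unfolding z(2) image_image by (simp add: mult.assoc)
  have 2: "(*) w ` I = (*) (w * inverse z) ` J" for w unfolding 1 using z(1) by (simp add: mult.assoc)
  show "ideal_class R I = ideal_class R J"
    unfolding ideal_class_eq[OF I] ideal_class_eq[OF J]
  proof (intro Set.set_eqI iffI)
    fix Y
    show "Y \<in> {(*) z ` J | z. z \<noteq> 0}" if Y: "Y \<in> {(*) z ` I | z. z \<noteq> 0}"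
    proof -
      obtain w where "w \<noteq> 0" "Y = (*) w ` I" using Y by blast
      then show ?thesis using 2[of w] z(1) by (intro CollectI exI[of _ "w * inverse z"]) simp
    qed
    show "Y \<in> {(*) z ` I | z. z \<noteq> 0}" if Y: "Y \<in> {(*) z ` J | z. z \<noteq> 0}"
    proof -
      obtain w where "w \<noteq> 0" "Y = (*) w ` J" using Y by blast
      then show ?thesis using 1[of w] z(1) by (intro CollectI exI[of _ "w * z"]) simp
    qed
  qed
qed

lemma ideal_class_scale: "submod R I \<Longrightarrow> z \<noteq> 0 \<Longrightarrow> ideal_class R ((*) z ` I) = ideal_class R I"
  using ideal_class_eq_iff[of I "(*) z ` I"] submod_scale[of I z] by blast

end

section \<open>The group of fractional ideals and its quotient\<close>

context fraction_ring
begin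

lemma frac_scale: "frac I \<Longrightarrow> z \<noteq> 0 \<Longrightarrow> frac ((*) z ` I)"
proof -
  assume I: "frac I" and z: "z \<noteq> 0"
  obtain d where d: "d \<in> R" "d \<noteq> 0" "\<And>i. i \<in> I \<Longrightarrow> d * i \<in> R" using I unfolding frac_def by blast
  obtain e where e: "e \<in> R" "e \<noteq> 0" "e * z \<in> R" using fractions by blast
  obtain a where a: "a \<in> I" "a \<noteq> 0" using frac_nonzero[OF I] by blast
  have "(e * d) * w \<in> R" if w: "w \<in> (*) z ` I" for w
  proof -
    obtain i where i: "i \<in> I" "w = z * i" using w by blast
    have "(e * z) * (d * i) \<in> R" using mult[OF e(3) d(3)[OF i(1)]] .
    then show ?thesis using i by (simp add: mult_ac)
  qed
  moreover have "z * a \<in> (*) z ` I" "z * a \<noteq> 0" using a z by simp_all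
  then have "(*) z ` I \<noteq> {0}" by blast
  ultimately show ?thesis unfolding frac_def using submod_scale[OF frac_submod[OF I]] d e mult
    by (intro conjI bexI[of _ "e * d"]) auto
qed

lemma frac_to_ideal: "frac I \<Longrightarrow> \<exists>d. d \<noteq> 0 \<and> (*) d ` I \<subseteq> R"
  unfolding frac_def by blast

text \<open>A scalar \<open>d\<close> moves \<open>I\<close> into R, where
  \<open>ideal_invertible\<close> applies; in the products the factor \<open>d\<close> is then
  passed from the element of \<open>I\<close> to the one of the inverse.\<close>

lemma frac_inverse: assumes I: "frac I" shows "frac (inv_ideal R I)" "iprod I (inv_ideal R I) = R"
proof -
  obtain d where d: "d \<in> R" "d \<noteq> 0" "\<And>i. i \<in> I \<Longrightarrow> d * i \<in> R" using I unfolding frac_def by blast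
  obtain a where a: "a \<in> I" "a \<noteq> 0" using frac_nonzero[OF I] by blast
  obtain e where e: "e \<in> R" "e \<noteq> 0" "e * a \<in> R" using fractions by blast
  have dV: "d \<in> inv_ideal R I" using d by (simp add: inv_ideal_def)
  have "(e * a) * v \<in> R" if "v \<in> inv_ideal R I" for v
    using mult[OF e(1), of "v * a"] that a(1) by (simp add: inv_ideal_def mult_ac)
  then show "frac (inv_ideal R I)"
    unfolding frac_def using submod_inv_ideal dV d(2) e a(2) by (intro conjI bexI[of _ "e * a"]) auto
  let ?I = "(*) d ` I"
  have "d * a \<in> ?I" "d * a \<noteq> 0" using a d by simp_all
  then have "?I \<noteq> {0}" by blast
  then have "1 \<in> iprod ?I (inv_ideal R ?I)"
    using submod_scale[OF frac_submod[OF I]] d(3) by (intro ideal_invertible) auto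
  moreover have "s \<in> iprod I (inv_ideal R I)" if "s \<in> iprod ?I (inv_ideal R ?I)" for s
    using that
  proof (induction rule: iprod_induct)
    case (mult i v)
    then obtain j where j: "j \<in> I" "i = d * j" by blast
    have "d * v \<in> inv_ideal R I" using mult(2) by (auto simp: inv_ideal_def mult_ac)
    then have "j * (d * v) \<in> iprod I (inv_ideal R I)" using j by (intro iprod_mult)
    then show ?case by (simp add: j mult_ac)
  qed (rule iprod_add)
  ultimately have 1: "1 \<in> iprod I (inv_ideal R I)" by blast
  have "submod R (iprod I (inv_ideal R I))" using dV by (intro submod_iprod frac_submod[OF I]) auto
  then have "R \<subseteq> iprod I (inv_ideal R I)" using submod_mult[OF _ _ 1] by force
  then show "iprod I (inv_ideal R I) = R" using iprod_inv_ideal_subset by blast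
qed


sublocale FI: comm_group "fractional_ideals R"
proof (intro comm_group.intro comm_monoid_fractional_ideals)
  interpret comm_monoid "fractional_ideals R" by (rule comm_monoid_fractional_ideals)
  show "group (fractional_ideals R)"
  proof (rule group_l_invI)
    fix I assume "I \<in> carrier (fractional_ideals R)"
    then have I: "frac I" by (simp add: carrier_fractional_ideals)
    then show "\<exists>J\<in>carrier (fractional_ideals R). J \<otimes>\<^bsub>fractional_ideals R\<^esub> I = \<one>\<^bsub>fractional_ideals R\<^esub>"
      using frac_inverse[OF I] iprod_commute[of I] unfolding carrier_fractional_ideals FI_mult FI_one by blast
  qed
qed

lemma principal_frac: "z \<noteq> 0 \<Longrightarrow> (*) z ` R \<in> carrier (fractional_ideals R)"
  using frac_scale[OF frac_R] by (simp add: carrier_fractional_ideals)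

lemma principal_mult: "iprod ((*) z ` R) ((*) w ` R) = (*) (z * w) ` R"
  using iprod_principal[OF submod_principal, of z w] by (simp add: image_image mult.assoc)

lemma principal_subgroup: "subgroup (principal_fractional_ideals R) (fractional_ideals R)"
proof
  show "principal_fractional_ideals R \<subseteq> carrier (fractional_ideals R)"
    unfolding principal_fractional_ideals_def using principal_frac by auto
  show "\<one>\<^bsub>fractional_ideals R\<^esub> \<in> principal_fractional_ideals R"
    unfolding principal_fractional_ideals_def FI_one by (auto intro!: exI[of _ 1])
next
  fix I J assume "I \<in> principal_fractional_ideals R" "J \<in> principal_fractional_ideals R"
  then obtain z w where "z \<noteq> 0" "I = (*) z ` R" "w \<noteq> 0" "J = (*) w ` R"
    unfolding principal_fractional_ideals_def by blast
  then show "I \<otimes>\<^bsub>fractional_ideals R\<^esub> J \<in> principal_fractional_ideals R"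
    unfolding principal_fractional_ideals_def FI_mult
    by (intro CollectI exI[of _ "z * w"]) (simp add: principal_mult)
next
  fix I assume "I \<in> principal_fractional_ideals R"
  then obtain z where z: "z \<noteq> 0" "I = (*) z ` R" unfolding principal_fractional_ideals_def by blast
  have "inv\<^bsub>fractional_ideals R\<^esub> I = (*) (inverse z) ` R"
    using z by (intro FI.inv_equality principal_frac) (auto simp: FI_mult FI_one principal_mult intro!: principal_frac)
  then show "inv\<^bsub>fractional_ideals R\<^esub> I \<in> principal_fractional_ideals R"
    unfolding principal_fractional_ideals_def using z(1) by (intro CollectI exI[of _ "inverse z"]) simp
qed

lemma principal_normal: "principal_fractional_ideals R \<lhd> fractional_ideals R"
  by (rule FI.subgroup_imp_normal[OF principal_subgroup])

lemma class_mult: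
  "frac I \<Longrightarrow> frac J \<Longrightarrow> ideal_class R I \<otimes>\<^bsub>class_group R\<^esub> ideal_class R J = ideal_class R (iprod I J)"
  unfolding ideal_class_def class_group_def FactGroup_def
  using normal.rcos_sum[OF principal_normal, of I J] by (simp add: carrier_fractional_ideals FI_mult)

lemma carrier_class_group: "carrier (class_group R) = {ideal_class R I | I. frac I}"
  unfolding class_group_def FactGroup_def RCOSETS_def ideal_class_def
  by (auto simp: carrier_fractional_ideals)

lemma one_class_group: "\<one>\<^bsub>class_group R\<^esub> = ideal_class R R"
proof -
  have "\<one>\<^bsub>class_group R\<^esub> = principal_fractional_ideals R" by (simp add: class_group_def FactGroup_def)
  then show ?thesis unfolding ideal_class_eq[OF submod_self] principal_fractional_ideals_def .
qed

end

section \<open>Matrices and their ideals\<close>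

text \<open>Both \<open>vec_nth\<close> and \<open>fps_nth\<close> are written \<open>$\<close>, which makes parsing exponential.\<close>

no_notation fps_nth (infixl \<open>$\<close> 75)

section \<open>Two by two matrices, GL2 and its normalizer\<close>

lemma mat2_nth [simp]:
  "mat2 a b c d $ 1 $ 1 = a" "mat2 a b c d $ 1 $ 2 = b" "mat2 a b c d $ 2 $ 1 = c" "mat2 a b c d $ 2 $ 2 = d"
  by (simp_all add: mat2_def)

lemma mat_eq_2: "(M :: 'k^2^2) = N \<longleftrightarrow> M $ 1 $ 1 = N $ 1 $ 1 \<and> M $ 1 $ 2 = N $ 1 $ 2 \<and> M $ 2 $ 1 = N $ 2 $ 1 \<and> M $ 2 $ 2 = N $ 2 $ 2"
  unfolding vec_eq_iff forall_2 by blast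

lemma mat_mult_2: "((M :: 'k::field^2^2) ** N) $ i $ j = M $ i $ 1 * N $ 1 $ j + M $ i $ 2 * N $ 2 $ j"
  by (simp add: matrix_matrix_mult_def sum_2)

lemma mat_vec_2: "((M :: 'k::field^2^2) *v v) $ i = M $ i $ 1 * v $ 1 + M $ i $ 2 * v $ 2"
  by (simp add: matrix_vector_mult_def sum_2)

lemma mat_nth_2 [simp]:
  "(mat z :: 'k::field^2^2) $ 1 $ 1 = z" "(mat z :: 'k::field^2^2) $ 2 $ 2 = z"
  "(mat z :: 'k::field^2^2) $ 1 $ 2 = 0" "(mat z :: 'k::field^2^2) $ 2 $ 1 = 0"
  by (simp_all add: mat_def)

definition minv :: "'k::field^2^2 \<Rightarrow> 'k^2^2"
  where "minv M = mat2 (M $ 2 $ 2 / det M) (- M $ 1 $ 2 / det M) (- M $ 2 $ 1 / det M) (M $ 1 $ 1 / det M)"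

lemma minv: "det M \<noteq> 0 \<Longrightarrow> M ** minv M = mat 1" "det M \<noteq> 0 \<Longrightarrow> minv M ** M = mat 1"
  by (simp_all add: mat_eq_2 mat_mult_2 minv_def field_simps) (simp_all add: det_2 algebra_simps)

lemma det_minv: "det (minv M) = inverse (det M)"
proof (cases "det M = 0")
  case False
  have "det (minv M) * det M = 1" using minv(2)[OF False] by (metis det_I det_mul)
  then show ?thesis using False by (simp add: field_simps)
qed (simp add: minv_def det_2)

lemma minv_minv: "det M \<noteq> 0 \<Longrightarrow> minv (minv M) = M"
  by (simp add: mat_eq_2 minv_def[of "minv M"] det_minv) (simp add: minv_def)

lemma matrix_monoid_mult: "M \<otimes>\<^bsub>matrix_monoid A\<^esub> N = M ** N"
  and matrix_monoid_one: "\<one>\<^bsub>matrix_monoid A\<^esub> = mat 1"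
  by (simp_all add: matrix_monoid_def)

lemma GL2_mult: "M \<otimes>\<^bsub>GL2 A\<^esub> N = M ** N"
  and GL2_one: "\<one>\<^bsub>GL2 A\<^esub> = mat 1"
  by (simp_all add: GL2_def units_of_mult units_of_one matrix_monoid_mult matrix_monoid_one)

lemma GL2_carrier: "carrier (GL2 A) = {M. (\<forall>i j. M $ i $ j \<in> A) \<and> (\<exists>N. (\<forall>i j. N $ i $ j \<in> A) \<and> N ** M = mat 1 \<and> M ** N = mat 1)}"
  unfolding GL2_def units_of_carrier Units_def by (auto simp: matrix_monoid_def)

lemma GL2_UNIV: "carrier (GL2 UNIV) = {M :: 'k::field^2^2. det M \<noteq> 0}"
proof -
  have "det M \<noteq> 0" if "N ** M = mat 1" for M N :: "'k^2^2"
    using that by (metis det_I det_mul mult_zero_right zero_neq_one)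
  then show ?thesis unfolding GL2_carrier using minv by blast
qed

lemma GL2_group: "group (GL2 (UNIV :: 'k::field set))"
proof -
  have "monoid (matrix_monoid (UNIV :: 'k set))"
    by unfold_locales (auto simp: matrix_monoid_def matrix_mul_assoc)
  then show ?thesis unfolding GL2_def by (rule monoid.units_group)
qed

lemma GL2_inv: "det M \<noteq> 0 \<Longrightarrow> inv\<^bsub>GL2 (UNIV :: 'k::field set)\<^esub> M = minv M"
  by (rule group.inv_equality[OF GL2_group]) (auto simp: GL2_UNIV GL2_mult GL2_one minv det_minv)

lemma mat_mult_scalar: "mat z ** (M :: 'k::field^2^2) = M ** mat z"
  by (simp add: mat_eq_2 mat_mult_2 mult.commute)

lemma GL2_normalizer_eq:
  "GL2_normalizer A = {M. det M \<noteq> 0 \<and> (\<lambda>g. M ** g ** minv M) ` carrier (GL2 A) = carrier (GL2 A)}"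
proof -
  have sub: "carrier (GL2 A) \<subseteq> carrier (GL2 UNIV)" by (auto simp: GL2_carrier)
  have "M <#\<^bsub>GL2 UNIV\<^esub> carrier (GL2 A) #>\<^bsub>GL2 UNIV\<^esub> (inv\<^bsub>GL2 UNIV\<^esub> M) = (\<lambda>g. M ** g ** minv M) ` carrier (GL2 A)"
    if "det M \<noteq> 0" for M
    using that by (auto simp: l_coset_def r_coset_def GL2_mult GL2_inv)
  then show ?thesis
    unfolding GL2_normalizer_def normalizer_def stabilizer_def using sub by (auto simp: GL2_UNIV)
qed

section \<open>Homogeneous coordinates and the Moebius action\<close>

definition vec2 :: "'k \<Rightarrow> 'k \<Rightarrow> 'k::field^2"
  where "vec2 x y = vector [x, y]"

lemma vec2_nth [simp]: "vec2 x y $ 1 = x" "vec2 x y $ 2 = y"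
  by (simp_all add: vec2_def)

lemma vec_eq_2: "(v :: 'k::field^2) = w \<longleftrightarrow> v $ 1 = w $ 1 \<and> v $ 2 = w $ 2"
  unfolding vec_eq_iff forall_2 by blast

definition line_of :: "'k::field^2 \<Rightarrow> ('k^2) set"
  where "line_of v = {z *s v | z. z \<noteq> 0}"

lemma proj_point_eq: "proj_point x y = line_of (vec2 x y)"
proof -
  have "vector [z * x, z * y] = z *s vec2 x y" for z by (simp add: vec_eq_2)
  then show ?thesis unfolding proj_point_def line_of_def by simp
qed

lemma vec2_eta: "vec2 (v $ 1) (v $ 2) = v"
  by (simp add: vec_eq_2)

lemma proj_line_eq: "proj_line = {line_of v | v. v \<noteq> 0}"
proof -
  have "proj_line = {line_of (vec2 x y) | x y. vec2 x y \<noteq> 0}"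
    unfolding proj_line_def proj_point_eq by (simp add: vec_eq_2)
  also have "\<dots> = {line_of v | v. v \<noteq> 0}" by (metis vec2_eta)
  finally show ?thesis .
qed

lemma line_of_mem: "v \<in> line_of v"
  unfolding line_of_def by (intro CollectI exI[of _ 1]) simp

lemma line_of_scale: "z \<noteq> 0 \<Longrightarrow> line_of (z *s v) = line_of v"
proof -
  assume z: "z \<noteq> 0"
  have 1: "\<exists>w'. w' \<noteq> 0 \<and> w *s (z *s v) = w' *s v" if "w \<noteq> 0" for w
    using that z by (intro exI[of _ "w * z"]) simp
  have 2: "\<exists>w'. w' \<noteq> 0 \<and> w *s v = w' *s (z *s v)" if "w \<noteq> 0" for w
    using that z by (intro exI[of _ "w / z"]) simp
  show ?thesis unfolding line_of_def using 1 2 by blast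
qed

lemma moebius_line_of: "moebius M (line_of v) = line_of (M *v v)"
proof -
  have "M *v (z *s v) = z *s (M *v v)" for z by (rule vector_scalar_commute)
  then show ?thesis unfolding moebius_def line_of_def image_Collect by (metis (no_types, lifting))
qed

lemma mat_vec_scalar: "mat z *v v = z *s (v :: 'k::field^2)"
  by (simp add: vec_eq_2 mat_vec_2)

lemma mat_vec_nonzero: "det M \<noteq> 0 \<Longrightarrow> v \<noteq> 0 \<Longrightarrow> M *v (v :: 'k::field^2) \<noteq> 0"
  by (metis matrix_vector_mul_assoc matrix_vector_mul_lid matrix_vector_mult_0_right minv(2))

lemma scale_image_subset:
  fixes z :: "'k::field"
  assumes "z \<noteq> 0" "I \<subseteq> (*) (inverse z) ` J"
  shows "(*) z ` I \<subseteq> J"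
proof -
  have "(*) z ` I \<subseteq> (*) z ` (*) (inverse z) ` J" using assms(2) by (rule image_mono)
  also have "\<dots> = J" using assms(1) by (simp add: image_image flip: mult.assoc)
  finally show ?thesis .
qed

context field_subring
begin

text \<open>Entries outside R are allowed, and the result is then a submodule of the field. The same
  holds for \<open>q\<close>, which is applied to inverse matrices below.\<close>

definition vid :: "'k^2 \<Rightarrow> 'k set"
  where "vid v = point_ideal R (v $ 1) (v $ 2)"

abbreviation q :: "'k^2^2 \<Rightarrow> 'k set"
  where "q \<equiv> matrix_ideal R"

lemma PIdl_eq: "PIdl\<^bsub>subring_of R\<^esub> a = {r * a | r. r \<in> R}"
  by (simp add: cgenideal_def)

lemma set_add_eq: "I <+>\<^bsub>subring_of R\<^esub> J = {i + j | i j. i \<in> I \<and> j \<in> J}"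
  by (auto simp: set_add_def set_mult_def)

lemma submod_PIdl: "submod R (PIdl\<^bsub>subring_of R\<^esub> a)"
  using submod_principal[of a] unfolding PIdl_eq by (simp add: image_def mult.commute[of a] Bex_def conj_commute)

lemma submod_set_add: "submod R I \<Longrightarrow> submod R J \<Longrightarrow> submod R (I <+>\<^bsub>subring_of R\<^esub> J)"
  using submod_combinations[of I J 1 1] by (simp add: set_add_eq)

lemma set_add_upper: "submod R I \<Longrightarrow> submod R J \<Longrightarrow> I \<subseteq> I <+>\<^bsub>subring_of R\<^esub> J \<and> J \<subseteq> I <+>\<^bsub>subring_of R\<^esub> J"
  unfolding set_add_eq using submod_zero by force

lemma set_add_least: "submod R N \<Longrightarrow> I \<subseteq> N \<Longrightarrow> J \<subseteq> N \<Longrightarrow> I <+>\<^bsub>subring_of R\<^esub> J \<subseteq> N"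
  unfolding set_add_eq using submod_add by blast

lemma PIdl_mem: "a \<in> PIdl\<^bsub>subring_of R\<^esub> a"
  unfolding PIdl_eq using one by (intro CollectI exI[of _ 1]) simp

lemma PIdl_least: "submod R N \<Longrightarrow> a \<in> N \<Longrightarrow> PIdl\<^bsub>subring_of R\<^esub> a \<subseteq> N"
  unfolding PIdl_eq using submod_mult by blast

lemma submod_vid: "submod R (vid v)"
  unfolding vid_def point_ideal_def by (intro submod_set_add submod_PIdl)

lemma vid_mem: "v $ i \<in> vid v"
proof -
  have "\<forall>i. v $ i \<in> vid v"
    unfolding forall_2 vid_def point_ideal_def
    using set_add_upper[OF submod_PIdl submod_PIdl] PIdl_mem by blast
  then show ?thesis by blast
qed

lemma vid_least: "submod R N \<Longrightarrow> (\<And>i. v $ i \<in> N) \<Longrightarrow> vid v \<subseteq> N"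
  unfolding vid_def point_ideal_def by (intro set_add_least PIdl_least)

lemma submod_q: "submod R (q M)"
  unfolding matrix_ideal_def by (intro submod_set_add submod_PIdl)

lemma q_mem: "M $ i $ j \<in> q M"
proof -
  let ?P = "\<lambda>i j. PIdl\<^bsub>subring_of R\<^esub> (M $ i $ j)"
  note S = submod_PIdl submod_set_add[OF submod_PIdl submod_PIdl]
    submod_set_add[OF submod_set_add[OF submod_PIdl submod_PIdl] submod_PIdl]
  have "?P 1 1 \<subseteq> q M" "?P 1 2 \<subseteq> q M" "?P 2 1 \<subseteq> q M" "?P 2 2 \<subseteq> q M"
    unfolding matrix_ideal_def
    using set_add_upper[OF S(1) S(1), of "M $ 1 $ 1" "M $ 1 $ 2"]
      set_add_upper[OF S(2) S(1), of "M $ 1 $ 1" "M $ 1 $ 2" "M $ 2 $ 1"]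
      set_add_upper[OF S(3) S(1), of "M $ 1 $ 1" "M $ 1 $ 2" "M $ 2 $ 1" "M $ 2 $ 2"]
    by blast+
  then have "\<forall>i j. M $ i $ j \<in> q M" unfolding forall_2 using PIdl_mem by blast
  then show ?thesis by blast
qed

lemma q_least: "submod R N \<Longrightarrow> (\<And>i j. M $ i $ j \<in> N) \<Longrightarrow> q M \<subseteq> N"
  unfolding matrix_ideal_def by (intro set_add_least PIdl_least)

lemma submod_colon: "submod R N \<Longrightarrow> submod R {i. \<forall>j\<in>J. i * j \<in> N}"
  by (auto simp: submod_def distrib_right mult.assoc)

lemma iprod_q_subset:
  assumes N: "submod R N" and "\<And>i j x. x \<in> J \<Longrightarrow> M $ i $ j * x \<in> N"
  shows "iprod (q M) J \<subseteq> N"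
proof -
  have "q M \<subseteq> {i. \<forall>j\<in>J. i * j \<in> N}" using assms by (intro q_least submod_colon) auto
  then show ?thesis using N by (intro iprod_subset) auto
qed

lemma q_mult_subset: "q (M ** N) \<subseteq> iprod (q M) (q N)"
proof (rule q_least)
  show S: "submod R (iprod (q M) (q N))" using q_mem by (intro submod_iprod submod_q) blast
  show "(M ** N) $ i $ j \<in> iprod (q M) (q N)" for i j
    unfolding mat_mult_2 by (intro iprod_add iprod_mult q_mem)
qed

lemma vid_mult_subset: "vid (M *v v) \<subseteq> iprod (q M) (vid v)"
proof (rule vid_least)
  show S: "submod R (iprod (q M) (vid v))" using vid_mem by (intro submod_iprod submod_q) blast
  show "(M *v v) $ i \<in> iprod (q M) (vid v)" for i
    unfolding mat_vec_2 by (intro iprod_add iprod_mult q_mem vid_mem)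
qed

lemma vid_scale: assumes "z \<noteq> 0" shows "vid (z *s v) = (*) z ` vid v"
proof
  show "vid (z *s v) \<subseteq> (*) z ` vid v"
    using vid_mem by (intro vid_least submod_scale submod_vid) auto
  have "vid v \<subseteq> (*) (inverse z) ` vid (z *s v)"
  proof (intro vid_least submod_scale submod_vid)
    show "v $ i \<in> (*) (inverse z) ` vid (z *s v)" for i
      using assms vid_mem[of "z *s v" i] by (intro image_eqI[of _ _ "(z *s v) $ i"]) simp_all
  qed
  then show "(*) z ` vid v \<subseteq> vid (z *s v)" by (rule scale_image_subset[OF assms])
qed

lemma q_scale: assumes "z \<noteq> 0" shows "q (mat z ** M) = (*) z ` q M"
proof
  have e: "(mat z ** M) $ i $ j = z * M $ i $ j" for i j
  proof -
    have "\<forall>i j. (mat z ** M) $ i $ j = z * M $ i $ j" by (simp add: forall_2 mat_mult_2)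
    then show ?thesis by blast
  qed
  show "q (mat z ** M) \<subseteq> (*) z ` q M"
    using q_mem by (intro q_least submod_scale submod_q) (auto simp: e)
  have "q M \<subseteq> (*) (inverse z) ` q (mat z ** M)"
  proof (intro q_least submod_scale submod_q)
    show "M $ i $ j \<in> (*) (inverse z) ` q (mat z ** M)" for i j
      using assms q_mem[of "mat z ** M" i j] by (intro image_eqI[of _ _ "(mat z ** M) $ i $ j"]) (simp_all add: e)
  qed
  then show "(*) z ` q M \<subseteq> q (mat z ** M)" by (rule scale_image_subset[OF assms])
qed

text \<open>Says that q(M)^2 is contained in (det M); the opposite inclusion is automatic, as
  \<open>q_square\<close> shows.\<close>

definition normalizing :: "'k^2^2 \<Rightarrow> bool"
  where "normalizing M \<longleftrightarrow> det M \<noteq> 0 \<and> (\<forall>i j i' j'. M $ i $ j * M $ i' $ j' / det M \<in> R)"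

lemma GL2_iff: "g \<in> carrier (GL2 R) \<longleftrightarrow> (\<forall>i j. g $ i $ j \<in> R) \<and> det g \<noteq> 0 \<and> inverse (det g) \<in> R"
proof
  assume "g \<in> carrier (GL2 R)"
  then obtain h where g: "\<forall>i j. g $ i $ j \<in> R" "\<forall>i j. h $ i $ j \<in> R" "h ** g = mat 1" by (auto simp: GL2_carrier)
  have "det h * det g = 1" using g(3) by (metis det_I det_mul)
  then have "det g \<noteq> 0" "inverse (det g) = det h" by (auto simp: mult.commute intro: inverse_unique)
  moreover have "det h \<in> R" using g(2) by (auto simp: det_2 intro!: closed)
  ultimately show "(\<forall>i j. g $ i $ j \<in> R) \<and> det g \<noteq> 0 \<and> inverse (det g) \<in> R" using g by simp
next
  assume g: "(\<forall>i j. g $ i $ j \<in> R) \<and> det g \<noteq> 0 \<and> inverse (det g) \<in> R"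
  have "\<forall>i j. minv g $ i $ j \<in> R" using g by (auto simp: forall_2 minv_def divide_inverse intro!: closed)
  then show "g \<in> carrier (GL2 R)" using g minv[of g] by (auto simp: GL2_carrier)
qed

lemma GL2_normalizing: "g \<in> carrier (GL2 R) \<Longrightarrow> normalizing g"
  unfolding GL2_iff normalizing_def by (auto simp: divide_inverse intro!: closed)

text \<open>The entries of a conjugate are combinations, with entries of \<open>g\<close> up to sign
  as coefficients, of the quotients in \<open>normalizing\<close>. Integral quotients thus give
  integral conjugates, and special choices of \<open>g\<close> isolate single quotients.\<close>

lemma conj_entries:
  assumes "det M \<noteq> 0"
  shows "(M ** g ** minv M) $ 1 $ 1 = g $ 1 $ 1 * (M $ 1 $ 1 * M $ 2 $ 2 / det M) + g $ 2 $ 1 * (M $ 1 $ 2 * M $ 2 $ 2 / det M)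
      - g $ 1 $ 2 * (M $ 1 $ 1 * M $ 2 $ 1 / det M) - g $ 2 $ 2 * (M $ 1 $ 2 * M $ 2 $ 1 / det M)"
    "(M ** g ** minv M) $ 1 $ 2 = g $ 1 $ 2 * (M $ 1 $ 1 * M $ 1 $ 1 / det M) + g $ 2 $ 2 * (M $ 1 $ 1 * M $ 1 $ 2 / det M)
      - g $ 1 $ 1 * (M $ 1 $ 1 * M $ 1 $ 2 / det M) - g $ 2 $ 1 * (M $ 1 $ 2 * M $ 1 $ 2 / det M)"
    "(M ** g ** minv M) $ 2 $ 1 = g $ 1 $ 1 * (M $ 2 $ 1 * M $ 2 $ 2 / det M) + g $ 2 $ 1 * (M $ 2 $ 2 * M $ 2 $ 2 / det M)
      - g $ 1 $ 2 * (M $ 2 $ 1 * M $ 2 $ 1 / det M) - g $ 2 $ 2 * (M $ 2 $ 1 * M $ 2 $ 2 / det M)"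
    "(M ** g ** minv M) $ 2 $ 2 = g $ 1 $ 2 * (M $ 1 $ 1 * M $ 2 $ 1 / det M) + g $ 2 $ 2 * (M $ 1 $ 1 * M $ 2 $ 2 / det M)
      - g $ 1 $ 1 * (M $ 1 $ 2 * M $ 2 $ 1 / det M) - g $ 2 $ 1 * (M $ 1 $ 2 * M $ 2 $ 2 / det M)"
  unfolding mat_mult_2 minv_def mat2_nth using assms by (simp_all add: field_simps)

lemma normalizing_conj:
  assumes M: "normalizing M" and g: "g \<in> carrier (GL2 R)"
  shows "M ** g ** minv M \<in> carrier (GL2 R)"
proof -
  have det: "det M \<noteq> 0" using M by (simp add: normalizing_def)
  have M': "M $ i $ j * M $ i' $ j' / det M \<in> R" for i j i' j' using M by (simp add: normalizing_def)
  have g': "g $ i $ j \<in> R" for i j using g by (simp add: GL2_iff)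
  have "det (M ** g ** minv M) = det g" using det by (simp add: det_mul det_minv)
  moreover have "\<forall>i j. (M ** g ** minv M) $ i $ j \<in> R"
    unfolding forall_2 conj_entries[OF det] by (intro conjI add diff mult M' g')
  ultimately show ?thesis using g by (simp add: GL2_iff)
qed

lemma normalizing_minv: "normalizing M \<Longrightarrow> normalizing (minv M)"
proof -
  assume M: "normalizing M"
  have det: "det M \<noteq> 0" and M': "\<And>i j i' j'. M $ i $ j * M $ i' $ j' / det M \<in> R"
    using M by (auto simp: normalizing_def)
  have M'': "- (M $ i $ j * M $ i' $ j' / det M) \<in> R" for i j i' j' using uminus[OF M'] .
  show ?thesis
    unfolding normalizing_def forall_2 det_minv using det M' M'' by (simp add: minv_def field_simps)
qed

text \<open>Conjugates of the two elementary unipotent matrices and of \<open>(1 1; 1 0)\<close> yield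
  all products of two entries divided by the determinant.\<close>

lemma normalizer_iff_normalizing: "M \<in> GL2_normalizer R \<longleftrightarrow> normalizing M"
proof
  assume "M \<in> GL2_normalizer R"
  then have det: "det M \<noteq> 0" and c: "\<And>g. g \<in> carrier (GL2 R) \<Longrightarrow> M ** g ** minv M \<in> carrier (GL2 R)"
    by (auto simp: GL2_normalizer_eq)
  have R: "(M ** g ** minv M) $ i $ j \<in> R" if "g \<in> carrier (GL2 R)" for g i j
    using c[OF that] by (simp add: GL2_iff)
  let ?p = "\<lambda>i j i' j'. M $ i $ j * M $ i' $ j' / det M"
  \<comment> \<open>The identity part of the two unipotent matrices contributes this difference on
    the diagonal; subtracting 1 leaves a single quotient.\<close>
  have 11: "?p 1 1 2 2 - ?p 1 2 2 1 = 1" using det by (simp add: diff_divide_distrib[symmetric] det_2)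
  have g1: "mat2 1 1 0 1 \<in> carrier (GL2 R)" and g2: "mat2 1 0 1 1 \<in> carrier (GL2 R)" and g3: "mat2 1 1 1 0 \<in> carrier (GL2 R)"
    unfolding GL2_iff forall_2 by (simp_all add: det_2 zero one uminus)
  have a1: "?p 1 1 1 1 \<in> R" using R[OF g1, of 1 2] unfolding conj_entries[OF det] by simp
  have a2: "?p 2 1 2 1 \<in> R" using uminus[OF R[OF g1, of 2 1]] unfolding conj_entries[OF det] by simp
  have a3: "?p 1 1 2 1 \<in> R" using diff[OF R[OF g1, of 2 2] one] 11 unfolding conj_entries[OF det] by (simp add: algebra_simps)
  have b1: "?p 1 2 1 2 \<in> R" using uminus[OF R[OF g2, of 1 2]] unfolding conj_entries[OF det] by simp
  have b2: "?p 2 2 2 2 \<in> R" using R[OF g2, of 2 1] unfolding conj_entries[OF det] by simp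
  have b3: "?p 1 2 2 2 \<in> R" using diff[OF R[OF g2, of 1 1] one] 11 unfolding conj_entries[OF det] by (simp add: algebra_simps)
  have "?p 1 1 2 2 + ?p 1 2 2 2 - ?p 1 1 2 1 \<in> R" using R[OF g3, of 1 1] unfolding conj_entries[OF det] by simp
  from add[OF diff[OF this b3] a3] have c1: "?p 1 1 2 2 \<in> R" by simp
  have c2: "?p 1 2 2 1 \<in> R" using diff[OF c1 one] 11 by (simp add: algebra_simps)
  have "?p 1 1 1 1 - ?p 1 1 1 2 - ?p 1 2 1 2 \<in> R" using R[OF g3, of 1 2] unfolding conj_entries[OF det] by simp
  from diff[OF diff[OF a1 this] b1] have c3: "?p 1 1 1 2 \<in> R" by simp
  have "?p 2 1 2 2 + ?p 2 2 2 2 - ?p 2 1 2 1 \<in> R" using R[OF g3, of 2 1] unfolding conj_entries[OF det] by simp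
  from add[OF diff[OF this b2] a2] have c4: "?p 2 1 2 2 \<in> R" by simp
  show "normalizing M" unfolding normalizing_def forall_2
    using det a1 a2 a3 b1 b2 b3 c1 c2 c3 c4 by (simp add: mult.commute)
next
  assume M: "normalizing M"
  have det: "det M \<noteq> 0" using M by (simp add: normalizing_def)
  have "g \<in> (\<lambda>g. M ** g ** minv M) ` carrier (GL2 R)" if g: "g \<in> carrier (GL2 R)" for g
  proof (rule image_eqI)
    show "minv M ** g ** M \<in> carrier (GL2 R)"
      using normalizing_conj[OF normalizing_minv[OF M] g] by (simp add: minv_minv[OF det])
    have "M ** (minv M ** g ** M) ** minv M = (M ** minv M) ** g ** (M ** minv M)"
      by (simp add: matrix_mul_assoc)
    then show "g = M ** (minv M ** g ** M) ** minv M" by (simp add: minv[OF det])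
  qed
  then show "M \<in> GL2_normalizer R" using normalizing_conj[OF M] det by (auto simp: GL2_normalizer_eq)
qed

text \<open>Products of two entries are multiples of det M by assumption, and det M is itself a
  difference of two such products.\<close>

lemma q_square: assumes M: "normalizing M" shows "iprod (q M) (q M) = (*) (det M) ` R"
proof
  have det: "det M \<noteq> 0" and M': "\<And>i j i' j'. M $ i $ j * M $ i' $ j' / det M \<in> R"
    using M by (auto simp: normalizing_def)
  have p: "M $ i $ j * M $ i' $ j' \<in> (*) (det M) ` R" for i j i' j'
    using M'[of i j i' j'] det by (intro image_eqI[of _ _ "M $ i $ j * M $ i' $ j' / det M"]) simp_all
  have "q M \<subseteq> {x. \<forall>y\<in>{y. \<exists>i j. y = M $ i $ j}. x * y \<in> (*) (det M) ` R}"
    using p by (intro q_least submod_colon submod_principal) auto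
  then have "x * M $ i $ j \<in> (*) (det M) ` R" if "x \<in> q M" for x i j using that by blast
  then show "iprod (q M) (q M) \<subseteq> (*) (det M) ` R"
    by (intro iprod_q_subset submod_principal) (simp add: mult.commute)
  have S: "submod R (iprod (q M) (q M))" using q_mem by (intro submod_iprod submod_q) blast
  have "det M \<in> iprod (q M) (q M)" unfolding det_2
    by (intro submod_diff[OF S] iprod_mult q_mem)
  then show "(*) (det M) ` R \<subseteq> iprod (q M) (q M)" by (rule principal_subset[OF S])
qed

text \<open>For size two the adjugate has the entries of \<open>M\<close> up to sign and position,
  so q(M^-1) is q(M) scaled by 1/det M, and \<open>q_square\<close> applies.\<close>

lemma q_minv: assumes M: "normalizing M" shows "iprod (q M) (q (minv M)) = R"
proof -
  have det: "det M \<noteq> 0" using M by (simp add: normalizing_def)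
  have sub: "q (minv M) \<subseteq> (*) (inverse (det M)) ` q M" if "det M \<noteq> 0" for M
  proof (intro q_least submod_scale submod_q)
    have "\<forall>i j. minv M $ i $ j \<in> (*) (inverse (det M)) ` q M"
      unfolding forall_2 minv_def using q_mem[of M] submod_uminus[OF submod_q q_mem, of M]
      by (auto simp: image_iff divide_inverse mult.commute intro: bexI[of _ "M $ _ $ _"] bexI[of _ "- M $ _ $ _"])
    then show "minv M $ i $ j \<in> (*) (inverse (det M)) ` q M" for i j by blast
  qed
  have "q M \<subseteq> (*) (det M) ` q (minv M)" using sub[of "minv M"] det by (simp add: det_minv minv_minv)
  then have "(*) (inverse (det M)) ` q M \<subseteq> q (minv M)" using det by (intro scale_image_subset) simp_all
  then have qm: "q (minv M) = (*) (inverse (det M)) ` q M" using sub[OF det] by blast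
  also have "\<dots> = iprod ((*) (inverse (det M)) ` R) (q M)" by (rule iprod_principal[OF submod_q, symmetric])
  finally have "iprod (q M) (q (minv M)) = iprod ((*) (inverse (det M)) ` R) (iprod (q M) (q M))"
    by (metis iprod_assoc iprod_commute)
  also have "\<dots> = R" unfolding q_square[OF M] iprod_principal[OF submod_principal] using det by (simp add: image_image flip: mult.assoc)
  finally show ?thesis .
qed

lemma q_mult: assumes M: "normalizing M" shows "q (M ** N) = iprod (q M) (q N)"
proof
  have det: "det M \<noteq> 0" using M by (simp add: normalizing_def)
  have "N = minv M ** (M ** N)" by (simp add: matrix_mul_assoc minv[OF det])
  then have "q N \<subseteq> iprod (q (minv M)) (q (M ** N))" using q_mult_subset by metis
  then have "iprod (q M) (q N) \<subseteq> iprod (q M) (iprod (q (minv M)) (q (M ** N)))" by (intro iprod_mono) auto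
  also have "\<dots> = q (M ** N)" unfolding iprod_assoc[symmetric] q_minv[OF M] by (rule iprod_R[OF submod_q])
  finally show "iprod (q M) (q N) \<subseteq> q (M ** N)" .
qed (rule q_mult_subset)

lemma vid_mult: assumes M: "normalizing M" shows "vid (M *v v) = iprod (q M) (vid v)"
proof
  have det: "det M \<noteq> 0" using M by (simp add: normalizing_def)
  have "v = minv M *v (M *v v)" by (simp add: matrix_vector_mul_assoc minv[OF det])
  then have "vid v \<subseteq> iprod (q (minv M)) (vid (M *v v))" using vid_mult_subset by metis
  then have "iprod (q M) (vid v) \<subseteq> iprod (q M) (iprod (q (minv M)) (vid (M *v v)))" by (intro iprod_mono) auto
  also have "\<dots> = vid (M *v v)" unfolding iprod_assoc[symmetric] q_minv[OF M] by (rule iprod_R[OF submod_vid])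
  finally show "iprod (q M) (vid v) \<subseteq> vid (M *v v)" .
qed (rule vid_mult_subset)

lemma q_GL2: assumes g: "g \<in> carrier (GL2 R)" shows "q g = R"
proof
  show "q g \<subseteq> R" using g by (intro q_least submod_self) (simp add: GL2_iff)
  have "det g \<in> q g" unfolding det_2 using g q_mem
    by (intro submod_diff[OF submod_q] submod_mult[OF submod_q]) (auto simp: GL2_iff)
  then have "inverse (det g) * det g \<in> q g" using g by (intro submod_mult[OF submod_q]) (auto simp: GL2_iff)
  then have "1 \<in> q g" using g by (simp add: GL2_iff)
  then show "R \<subseteq> q g" using submod_mult[OF submod_q, of _ 1] by force
qed

text \<open>The identity q(M)^2 = (det M) becomes R = (det M), so the determinant is a unit.\<close>

lemma GL2_if_q: assumes M: "normalizing M" "q M = R" shows "M \<in> carrier (GL2 R)"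
proof -
  have "1 \<in> (*) (det M) ` R" using q_square[OF M(1)] one unfolding M(2) iprod_R[OF submod_self] by blast
  then have "inverse (det M) \<in> R" by (auto simp: inverse_unique)
  then show ?thesis using M q_mem[of M] by (auto simp: GL2_iff normalizing_def)
qed

end

section \<open>Cusps and the Quinn group\<close>

context field_subring
begin

section \<open>Orbits of points under GL2\<close>

lemma GL2_one_mem: "mat 1 \<in> carrier (GL2 R)"
  unfolding GL2_iff forall_2 by (simp add: zero one)

lemma GL2_mult_mem: "g \<in> carrier (GL2 R) \<Longrightarrow> h \<in> carrier (GL2 R) \<Longrightarrow> g ** h \<in> carrier (GL2 R)"
  unfolding GL2_iff by (auto simp: mat_mult_2 det_mul intro!: closed)

lemma GL2_minv_mem: assumes g: "g \<in> carrier (GL2 R)" shows "minv g \<in> carrier (GL2 R)"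
proof (rule GL2_if_q[OF normalizing_minv[OF GL2_normalizing[OF g]]])
  show "q (minv g) = R"
    using q_minv[OF GL2_normalizing[OF g]] unfolding q_GL2[OF g] iprod_R[OF submod_q] .
qed

lemma cusp_line_of: "cusp R (line_of v) = {line_of (g *v v) | g. g \<in> carrier (GL2 R)}"
  by (simp add: cusp_def orbit_def moebius_line_of)

lemma cusps_eq: "cusps R = {cusp R (line_of v) | v. v \<noteq> 0}"
  unfolding cusps_def orbits_def cusp_def proj_line_eq by blast

lemma cusp_pp_subset: "g \<in> carrier (GL2 R) \<Longrightarrow> cusp R (line_of (g *v v)) \<subseteq> cusp R (line_of v)"
  unfolding cusp_line_of by (auto simp: matrix_vector_mul_assoc intro: GL2_mult_mem)

lemma cusp_pp_GL2: assumes g: "g \<in> carrier (GL2 R)" shows "cusp R (line_of (g *v v)) = cusp R (line_of v)"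
proof
  have "minv g *v (g *v v) = v" using g by (simp add: matrix_vector_mul_assoc minv GL2_iff)
  then show "cusp R (line_of v) \<subseteq> cusp R (line_of (g *v v))"
    using cusp_pp_subset[OF GL2_minv_mem[OF g], of "g *v v"] by simp
qed (rule cusp_pp_subset[OF g])

lemma cusp_eq_imp:
  assumes "cusp R (line_of v) = cusp R (line_of v')"
  shows "ideal_class R (vid v) = ideal_class R (vid v')"
proof -
  have "line_of v' \<in> cusp R (line_of v')" unfolding cusp_line_of using GL2_one_mem by (intro CollectI exI[of _ "mat 1"]) simp
  then obtain g where g: "g \<in> carrier (GL2 R)" "line_of v' = line_of (g *v v)" using assms cusp_line_of by blast
  then have "v' \<in> line_of (g *v v)" using line_of_mem by metis
  then obtain z where z: "z \<noteq> 0" "v' = z *s (g *v v)" unfolding line_of_def by blast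
  have "vid v' = (*) z ` vid v"
    unfolding z(2) vid_scale[OF z(1)] vid_mult[OF GL2_normalizing[OF g(1)]] q_GL2[OF g(1)] iprod_R[OF submod_vid] ..
  then show ?thesis using ideal_class_scale[OF submod_vid z(1)] by simp
qed

text \<open>In this form closure under products follows from the multiplicativity of
  \<open>q\<close> and the determinant.\<close>

lemma normalizing_iff_q: "normalizing M \<longleftrightarrow> det M \<noteq> 0 \<and> iprod (q M) (q M) = (*) (det M) ` R"
proof
  assume "normalizing M"
  then show "det M \<noteq> 0 \<and> iprod (q M) (q M) = (*) (det M) ` R" using q_square by (simp add: normalizing_def)
next
  assume M: "det M \<noteq> 0 \<and> iprod (q M) (q M) = (*) (det M) ` R"
  have "M $ i $ j * M $ i' $ j' / det M \<in> R" for i j i' j'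
  proof -
    have "M $ i $ j * M $ i' $ j' \<in> (*) (det M) ` R" using iprod_mult[OF q_mem q_mem] M by blast
    then show ?thesis using M by auto
  qed
  then show "normalizing M" using M by (simp add: normalizing_def)
qed

lemma normalizing_mult: assumes "normalizing M" "normalizing N" shows "normalizing (M ** N)"
proof -
  have "iprod (q (M ** N)) (q (M ** N)) = iprod (iprod (q M) (q M)) (iprod (q N) (q N))"
    unfolding q_mult[OF assms(1)] by (metis iprod_assoc iprod_commute)
  also have "\<dots> = (*) (det (M ** N)) ` R"
    unfolding q_square[OF assms(1)] q_square[OF assms(2)] iprod_principal[OF submod_principal]
    by (simp add: image_image det_mul mult.assoc)
  finally show ?thesis using assms unfolding normalizing_iff_q by (simp add: det_mul)
qed

lemma normalizing_scalar: "z \<noteq> 0 \<Longrightarrow> normalizing (mat z)"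
  unfolding normalizing_def forall_2 by (simp add: det_2 zero one)

lemma mat_mat: "(mat z :: 'k^2^2) ** mat w = mat (z * w)"
  by (simp add: mat_eq_2 mat_mult_2)

section \<open>Cosets in the Quinn group and their action\<close>

lemma quinn_coset_eq: "quinn_coset R M = {mat z ** g ** M | z g. z \<noteq> 0 \<and> g \<in> carrier (GL2 R)}"
  unfolding quinn_coset_def scalars_GL2_def scalar_matrices_def r_coset_def set_mult_def GL2_mult by auto

text \<open>Scalars are central, and moving \<open>h\<close> to the left across \<open>M\<close>
  conjugates it; for normalizing \<open>M\<close> the conjugate stays in GL2(R).\<close>

lemma quinn_coset_mult:
  "(mat z ** g ** M) ** (mat w ** h ** N) = mat (z * w) ** (g ** (M ** h ** minv M)) ** (M ** N)"
  if "det M \<noteq> 0" for M N g h :: "'k^2^2"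
proof -
  have "mat (z * w) ** (g ** (M ** h ** minv M)) ** (M ** N)
      = mat z ** (mat w ** (g ** M)) ** h ** (minv M ** M) ** N"
    by (simp add: matrix_mul_assoc flip: mat_mat)
  also have "\<dots> = mat z ** ((g ** M) ** mat w) ** h ** N"
    by (simp only: mat_mult_scalar minv[OF that] matrix_mul_rid)
  finally show ?thesis by (simp add: matrix_mul_assoc)
qed

lemma quinn_coset_subset:
  assumes "z \<noteq> 0" "g \<in> carrier (GL2 R)"
  shows "quinn_coset R (mat z ** g ** M) \<subseteq> quinn_coset R M"
proof
  fix L assume "L \<in> quinn_coset R (mat z ** g ** M)"
  then obtain w h where w: "w \<noteq> 0" "h \<in> carrier (GL2 R)" "L = mat w ** h ** (mat z ** g ** M)"
    unfolding quinn_coset_eq by blast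
  have "mat w ** h ** (mat z ** g ** M) = mat w ** (h ** mat z) ** g ** M" by (simp add: matrix_mul_assoc)
  also have "\<dots> = mat w ** (mat z ** h) ** g ** M" by (simp only: mat_mult_scalar)
  also have "\<dots> = mat (w * z) ** (h ** g) ** M" by (simp add: matrix_mul_assoc flip: mat_mat)
  finally show "L \<in> quinn_coset R M"
    unfolding quinn_coset_eq using w assms GL2_mult_mem by fastforce
qed

lemma quinn_coset_mem: "M \<in> quinn_coset R M"
  unfolding quinn_coset_eq using GL2_one_mem by (intro CollectI exI[of _ 1] exI[of _ "mat 1"]) simp

text \<open>If q(N) = z q(M), then L = z^-1 N M^-1 is normalizing with q(L) = R. Hence L is in
  GL2(R) by \<open>GL2_if_q\<close>, and N = z L M.\<close>

lemma quinn_coset_eq_iff: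
  assumes M: "normalizing M" and N: "normalizing N"
  shows "quinn_coset R M = quinn_coset R N \<longleftrightarrow> ideal_class R (q M) = ideal_class R (q N)"
proof
  assume "quinn_coset R M = quinn_coset R N"
  then have "N \<in> quinn_coset R M" using quinn_coset_mem by blast
  then obtain z g where z: "z \<noteq> 0" "g \<in> carrier (GL2 R)" "N = mat z ** g ** M" unfolding quinn_coset_eq by blast
  have "q N = (*) z ` q M"
    unfolding z(3) matrix_mul_assoc[symmetric] q_scale[OF z(1)] q_mult[OF GL2_normalizing[OF z(2)]] q_GL2[OF z(2)]
      iprod_R[OF submod_q] ..
  then show "ideal_class R (q M) = ideal_class R (q N)" using ideal_class_scale[OF submod_q z(1)] by simp
next
  assume "ideal_class R (q M) = ideal_class R (q N)"
  then obtain z where z: "z \<noteq> 0" "q N = (*) z ` q M" using ideal_class_eq_iff[OF submod_q submod_q] by blast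
  have detM: "det M \<noteq> 0" using M by (simp add: normalizing_def)
  define L where "L = mat (inverse z) ** (N ** minv M)"
  have "normalizing L" unfolding L_def using z(1) by (intro normalizing_mult normalizing_scalar N normalizing_minv M) simp
  moreover have "q L = R"
  proof -
    have "q L = (*) (inverse z) ` iprod (q N) (q (minv M))"
      unfolding L_def using z(1) by (simp add: q_scale q_mult[OF N])
    also have "iprod (q N) (q (minv M)) = iprod (iprod ((*) z ` R) (q M)) (q (minv M))"
      unfolding z(2) iprod_principal[OF submod_q] ..
    also have "\<dots> = (*) z ` R"
      unfolding iprod_assoc q_minv[OF M] by (rule iprod_R_right[OF submod_principal])
    finally show ?thesis using z(1) by (simp add: image_image flip: mult.assoc)
  qed
  ultimately have L: "L \<in> carrier (GL2 R)" by (rule GL2_if_q)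
  have "mat z ** L = N ** minv M"
    unfolding L_def matrix_mul_assoc mat_mat using z(1) by simp
  then have "mat z ** L ** M = N ** (minv M ** M)" by (simp add: matrix_mul_assoc)
  then have N_eq: "N = mat z ** L ** M" using minv[OF detM] by simp
  have detL: "det L \<noteq> 0" using L by (simp add: GL2_iff)
  have "mat (inverse z) ** minv L ** N = mat (inverse z) ** (minv L ** mat z) ** L ** M"
    unfolding N_eq by (simp add: matrix_mul_assoc)
  also have "\<dots> = mat (inverse z) ** (mat z ** minv L) ** L ** M" by (simp only: mat_mult_scalar)
  also have "\<dots> = (mat (inverse z) ** mat z) ** (minv L ** L) ** M" by (simp add: matrix_mul_assoc)
  also have "\<dots> = M" using z(1) by (simp add: mat_mat minv[OF detL])
  finally have M_eq: "M = mat (inverse z) ** minv L ** N" ..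
  have "quinn_coset R N \<subseteq> quinn_coset R M" using quinn_coset_subset[OF z(1) L, of M] N_eq by simp
  moreover have "quinn_coset R M \<subseteq> quinn_coset R N"
    using quinn_coset_subset[OF _ GL2_minv_mem[OF L], of "inverse z" N] M_eq z(1) by simp
  ultimately show "quinn_coset R M = quinn_coset R N" by blast
qed

lemma quinn_coset_set_mult:
  assumes M: "normalizing M"
  shows "quinn_coset R M <#>\<^bsub>GL2 UNIV\<^esub> quinn_coset R N = quinn_coset R (M ** N)"
proof
  have det: "det M \<noteq> 0" using M by (simp add: normalizing_def)
  show "quinn_coset R M <#>\<^bsub>GL2 UNIV\<^esub> quinn_coset R N \<subseteq> quinn_coset R (M ** N)"
  proof
    fix L assume "L \<in> quinn_coset R M <#>\<^bsub>GL2 UNIV\<^esub> quinn_coset R N"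
    then obtain z g w h where z: "z \<noteq> 0" "w \<noteq> 0" "g \<in> carrier (GL2 R)" "h \<in> carrier (GL2 R)"
      "L = (mat z ** g ** M) ** (mat w ** h ** N)" unfolding set_mult_def GL2_mult quinn_coset_eq by blast
    then show "L \<in> quinn_coset R (M ** N)"
      unfolding quinn_coset_eq[of "M ** N"] quinn_coset_mult[OF det]
      using GL2_mult_mem[OF z(3) normalizing_conj[OF M z(4)]]
      by (intro CollectI exI[of _ "z * w"] exI[of _ "g ** (M ** h ** minv M)"]) auto
  qed
  show "quinn_coset R (M ** N) \<subseteq> quinn_coset R M <#>\<^bsub>GL2 UNIV\<^esub> quinn_coset R N"
  proof
    fix L assume "L \<in> quinn_coset R (M ** N)"
    then obtain z g where "z \<noteq> 0" "g \<in> carrier (GL2 R)" "L = mat z ** g ** (M ** N)" unfolding quinn_coset_eq by blast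
    then have "mat z ** g ** M \<in> quinn_coset R M" "L = (mat z ** g ** M) ** N"
      unfolding quinn_coset_eq by (auto simp: matrix_mul_assoc)
    then show "L \<in> quinn_coset R M <#>\<^bsub>GL2 UNIV\<^esub> quinn_coset R N"
      unfolding set_mult_def GL2_mult using quinn_coset_mem[of N] by blast
  qed
qed

lemma carrier_Quinn: "carrier (Quinn R) = {quinn_coset R M | M. normalizing M}"
  unfolding Quinn_def FactGroup_def RCOSETS_def quinn_coset_def r_coset_def
  by (auto simp: normalizer_iff_normalizing)

lemma Quinn_mult: "C \<otimes>\<^bsub>Quinn R\<^esub> D = C <#>\<^bsub>GL2 UNIV\<^esub> D"
  by (simp add: Quinn_def FactGroup_def set_mult_def)

text \<open>Scalars fix every point and \<open>h\<close> crosses \<open>M\<close> as a conjugate in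
  GL2(R), so all the images make up one orbit: the induced action is well defined.\<close>

lemma quinn_act_eq:
  assumes M: "normalizing M"
  shows "quinn_act (quinn_coset R M) (cusp R (line_of v)) = cusp R (line_of (M *v v))"
proof
  have det: "det M \<noteq> 0" using M by (simp add: normalizing_def)
  show "quinn_act (quinn_coset R M) (cusp R (line_of v)) \<subseteq> cusp R (line_of (M *v v))"
  proof
    fix p assume "p \<in> quinn_act (quinn_coset R M) (cusp R (line_of v))"
    then obtain z g h where z: "z \<noteq> 0" "g \<in> carrier (GL2 R)" "h \<in> carrier (GL2 R)"
      "p = moebius (mat z ** g ** M) (line_of (h *v v))"
      unfolding quinn_act_def quinn_coset_eq cusp_line_of by blast
    have "g ** (M ** h ** minv M) *v (M *v v) = g ** M ** h ** (minv M ** M) *v v"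
      by (simp add: matrix_vector_mul_assoc matrix_mul_assoc)
    then have "g ** (M ** h ** minv M) *v (M *v v) = g ** M ** h *v v" by (simp add: minv[OF det])
    moreover have "p = line_of (z *s (g ** M ** h *v v))"
      unfolding z(4) moebius_line_of by (simp add: matrix_vector_mul_assoc matrix_mul_assoc flip: mat_vec_scalar)
    ultimately have "p = line_of (g ** (M ** h ** minv M) *v (M *v v))" using line_of_scale[OF z(1)] by simp
    then show "p \<in> cusp R (line_of (M *v v))"
      unfolding cusp_line_of using GL2_mult_mem[OF z(2) normalizing_conj[OF M z(3)]] by blast
  qed
  show "cusp R (line_of (M *v v)) \<subseteq> quinn_act (quinn_coset R M) (cusp R (line_of v))"
  proof
    fix p assume "p \<in> cusp R (line_of (M *v v))"
    then obtain g where g: "g \<in> carrier (GL2 R)" "p = line_of (g *v (M *v v))" unfolding cusp_line_of by blast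
    have "mat 1 ** g ** M \<in> quinn_coset R M" unfolding quinn_coset_eq using g(1)
      by (intro CollectI exI[of _ 1] exI[of _ g]) simp
    moreover have "line_of v \<in> cusp R (line_of v)" unfolding cusp_line_of using GL2_one_mem by (intro CollectI exI[of _ "mat 1"]) simp
    moreover have "p = moebius (mat 1 ** g ** M) (line_of v)" unfolding g(2) moebius_line_of by (simp add: matrix_vector_mul_assoc)
    ultimately show "p \<in> quinn_act (quinn_coset R M) (cusp R (line_of v))" unfolding quinn_act_def by blast
  qed
qed

end

context fraction_ring
begin

section \<open>Ideal classes of vectors and matrices, and the two identifications\<close>

lemma common_denominator: "finite S \<Longrightarrow> \<exists>d\<in>R. d \<noteq> 0 \<and> (\<forall>s\<in>S. d * s \<in> R)"
proof (induction S rule: finite_induct)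
  case empty
  then show ?case using one by (intro bexI[of _ 1]) auto
next
  case (insert s S)
  then obtain d where d: "d \<in> R" "d \<noteq> 0" "\<And>s. s \<in> S \<Longrightarrow> d * s \<in> R" by blast
  obtain e where e: "e \<in> R" "e \<noteq> 0" "e * s \<in> R" using fractions by blast
  have "d * e * t \<in> R" if "t \<in> insert s S" for t
  proof (cases "t = s")
    case True
    then show ?thesis using mult[OF d(1) e(3)] by (simp add: mult.assoc)
  next
    case False
    then show ?thesis using mult[OF e(1) d(3)[of t]] that by (simp add: mult_ac)
  qed
  then show ?case using d e mult by (intro bexI[of _ "d * e"]) auto
qed

lemma frac_vid: assumes "v \<noteq> 0" shows "frac (vid v)"
proof -
  obtain d where d: "d \<in> R" "d \<noteq> 0" "\<And>i. d * v $ i \<in> R" using common_denominator[of "range (($) v)"] by auto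
  have "vid v \<subseteq> {z. d * z \<in> R}" using d(3) by (intro vid_least submod_preimage submod_self) auto
  moreover obtain i where "v $ i \<noteq> 0" using assms by (auto simp: vec_eq_iff)
  then have "vid v \<noteq> {0}" using vid_mem[of v i] by auto
  ultimately show ?thesis unfolding frac_def using submod_vid d by blast
qed

lemma frac_q: assumes M: "normalizing M" shows "frac (q M)"
proof -
  obtain d where d: "d \<in> R" "d \<noteq> 0" "\<And>i j. d * M $ i $ j \<in> R"
    using common_denominator[of "(\<lambda>(i, j). M $ i $ j) ` UNIV"] by auto
  have "q M \<subseteq> {z. d * z \<in> R}" using d(3) by (intro q_least submod_preimage submod_self) auto
  moreover have "det M \<noteq> 0" using M by (simp add: normalizing_def)
  then have "M $ 1 $ 1 \<noteq> 0 \<or> M $ 1 $ 2 \<noteq> 0" by (auto simp: det_2)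
  then have "q M \<noteq> {0}" using q_mem[of M 1 1] q_mem[of M 1 2] by auto
  ultimately show ?thesis unfolding frac_def using submod_q d by blast
qed

lemma vid_eq: "vid v = {r * v $ 1 + s * v $ 2 | r s. r \<in> R \<and> s \<in> R}"
  unfolding vid_def point_ideal_def set_add_eq PIdl_eq by blast

text \<open>Every class comes from a cusp: scaled into R, \<open>I\<close> has two generators, and
  these are the coordinates.\<close>

lemma frac_class_vid: assumes I: "frac I" shows "\<exists>v. v \<noteq> 0 \<and> (\<forall>i. v $ i \<in> R) \<and> ideal_class R I = ideal_class R (vid v)"
proof -
  obtain d where d: "d \<noteq> 0" "(*) d ` I \<subseteq> R" using frac_to_ideal[OF I] by blast
  obtain c where c: "c \<in> I" "c \<noteq> 0" using frac_nonzero[OF I] by blast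
  have S: "submod R ((*) d ` I)" using submod_scale[OF frac_submod[OF I]] .
  obtain b where b: "b \<in> (*) d ` I" "(*) d ` I = {r * (d * c) + s * b | r s. r \<in> R \<and> s \<in> R}"
    using ideal_two_generated[OF S d(2), of "d * c"] c d(1) by auto
  have "(*) d ` I = vid (vec2 (d * c) b)" unfolding vid_eq vec2_nth using b(2) .
  then have "ideal_class R I = ideal_class R (vid (vec2 (d * c) b))"
    using ideal_class_scale[OF frac_submod[OF I] d(1)] by simp
  moreover have "vec2 (d * c) b \<noteq> 0" using c d(1) by (simp add: vec_eq_2)
  moreover have "\<forall>i. vec2 (d * c) b $ i \<in> R" unfolding forall_2 using b(1) c(1) d(2) by auto
  ultimately show ?thesis by blast
qed

text \<open>Equal ideals have equal inverses, so the coefficients \<open>s\<close>, \<open>t\<close>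
  found for \<open>v\<close> are also integral against \<open>w\<close>, and conversely. This makes
  the entries of \<open>g\<close> integral.\<close>

lemma same_ideal_GL2:
  assumes v: "v \<noteq> 0" "w \<noteq> 0" and eq: "vid v = vid w"
  shows "\<exists>g\<in>carrier (GL2 R). w = g *v v"
proof -
  obtain s t where st: "v $ 1 * s + v $ 2 * t = 1" "v $ 1 * s \<in> R" "v $ 1 * t \<in> R" "v $ 2 * s \<in> R" "v $ 2 * t \<in> R"
    using pair_inverse[of "v $ 1" "v $ 2"] v(1) by (auto simp: vec_eq_2)
  obtain s' t' where st': "w $ 1 * s' + w $ 2 * t' = 1" "w $ 1 * s' \<in> R" "w $ 1 * t' \<in> R" "w $ 2 * s' \<in> R" "w $ 2 * t' \<in> R"
    using pair_inverse[of "w $ 1" "w $ 2"] v(2) by (auto simp: vec_eq_2)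
  have S: "submod R {z. c * z \<in> R}" for c by (rule submod_preimage[OF submod_self])
  have sub: "vid u \<subseteq> {z. c * z \<in> R}" if "u $ 1 * c \<in> R" "u $ 2 * c \<in> R" for u c
  proof -
    have "\<forall>i. c * u $ i \<in> R" using that by (simp add: forall_2 mult.commute)
    then show ?thesis by (intro vid_least S) auto
  qed
  note A = sub[OF st(2,4)] sub[OF st(3,5)] and B = sub[OF st'(2,4)] sub[OF st'(3,5)]
  have ws: "s * w $ i \<in> R" "t * w $ i \<in> R" for i using A vid_mem[of w i] eq by auto
  have vs: "s' * v $ i \<in> R" "t' * v $ i \<in> R" for i using B vid_mem[of v i] eq by auto
  \<comment> \<open>\<open>g\<close> is the column \<open>w\<close> times the row (s, t), plus the
    column (t', -s') times the row (v_2, -v_1). The first summand maps \<open>v\<close> to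
    \<open>w\<close>, the second kills \<open>v\<close> and makes the determinant 1.\<close>
  define g where "g = mat2 (s * w $ 1 + t' * v $ 2) (t * w $ 1 - t' * v $ 1)
    (s * w $ 2 - s' * v $ 2) (t * w $ 2 + s' * v $ 1)"
  have "det g = (v $ 1 * s + v $ 2 * t) * (w $ 1 * s' + w $ 2 * t')"
    unfolding g_def det_2 mat2_nth by (simp add: algebra_simps)
  then have "det g = 1" using st(1) st'(1) by simp
  moreover have "\<forall>i j. g $ i $ j \<in> R" unfolding forall_2 g_def mat2_nth using ws vs by (intro conjI add diff)
  ultimately have "g \<in> carrier (GL2 R)" by (simp add: GL2_iff one)
  moreover have "g *v v = w"
  proof -
    have "(g *v v) $ 1 = (v $ 1 * s + v $ 2 * t) * w $ 1" "(g *v v) $ 2 = (v $ 1 * s + v $ 2 * t) * w $ 2"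
      unfolding mat_vec_2 g_def mat2_nth by (simp_all add: algebra_simps)
    then show ?thesis by (simp add: vec_eq_2 st(1))
  qed
  ultimately show ?thesis by metis
qed

lemma cusp_eq_iff:
  assumes v: "v \<noteq> 0" "w \<noteq> 0"
  shows "cusp R (line_of v) = cusp R (line_of w) \<longleftrightarrow> ideal_class R (vid v) = ideal_class R (vid w)"
proof
  assume "ideal_class R (vid v) = ideal_class R (vid w)"
  then obtain z where z: "z \<noteq> 0" "vid w = (*) z ` vid v" using ideal_class_eq_iff[OF submod_vid submod_vid] by blast
  then have "vid (z *s v) = vid w" by (simp add: vid_scale)
  moreover have "z *s v \<noteq> 0" using v z by simp
  ultimately obtain g where "g \<in> carrier (GL2 R)" "w = g *v (z *s v)" using same_ideal_GL2 v(2) by blast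
  then show "cusp R (line_of v) = cusp R (line_of w)" using cusp_pp_GL2[of g "z *s v"] line_of_scale[OF z(1)] by simp
qed (rule cusp_eq_imp)

text \<open>The coordinate vector is chosen arbitrarily, and \<open>cusp_eq_imp\<close> shows
  independence of the choice; for \<open>\<Psi>\<close> this is the role of
  \<open>quinn_coset_eq_iff\<close>.\<close>

definition \<Phi> where "\<Phi> w = ideal_class R (vid (SOME v. v \<noteq> 0 \<and> w = cusp R (line_of v)))"

definition \<Psi> where "\<Psi> C = ideal_class R (q (SOME M. normalizing M \<and> C = quinn_coset R M))"

lemma \<Phi>_cusp: assumes "v \<noteq> 0" shows "\<Phi> (cusp R (line_of v)) = ideal_class R (vid v)"
proof -
  define u where "u = (SOME u. u \<noteq> 0 \<and> cusp R (line_of v) = cusp R (line_of u))"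
  have "u \<noteq> 0 \<and> cusp R (line_of v) = cusp R (line_of u)" unfolding u_def by (rule someI[of _ v]) (simp add: assms)
  then show ?thesis using cusp_eq_imp unfolding \<Phi>_def u_def[symmetric] by metis
qed

lemma \<Psi>_coset: assumes "normalizing M" shows "\<Psi> (quinn_coset R M) = ideal_class R (q M)"
proof -
  define N where "N = (SOME N. normalizing N \<and> quinn_coset R M = quinn_coset R N)"
  have "normalizing N \<and> quinn_coset R M = quinn_coset R N" unfolding N_def by (rule someI[of _ M]) (simp add: assms)
  then show ?thesis using quinn_coset_eq_iff[OF assms] unfolding \<Psi>_def N_def[symmetric] by metis
qed

lemma \<Phi>_bij: "bij_betw \<Phi> (cusps R) (carrier (class_group R))"
  unfolding bij_betw_def
proof
  show "inj_on \<Phi> (cusps R)"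
  proof (rule inj_onI)
    fix w w' assume "w \<in> cusps R" "w' \<in> cusps R" and eq: "\<Phi> w = \<Phi> w'"
    then obtain v v' where "v \<noteq> 0" "w = cusp R (line_of v)" "v' \<noteq> 0" "w' = cusp R (line_of v')" unfolding cusps_eq by blast
    then show "w = w'" using eq cusp_eq_iff \<Phi>_cusp by simp
  qed
  show "\<Phi> ` cusps R = carrier (class_group R)"
  proof
    show "\<Phi> ` cusps R \<subseteq> carrier (class_group R)"
      unfolding cusps_eq carrier_class_group using \<Phi>_cusp frac_vid by auto
    show "carrier (class_group R) \<subseteq> \<Phi> ` cusps R"
    proof
      fix c assume "c \<in> carrier (class_group R)"
      then obtain v where "v \<noteq> 0" "c = ideal_class R (vid v)" unfolding carrier_class_group using frac_class_vid by blast
      then show "c \<in> \<Phi> ` cusps R" unfolding cusps_eq using \<Phi>_cusp[of v] by blast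
    qed
  qed
qed

lemma class_group_2_carrier:
  "carrier (class_group_2 R) = {ideal_class R I | I. frac I \<and> (\<exists>z. z \<noteq> 0 \<and> iprod I I = (*) z ` R)}"
proof -
  have "ideal_class R I \<otimes>\<^bsub>class_group R\<^esub> ideal_class R I = \<one>\<^bsub>class_group R\<^esub> \<longleftrightarrow> (\<exists>z. z \<noteq> 0 \<and> iprod I I = (*) z ` R)"
    if "frac I" for I
    unfolding class_mult[OF that that] one_class_group
    using ideal_class_eq_iff[OF submod_self frac_submod[OF frac_iprod[OF that that]]] by metis
  then show ?thesis unfolding class_group_2_def carrier_class_group by auto
qed

text \<open>A square root \<open>I = aA + bA\<close> of a principal ideal \<open>zA\<close> is realised by completing the column
  \<open>(a, b)\<close> to a matrix of determinant \<open>z\<close> with entries in \<open>I\<close>.\<close>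

lemma square_root_realised:
  assumes v: "v \<noteq> 0" and z: "z \<noteq> 0" "iprod (vid v) (vid v) = (*) z ` R"
  shows "\<exists>M. normalizing M \<and> q M = vid v"
proof -
  obtain s t where st: "v $ 1 * s + v $ 2 * t = 1" "v $ 1 * s \<in> R" "v $ 1 * t \<in> R" "v $ 2 * s \<in> R" "v $ 2 * t \<in> R"
    using pair_inverse[of "v $ 1" "v $ 2"] v by (auto simp: vec_eq_2)
  have zI: "z \<in> iprod (vid v) (vid v)" unfolding z(2) using one by force
  \<comment> \<open>If \<open>c\<close> maps the ideal I of \<open>v\<close> into R, it maps I^2,
    which contains \<open>z\<close>, into I. This applies to \<open>s\<close> and
    \<open>t\<close>.\<close>
  have "c * z \<in> vid v" if "c * v $ 1 \<in> R" "c * v $ 2 \<in> R" for c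
  proof -
    have "\<forall>i. c * v $ i \<in> R" using that by (simp add: forall_2)
    then have "vid v \<subseteq> {x. c * x \<in> R}" by (intro vid_least submod_preimage submod_self) auto
    then have "x * y \<in> {x. c * x \<in> vid v}" if "x \<in> vid v" "y \<in> vid v" for x y
      using that submod_mult[OF submod_vid, of "c * x" y v] by (auto simp: mult.assoc)
    then show ?thesis using iprod_subset[OF submod_preimage[OF submod_vid], of "vid v" "vid v" c v] zI by blast
  qed
  then have sz: "s * z \<in> vid v" "- (t * z) \<in> vid v" using st submod_uminus[OF submod_vid] by (simp_all add: mult.commute)
  define M where "M = mat2 (v $ 1) (- (t * z)) (v $ 2) (s * z)"
  have "det M = (v $ 1 * s + v $ 2 * t) * z" unfolding M_def det_2 mat2_nth by (simp add: algebra_simps)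
  then have det: "det M = z" using st(1) by simp
  have "\<forall>i j. M $ i $ j \<in> vid v" unfolding forall_2 M_def mat2_nth using sz vid_mem by blast
  then have "q M \<subseteq> vid v" by (intro q_least submod_vid) blast
  moreover have "\<forall>i. v $ i \<in> q M" using q_mem[of M 1 1] q_mem[of M 2 1] by (simp add: forall_2 M_def)
  then have "vid v \<subseteq> q M" by (intro vid_least submod_q) blast
  ultimately have "q M = vid v" by blast
  then show ?thesis using z det by (auto simp: normalizing_iff_q)
qed

lemma \<Psi>_iso: "\<Psi> \<in> iso (Quinn R) (class_group_2 R)"
  unfolding iso_def
proof (intro CollectI conjI homI)
  have mem: "\<Psi> C \<in> carrier (class_group_2 R)" if C: "C \<in> carrier (Quinn R)" for C
  proof -
    obtain M where M: "normalizing M" "C = quinn_coset R M" using C unfolding carrier_Quinn by blast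
    have "det M \<noteq> 0" using M by (simp add: normalizing_def)
    then show ?thesis unfolding M(2) \<Psi>_coset[OF M(1)] class_group_2_carrier
      using frac_q[OF M(1)] q_square[OF M(1)] by blast
  qed
  then show "\<Psi> C \<in> carrier (class_group_2 R)" if "C \<in> carrier (Quinn R)" for C using that .
  show "\<Psi> (C \<otimes>\<^bsub>Quinn R\<^esub> D) = \<Psi> C \<otimes>\<^bsub>class_group_2 R\<^esub> \<Psi> D"
    if CD: "C \<in> carrier (Quinn R)" "D \<in> carrier (Quinn R)" for C D
  proof -
    obtain M N where MN: "normalizing M" "C = quinn_coset R M" "normalizing N" "D = quinn_coset R N" using CD[unfolded carrier_Quinn] by blast
    have "\<Psi> (C \<otimes>\<^bsub>Quinn R\<^esub> D) = ideal_class R (iprod (q M) (q N))"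
      unfolding Quinn_mult MN quinn_coset_set_mult[OF MN(1)] \<Psi>_coset[OF normalizing_mult[OF MN(1,3)]] q_mult[OF MN(1)] ..
    also have "\<dots> = \<Psi> C \<otimes>\<^bsub>class_group R\<^esub> \<Psi> D"
      unfolding MN \<Psi>_coset[OF MN(1)] \<Psi>_coset[OF MN(3)] class_mult[OF frac_q[OF MN(1)] frac_q[OF MN(3)]] ..
    finally show ?thesis by (simp add: class_group_2_def)
  qed
  show "bij_betw \<Psi> (carrier (Quinn R)) (carrier (class_group_2 R))"
    unfolding bij_betw_def
  proof
    show "inj_on \<Psi> (carrier (Quinn R))"
    proof (rule inj_onI)
      fix C D assume "C \<in> carrier (Quinn R)" "D \<in> carrier (Quinn R)" and eq: "\<Psi> C = \<Psi> D"
      then obtain M N where "normalizing M" "C = quinn_coset R M" "normalizing N" "D = quinn_coset R N" unfolding carrier_Quinn by blast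
      then show "C = D" using eq quinn_coset_eq_iff \<Psi>_coset by simp
    qed
    have "c \<in> \<Psi> ` carrier (Quinn R)" if c: "c \<in> carrier (class_group_2 R)" for c
    proof -
      obtain I where I: "frac I" "c = ideal_class R I" using c unfolding class_group_2_carrier by blast
      obtain v where v: "v \<noteq> 0" "c = ideal_class R (vid v)" using frac_class_vid[OF I(1)] I(2) by blast
      \<comment> \<open>Having order dividing 2 is a property of the class, so \<open>vid v\<close>
        is again a square root of a principal ideal.\<close>
      have "ideal_class R (iprod (vid v) (vid v)) = ideal_class R R"
        using c class_mult[OF frac_vid[OF v(1)] frac_vid[OF v(1)]] v(2) one_class_group by (simp add: class_group_2_def)
      then obtain z where "z \<noteq> 0" "iprod (vid v) (vid v) = (*) z ` R"
        using ideal_class_eq_iff[OF submod_self frac_submod[OF frac_iprod[OF frac_vid[OF v(1)] frac_vid[OF v(1)]]]] by metis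
      then obtain M where M: "normalizing M" "q M = vid v" using square_root_realised[OF v(1)] by blast
      then have "c = \<Psi> (quinn_coset R M)" using \<Psi>_coset v(2) by simp
      then show ?thesis unfolding carrier_Quinn using M(1) by blast
    qed
    then show "\<Psi> ` carrier (Quinn R) = carrier (class_group_2 R)" using mem by blast
  qed
qed

lemma quinn_act_class:
  assumes "C \<in> carrier (Quinn R)" "w \<in> cusps R"
  shows "quinn_act C w \<in> cusps R \<and> \<Phi> (quinn_act C w) = \<Psi> C \<otimes>\<^bsub>class_group R\<^esub> \<Phi> w"
proof -
  obtain M where M: "normalizing M" "C = quinn_coset R M" using assms(1) unfolding carrier_Quinn by blast
  obtain v where v: "v \<noteq> 0" "w = cusp R (line_of v)" using assms(2) unfolding cusps_eq by blast
  have Mv: "M *v v \<noteq> 0" using mat_vec_nonzero[of M v] M(1) v(1) by (simp add: normalizing_def)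
  have "\<Phi> (cusp R (line_of (M *v v))) = ideal_class R (iprod (q M) (vid v))"
    unfolding \<Phi>_cusp[OF Mv] vid_mult[OF M(1)] ..
  also have "\<dots> = \<Psi> C \<otimes>\<^bsub>class_group R\<^esub> \<Phi> w"
    unfolding M v \<Psi>_coset[OF M(1)] \<Phi>_cusp[OF v(1)] class_mult[OF frac_q[OF M(1)] frac_vid[OF v(1)]] ..
  finally show ?thesis unfolding M(2) v(2) quinn_act_eq[OF M(1)] using Mv unfolding cusps_eq by blast
qed

lemma point_ideal_vid: "point_ideal R x y = vid (vec2 x y)"
  by (simp add: vid_def)

end

theorem theorem6p1:
  fixes k Pinf A :: "'k::field set"
  assumes "function_field_over_finite_field k"
    and "is_place k Pinf"
    and "A = integral_outside k Pinf"
  shows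
    "(\<forall>p\<in>proj_line. \<forall>x\<in>A. \<forall>y\<in>A. p = proj_point x y \<longrightarrow>
       (\<forall>a\<in>A. \<forall>b\<in>A. \<forall>c\<in>A. \<forall>d\<in>A. mat2 a b c d \<in> GL2_normalizer A \<longrightarrow>
          moebius (mat2 a b c d) p = proj_point (a * x + b * y) (c * x + d * y) \<and>
          ideal_class A (point_ideal A (a * x + b * y) (c * x + d * y))
            = ideal_class A (matrix_ideal A (mat2 a b c d) \<cdot>\<^bsub>subring_of A\<^esub> point_ideal A x y) \<and>
          ideal_class A (matrix_ideal A (mat2 a b c d) \<cdot>\<^bsub>subring_of A\<^esub> point_ideal A x y)
            = ideal_class A (matrix_ideal A (mat2 a b c d)) \<otimes>\<^bsub>class_group A\<^esub>
              ideal_class A (point_ideal A x y)))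
     \<and>
     (\<exists>\<Phi> \<Psi>.
        (\<forall>x\<in>A. \<forall>y\<in>A. (x, y) \<noteq> (0, 0) \<longrightarrow>
           \<Phi> (cusp A (proj_point x y)) = ideal_class A (point_ideal A x y)) \<and>
        bij_betw \<Phi> (cusps A) (carrier (class_group A)) \<and>
        (\<forall>M\<in>GL2_normalizer A. (\<forall>i j. M $ i $ j \<in> A) \<longrightarrow>
           \<Psi> (quinn_coset A M) = ideal_class A (matrix_ideal A M)) \<and>
        \<Psi> \<in> iso (Quinn A) (class_group_2 A) \<and>
        (\<forall>C\<in>carrier (Quinn A). \<forall>w\<in>cusps A.
           quinn_act C w \<in> cusps A \<and>
           \<Phi> (quinn_act C w) = \<Psi> C \<otimes>\<^bsub>class_group A\<^esub> \<Phi> w))"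
proof -
  interpret function_field k using function_field_if_over_finite_field[OF assms(1)] .
  interpret A: fraction_ring A unfolding assms(3) by (rule fraction_ring_integral_outside[OF assms(2)])
  have part1: "moebius (mat2 a b c d) p = proj_point (a * x + b * y) (c * x + d * y) \<and>
          ideal_class A (point_ideal A (a * x + b * y) (c * x + d * y))
            = ideal_class A (iprod (matrix_ideal A (mat2 a b c d)) (point_ideal A x y)) \<and>
          ideal_class A (iprod (matrix_ideal A (mat2 a b c d)) (point_ideal A x y))
            = ideal_class A (matrix_ideal A (mat2 a b c d)) \<otimes>\<^bsub>class_group A\<^esub>
              ideal_class A (point_ideal A x y)"
    if p: "p \<in> proj_line" "p = proj_point x y" and M: "mat2 a b c d \<in> GL2_normalizer A" for p x y a b c d
  proof -
    define v where "v = vec2 x y"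
    define M where "M = mat2 a b c d"
    have nM: "A.normalizing M" using M A.normalizer_iff_normalizing by (simp add: M_def)
    have Mv: "vec2 (a * x + b * y) (c * x + d * y) = M *v v"
      by (simp add: vec_eq_2 mat_vec_2 M_def v_def)
    \<comment> \<open>Membership in \<open>proj_line\<close> excludes the pair (0, 0), whose
      \<open>proj_point\<close> consists of the zero vector only.\<close>
    obtain u where u: "u \<noteq> 0" "line_of v = line_of u" using p unfolding proj_line_eq proj_point_eq v_def by blast
    then obtain z where "z \<noteq> 0" "v = z *s u" using line_of_mem[of v] unfolding line_of_def by blast
    then have v0: "v \<noteq> 0" using u by simp
    show ?thesis
      unfolding p(2) proj_point_eq moebius_line_of A.point_ideal_vid Mv v_def[symmetric] M_def[symmetric] A.vid_mult[OF nM]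
        A.class_mult[OF A.frac_q[OF nM] A.frac_vid[OF v0]] by simp
  qed
  show ?thesis
    unfolding iprod_subring_of
  proof (intro conjI exI[of _ A.\<Phi>] exI[of _ A.\<Psi>])
    show "\<forall>x\<in>A. \<forall>y\<in>A. (x, y) \<noteq> (0, 0) \<longrightarrow> A.\<Phi> (cusp A (proj_point x y)) = ideal_class A (point_ideal A x y)"
      using A.\<Phi>_cusp unfolding proj_point_eq A.point_ideal_vid by (simp add: vec_eq_2)
    show "\<forall>M\<in>GL2_normalizer A. (\<forall>i j. M $ i $ j \<in> A) \<longrightarrow> A.\<Psi> (quinn_coset A M) = ideal_class A (matrix_ideal A M)"
      using A.\<Psi>_coset A.normalizer_iff_normalizing by blast
  qed (intro ballI impI part1 A.\<Phi>_bij A.\<Psi>_iso A.quinn_act_class; assumption)+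
qed

end
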